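(* Let $\nu$ be a splitting law, let $(P(u))_{u\in\mathcal T^\infty}$ be i.i.d. with law $\nu$, let $\mathbf U=(U_i)_{i\ge1}$ be i.i.d. uniform on $[0,1)$, and let $\mathbf Y=(Y^u)_{u\in\mathcal T^\infty}$ be i.i.d. with $\mathrm{Dir}_2(\frac12)$ distribution, these three families being independent. Let $F_n=F(n,\mathbf U,\mathbf Y)$ be the associated fragmentation trees, $t_n$ the underlying ternary tree of $F_n$, $I^u$ the interval marking the node $u\in\mathcal T^\infty$, $m_n$ the compact triangulation associated with $t_n$ and $(P(u))_{u\in t_n^0}$, and $\mu_n=\frac1n\sum_{x\in\mathcal V(m_n)}\delta_x$ its occupation measure ($n\ge1$). Let $\mu$ be the a.s. unique random measure on $\tilde T$ such that a.s., for every $u\in\mathcal T^\infty$, $\mu(\tilde T(u))=|I^u|$ and $\mu(\partial\tilde T(u))=0$. Then $\mu_n\to\mu$ as $n\to\infty$, where the convergence holds in distribution in the set of probability measures on $\tilde T$ equipped with the topology of weak convergence.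
   Context: $A=(0,0)$, $B=(1,0)$, $C=e^{i\pi/3}$ in $\mathbb R^2\cong\mathbb C$; $T=[AB]\cup[BC]\cup[CA]$ and $\tilde T$ is the filled (closed) triangle. A splitting law is a probability distribution $\nu$ on $\mathbb R_+^3$ such that if $P=(P_1,P_2,P_3)\sim\nu$ then the law of $P$ is invariant under permutations of coordinates, $P_i>0$ a.s. for each $i$, and $P_1+P_2+P_3=1$ a.s. $\mathcal T^\infty=\bigcup_{n\ge0}\{1,2,3\}^n$. A ternary tree is a set $t\subseteq\mathcal T^\infty$ containing the empty word $\emptyset$, closed under removing the last letter, where each $u\in t$ has either none (leaf) or all three (internal node) of the children $u(1),u(2),u(3)$ in $t$; $t^0$ is its set of internal nodes. Triangles. From $(P(u))_{u\in\mathcal T^\infty}$ define for each $u$ an ordered triple of points: $(A_\emptyset,B_\emptyset,C_\emptyset)=(A,B,C)$; $M_u=P_1(u)A_u+P_2(u)B_u+P_3(u)C_u$; the triples of $u(1),u(2),u(3)$ are $(M_u,B_u,C_u)$, $(A_u,M_u,C_u)$, $(A_u,B_u,M_u)$. $\tilde T(u)$ is the filled triangle with vertices $A_u,B_u,C_u$, and $\partial\tilde T(u)$ its boundary. The compact triangulation associated with a finite ternary tree $t$ and $(P(u))_{u\in t^0}$ is $m=T\cup\bigcup_{u\in t^0}([A_uM_u]\cup[B_uM_u]\cup[C_uM_u])$, with internal vertex set $\mathcal V(m)=\{M_u:u\in t^0\}$. Fragmentation trees. $\mathrm{Dir}_2(\frac12)$ is the symmetric Dirichlet distribution with parameters $(\frac12,\frac12,\frac12)$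 on the simplex $\{x\in\mathbb R^3:x_i\ge0,\ x_1+x_2+x_3=1\}$. Intervals: $I^\emptyset=[0,1)$, and if $I^u=[a,b)$ and $Y^u=(y_1,y_2,y_3)$ then $I^{u(1)}=[a,a+(b-a)y_1)$, $I^{u(2)}=[a+(b-a)y_1,a+(b-a)(y_1+y_2))$, $I^{u(3)}=[a+(b-a)(y_1+y_2),b)$. $|I^u|$ is the length of $I^u$. $F_0$ is the tree $\{\emptyset\}$ with mark $I^\emptyset$; given $F_k$ (a ternary tree with $k$ internal nodes, each node $u$ marked with $I^u$, the leaf intervals partitioning $[0,1)$), $F_{k+1}$ is obtained by giving three children, with their interval marks, to the unique leaf $l$ of $F_k$ with $U_{k+1}\in I^l$. *)

theory Defs
  imports "HOL-Probability.Probability"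
begin

text \<open>
  Words over the alphabet \<open>{1, 2, 3}\<close> are lists over the three-element type \<^typ>\<open>3\<close>, the index type
  of \<^typ>\<open>real ^ 3\<close> (in which \<open>3 = 0\<close>), written with the last letter first: the child \<open>u(i)\<close> of \<open>u\<close>
  is \<open>i # u\<close>, and removing the last letter is \<^term>\<open>tl\<close>.
\<close>

type_synonym node = "3 list"

definition leaves :: "node set \<Rightarrow> node set" where
  "leaves t = {u \<in> t. \<forall>i. i # u \<notin> t}"

definition internal_nodes :: "node set \<Rightarrow> node set" where
  "internal_nodes t = {u \<in> t. \<forall>i. i # u \<in> t}"


section \<open>Laws and independence\<close>

definition splitting_law :: "(real ^ 3) measure \<Rightarrow> bool" where
  "splitting_law \<nu> \<longleftrightarrow>
     prob_space \<nu> \<and> sets \<nu> = sets borel \<and>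
     (\<forall>\<pi>. bij \<pi> \<longrightarrow> distr \<nu> borel (\<lambda>x. \<chi> i. x $ \<pi> i) = \<nu>) \<and>
     (\<forall>i. AE x in \<nu>. x $ i > 0) \<and>
     (AE x in \<nu>. x $ 1 + x $ 2 + x $ 3 = 1)"

text \<open>
  The symmetric Dirichlet law with parameters \<open>(\<alpha>, \<alpha>, \<alpha>)\<close>, given by the density of its first two
  coordinates with respect to Lebesgue measure.
\<close>

definition dirichlet2 :: "real \<Rightarrow> (real ^ 3) measure" where
  "dirichlet2 \<alpha> =
     distr
       (density lborel (\<lambda>(x :: real, y :: real).
          ennreal (if x > 0 \<and> y > 0 \<and> x + y < 1
            then Gamma (3 * \<alpha>) / Gamma \<alpha> ^ 3 *
                 (x powr (\<alpha> - 1) * y powr (\<alpha> - 1) * (1 - x - y) powr (\<alpha> - 1))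
            else 0)))
       borel (\<lambda>(x, y). vector [x, y, 1 - x - y])"

definition iid ::
    "'w measure \<Rightarrow> 'b::topological_space measure \<Rightarrow> ('i \<Rightarrow> 'w \<Rightarrow> 'b) \<Rightarrow> 'i set \<Rightarrow> bool" where
  "iid M N X I \<longleftrightarrow>
     prob_space.indep_vars M (\<lambda>_. borel) X I \<and> (\<forall>i\<in>I. distr M borel (X i) = N)"

definition generated_events ::
    "'w measure \<Rightarrow> ('i \<Rightarrow> 'w \<Rightarrow> 'b::topological_space) \<Rightarrow> 'i set \<Rightarrow> 'w set set" where
  "generated_events M X I =
     sigma_sets (space M) (\<Union>i\<in>I. {X i -` A \<inter> space M | A. A \<in> sets borel})"


section \<open>Triangles and triangulations\<close>

primrec triangle :: "(node \<Rightarrow> real ^ 3) \<Rightarrow> node \<Rightarrow> complex \<times> complex \<times> complex" where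
  "triangle p [] = (0, 1, exp (\<i> * pi / 3))"
| "triangle p (i # u) =
     (let (a, b, c) = triangle p u;
          m = (p u $ 1) *\<^sub>R a + (p u $ 2) *\<^sub>R b + (p u $ 3) *\<^sub>R c
      in if i = 1 then (m, b, c) else if i = 2 then (a, m, c) else (a, b, m))"

definition inner_vertex :: "(node \<Rightarrow> real ^ 3) \<Rightarrow> node \<Rightarrow> complex" where
  "inner_vertex p u =
     (let (a, b, c) = triangle p u
      in (p u $ 1) *\<^sub>R a + (p u $ 2) *\<^sub>R b + (p u $ 3) *\<^sub>R c)"

definition filled_triangle :: "(node \<Rightarrow> real ^ 3) \<Rightarrow> node \<Rightarrow> complex set" where
  "filled_triangle p u = (let (a, b, c) = triangle p u in convex hull {a, b, c})"

definition root_triangle :: "complex set" where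
  "root_triangle = convex hull {0, 1, exp (\<i> * pi / 3)}"

text \<open>
  The compact triangulation of \<open>t\<close> and \<open>p\<close> as a plane set, followed by its internal vertex set. Like
  the set itself, the latter is given in terms of \<open>t\<close> and \<open>p\<close>, and occupation measures depend on the
  triangulation only through it.
\<close>

definition compact_triangulation :: "node set \<Rightarrow> (node \<Rightarrow> real ^ 3) \<Rightarrow> complex set" where
  "compact_triangulation t p =
     closed_segment 0 1 \<union> closed_segment 1 (exp (\<i> * pi / 3)) \<union> closed_segment (exp (\<i> * pi / 3)) 0 \<union>
     (\<Union>u\<in>internal_nodes t.
        let (a, b, c) = triangle p u; m = inner_vertex p u
        in closed_segment a m \<union> closed_segment b m \<union> closed_segment c m)"

definition internal_vertices :: "node set \<Rightarrow> (node \<Rightarrow> real ^ 3) \<Rightarrow> complex set" where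
  "internal_vertices t p = inner_vertex p ` internal_nodes t"

text \<open>
  \<open>(1/n) \<Sum>\<^bsub>x \<in> V\<^esub> \<delta>\<^bsub>x\<^esub>\<close> as a measure on the root triangle: the sum of Dirac masses is the
  image of the counting measure on \<open>V\<close> under the inclusion.
\<close>

definition occupation_measure :: "nat \<Rightarrow> complex set \<Rightarrow> complex measure" where
  "occupation_measure n V =
     scale_measure (ennreal (1 / real n))
       (distr (count_space V) (restrict_space borel root_triangle) (\<lambda>x. x))"


section \<open>Fragmentation trees\<close>

primrec interval_bounds :: "(node \<Rightarrow> real ^ 3) \<Rightarrow> node \<Rightarrow> real \<times> real" where
  "interval_bounds y [] = (0, 1)"
| "interval_bounds y (i # u) =
     (let (a, b) = interval_bounds y u;
          c = a + (b - a) * (y u $ 1);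
          d = a + (b - a) * (y u $ 1 + y u $ 2)
      in if i = 1 then (a, c) else if i = 2 then (c, d) else (d, b))"

definition frag_interval :: "(node \<Rightarrow> real ^ 3) \<Rightarrow> node \<Rightarrow> real set" where
  "frag_interval y u = (let (a, b) = interval_bounds y u in {a..<b})"

text \<open>
  The underlying tree of the fragmentation tree; the mark of a node \<open>u\<close> is \<open>frag_interval y u\<close>
  throughout, so it is not stored.
\<close>

primrec frag_tree :: "nat \<Rightarrow> (nat \<Rightarrow> real) \<Rightarrow> (node \<Rightarrow> real ^ 3) \<Rightarrow> node set" where
  "frag_tree 0 x y = {[]}"
| "frag_tree (Suc k) x y =
     (let t = frag_tree k x y;
          l = (THE l. l \<in> leaves t \<and> x (Suc k) \<in> frag_interval y l)
      in t \<union> range (\<lambda>i. i # l))"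


section \<open>Convergence in distribution\<close>

text \<open>The weak topology on the set of Borel probability measures on \<open>S\<close>.\<close>

definition weak_topology :: "'a::topological_space set \<Rightarrow> 'a measure topology" where
  "weak_topology S =
     topology_generated_by
       {{N \<in> space (prob_algebra (restrict_space borel S)). (\<integral>x. f x \<partial>N) \<in> V} | (f :: 'a \<Rightarrow> real) V.
          continuous_on S f \<and> bounded (f ` S) \<and> open V}"

definition borel_of :: "'a topology \<Rightarrow> 'a measure" where
  "borel_of T = sigma (topspace T) {U. openin T U}"

text \<open>
  Random elements of \<open>T\<close> are allowed to be ill-defined (even to leave \<open>T\<close>) on a null set, hence
  the measurable versions \<open>Z\<close> and \<open>Z'\<close>; the choice of versions does not matter.
\<close>

definition converges_in_distribution ::
    "'w measure \<Rightarrow> 'a topology \<Rightarrow> (nat \<Rightarrow> 'w \<Rightarrow> 'a) \<Rightarrow> ('w \<Rightarrow> 'a) \<Rightarrow> bool" where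
  "converges_in_distribution M T X X' \<longleftrightarrow>
     (\<exists>Z Z'. (\<forall>n. Z n \<in> M \<rightarrow>\<^sub>M borel_of T) \<and> Z' \<in> M \<rightarrow>\<^sub>M borel_of T \<and>
        (\<forall>n. AE \<omega> in M. Z n \<omega> = X n \<omega>) \<and> (AE \<omega> in M. Z' \<omega> = X' \<omega>) \<and>
        (\<forall>\<Phi>. continuous_map T euclideanreal \<Phi> \<and> bounded (\<Phi> ` topspace T) \<longrightarrow>
           (\<lambda>n. \<integral>\<omega>. \<Phi> (Z n \<omega>) \<partial>M) \<longlonglongrightarrow> (\<integral>\<omega>. \<Phi> (Z' \<omega>) \<partial>M)))"

end

theory Submission
  imports Defs "HOL-Library.Sublist"
begin

text \<open>
  The convergence even holds almost surely. The internal nodes of \<open>t\<^sub>n\<close> are the leaves split by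
  \<open>U\<^sub>1, \<dots>, U\<^sub>n\<close>, so the number of them below \<open>u\<close> is, up to \<open>|u|\<close>, the number of \<open>U\<^sub>i\<close> in \<open>I\<^sup>u\<close>; by
  the law of large numbers the mass that \<open>\<mu>\<^sub>n\<close> gives to the vertices below \<open>u\<close> tends to \<open>|I\<^sup>u|\<close>, the
  mass of \<open>\<mu>\<close> on the triangle of \<open>u\<close>. A continuous function \<open>f\<close> satisfies
  \<open>|f(x) - f(y)| \<le> \<epsilon> + C |x - y|\<^sup>2\<close>, so the integrals against \<open>\<mu>\<^sub>n\<close> and \<open>\<mu>\<close> are both compared with
  a sum over the words of length \<open>k\<close>, with an error controlled by the sum \<open>X\<^sub>k\<close> of \<open>|I\<^sup>u|\<close> times
  the squared edge lengths of the triangle of \<open>u\<close>. Since all coordinates have mean \<open>1/3\<close> and the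
  weights of intervals and triangles are independent, the mean of \<open>X\<^sub>k\<close> is at most a constant times
  \<open>(7/9)\<^sup>k\<close>. The triangles of the words of length \<open>k\<close> cover the root triangle and have total
  \<open>\<mu>\<close>-mass 1, so their overlaps are automatically null.
\<close>

text \<open>The triangles do not shrink uniformly: a child of index 3 keeps the edge [AB] of its
  parent, so every level contains a triangle with an edge of length 1. Smallness is therefore sought
  only after weighting by |I^u|. The rate 7/9 is (1/3) * (7/3). The factor 1/3 is the mean of a
  Dirichlet coordinate. As for 7/3, each edge of a triangle survives in exactly one child, which
  gives 1, while each segment ending at M_u lies in two children; by Leibniz' formula these segments
  contribute at most 2 (p_i + p_j) per squared edge, of mean 2 (1/3 + 1/3). One good level k per
  tolerance is enough, so it suffices that the infimum of the X_k has mean zero. The endpoints of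
  I^u are random, so the law of large numbers is needed for all half-lines at once. The
  \<open>THE\<close> in the recursion of the trees is meaningful only for proper weights and points
  in [0,1); a measurable event of probability one on which this holds also yields the measurable
  versions that convergence in distribution requires.\<close>

definition weights :: "(node \<Rightarrow> real ^ 3) \<Rightarrow> bool" where
  "weights p \<longleftrightarrow> (\<forall>u. (\<forall>i. p u $ i > 0) \<and> (\<Sum>i\<in>UNIV. p u $ i) = 1)"

lemma weights_pos: "weights p \<Longrightarrow> p u $ i > 0"
  and weights_sum: "weights p \<Longrightarrow> (\<Sum>i\<in>UNIV. p u $ i) = 1"
  by (auto simp: weights_def)

section \<open>Fragmentation trees\<close>

definition frag_length :: "(node \<Rightarrow> real ^ 3) \<Rightarrow> node \<Rightarrow> real" where
  "frag_length y u = snd (interval_bounds y u) - fst (interval_bounds y u)"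

lemma frag_length_Nil [simp]: "frag_length y [] = 1"
  by (simp add: frag_length_def)

lemma neq_3 [simp]: "(3::3) \<noteq> 1" "(3::3) \<noteq> 2" "(2::3) \<noteq> 1" "(1::3) \<noteq> 2" "(1::3) \<noteq> 3" "(2::3) \<noteq> 3"
  by simp_all

text \<open>The third child ends at the right end of its parent by definition, so its length is the
  parent's length times the third weight only because the weights add up to one.\<close>

lemma frag_length_Cons:
  assumes "weights y"
  shows "frag_length y (i # u) = frag_length y u * y u $ i"
proof -
  have "y u $ 3 = 1 - y u $ 1 - y u $ 2"
    using weights_sum[OF assms, of u] by (simp add: sum_3)
  then show ?thesis
    using exhaust_3[of i] by (auto simp: frag_length_def Let_def split_beta right_diff_distrib distrib_left)
qed

lemma frag_length_pos: "weights y \<Longrightarrow> frag_length y u > 0"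
  by (induction u) (auto simp: frag_length_Cons weights_pos)

lemma measure_frag_interval: "weights y \<Longrightarrow> measure lborel (frag_interval y u) = frag_length y u"
  using frag_length_pos[of y u] by (simp add: frag_interval_def frag_length_def split_beta)

lemma sum_Cons_3: "(\<Sum>u | length u = Suc k. f u) = (\<Sum>u | length u = k. \<Sum>i\<in>UNIV. f (i # u))"
  for f :: "node \<Rightarrow> 'a::comm_monoid_add"
proof -
  have "{u :: node. length u = Suc k} = (\<lambda>(u, i). i # u) ` ({u. length u = k} \<times> UNIV)"
    by (auto simp: length_Suc_conv image_iff)
  moreover have "inj_on (\<lambda>(u, i :: 3). i # u) ({u. length u = k} \<times> UNIV)"
    by (auto simp: inj_on_def)
  ultimately show ?thesis
    by (simp add: sum.reindex sum.cartesian_product case_prod_unfold)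
qed

lemma finite_length_node [simp]: "finite {u :: node. length u = k}" "finite {u :: node. length u < k}"
proof -
  show "finite {u :: node. length u = k}"
    using finite_lists_length_eq[of "UNIV :: 3 set" k] by simp
  show "finite {u :: node. length u < k}"
    by (rule finite_subset[OF _ finite_lists_length_le[of "UNIV :: 3 set" k]]) auto
qed

lemma sum_frag_length: "weights y \<Longrightarrow> (\<Sum>u | length u = k. frag_length y u) = 1"
proof (induction k)
  case (Suc k)
  then show ?case
    by (simp add: sum_Cons_3 frag_length_Cons weights_sum flip: sum_distrib_left)
qed simp

lemma frag_interval_Nil [simp]: "frag_interval y [] = {0..<1}"
  by (simp add: frag_interval_def)

text \<open>Unique existence expresses covering and disjointness of the three child intervals at
  once. Both follow from the strict order of the four cut points.\<close>

lemma frag_interval_children: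
  assumes "weights y"
  shows "x \<in> frag_interval y u \<longleftrightarrow> (\<exists>!i. x \<in> frag_interval y (i # u))" (is ?iff)
    and "frag_interval y (i # u) \<subseteq> frag_interval y u" (is ?subset)
proof -
  obtain a b where ab: "interval_bounds y u = (a, b)" by fastforce
  define c where "c = a + (b - a) * (y u $ 1)"
  define d where "d = a + (b - a) * (y u $ 1 + y u $ 2)"
  have len: "b - a > 0"
    using frag_length_pos[OF assms, of u] by (simp add: frag_length_def ab)
  have d2: "d = c + (b - a) * y u $ 2" by (simp add: c_def d_def algebra_simps)
  have "y u $ 2 = 1 - y u $ 1 - y u $ 3"
    using weights_sum[OF assms, of u] by (simp add: sum_3)
  then have b3: "b = d + (b - a) * y u $ 3" unfolding d_def by (simp only:) (simp add: algebra_simps)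
  have "(b - a) * y u $ i > 0" for i using len weights_pos[OF assms] by simp
  then have ord: "a < c" "c < d" "d < b"
    using d2 b3 by (auto simp: c_def) (smt (verit))+
  have ch: "frag_interval y (1 # u) = {a..<c}" "frag_interval y (2 # u) = {c..<d}"
    "frag_interval y (3 # u) = {d..<b}" "frag_interval y u = {a..<b}"
    by (auto simp: frag_interval_def ab Let_def c_def d_def)
  have ex_3: "(\<exists>i. Q i) \<longleftrightarrow> Q 1 \<or> Q 2 \<or> Q 3" for Q :: "3 \<Rightarrow> bool"
    using forall_3[of "\<lambda>i. \<not> Q i"] by blast
  show ?iff
    unfolding Ex1_def ex_3 forall_3 ch using ord by auto
  show ?subset
    using exhaust_3[of i] ord by (auto simp: ch)
qed

lemma frag_interval_suffix:
  assumes "weights y" "suffix u v"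
  shows "frag_interval y v \<subseteq> frag_interval y u"
  using assms(2)
proof (induction v)
  case (Cons i v)
  then show ?case
    using frag_interval_children(2)[OF assms(1), of i v] by (auto simp: suffix_Cons)
qed simp

text \<open>The intervals form a tree under inclusion: words with a common point are comparable. In
  the case of equal lengths the tails agree by induction and the last letters by disjointness of
  siblings.\<close>

lemma frag_interval_Int_suffix:
  assumes "weights y" "x \<in> frag_interval y u" "x \<in> frag_interval y v" "length u \<le> length v"
  shows "suffix u v"
  using assms(2-)
proof (induction v arbitrary: u)
  case (Cons i v)
  have xv: "x \<in> frag_interval y v"
    using Cons.prems frag_interval_children(2)[OF assms(1)] by blast
  show ?case
  proof (cases "length u \<le> length v")
    case True
    then show ?thesis using Cons xv by (auto simp: suffix_Cons)
  next
    case False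
    then obtain j w where u: "u = j # w" "length w = length v"
      using Cons.prems by (cases u) auto
    have "x \<in> frag_interval y w"
      using Cons.prems frag_interval_children(2)[OF assms(1)] u by blast
    then have "w = v" using Cons.IH[OF _ xv] u(2)
      by (metis order_refl suffix_order.antisym suffix_length_suffix xv suffix_def append_eq_append_conv self_append_conv2)
    then have "j = i"
      using frag_interval_children(1)[OF assms(1), of x v] Cons.prems xv u by blast
    then show ?thesis using u \<open>w = v\<close> by simp
  qed
qed simp

text \<open>The index is that of the tree being split, and the splitting point is
  \<open>x (Suc k)\<close>. With this shift the internal nodes of the tree of index k are the values
  at 0, ..., k - 1.\<close>

definition split_leaf :: "(nat \<Rightarrow> real) \<Rightarrow> (node \<Rightarrow> real ^ 3) \<Rightarrow> nat \<Rightarrow> node" where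
  "split_leaf x y k =
     (THE l. l \<in> leaves (frag_tree k x y) \<and> x (Suc k) \<in> frag_interval y l)"

lemma frag_tree_Suc: "frag_tree (Suc k) x y = frag_tree k x y \<union> range (\<lambda>i. i # split_leaf x y k)"
  by (simp add: split_leaf_def Let_def)

text \<open>The facts are proved together because they depend on each other: the definite
  description picks a leaf only if the leaf intervals partition [0,1), and this partition survives a
  split only if the tree is closed under taking parents.\<close>

lemma
  assumes y: "weights y" and x: "\<forall>i\<ge>1. x i \<in> {0..<1}"
  shows frag_tree_leaf_ex1: "z \<in> {0..<1} \<Longrightarrow> \<exists>!l. l \<in> leaves (frag_tree k x y) \<and> z \<in> frag_interval y l"
    and split_leaf_leaf: "split_leaf x y k \<in> leaves (frag_tree k x y)"
    and split_leaf_interval: "x (Suc k) \<in> frag_interval y (split_leaf x y k)"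
    and internal_nodes_frag_tree: "internal_nodes (frag_tree k x y) = split_leaf x y ` {..<k}"
    and frag_tree_length: "u \<in> frag_tree k x y \<Longrightarrow> length u \<le> k"
proof -
  \<comment> \<open>Stated under the assumption of a unique leaf, so that it serves both inside the
    induction and after it.\<close>
  have spl: "split_leaf x y k \<in> leaves (frag_tree k x y) \<and> x (Suc k) \<in> frag_interval y (split_leaf x y k)"
    if "\<And>z. z \<in> {0..<1} \<Longrightarrow> \<exists>!l. l \<in> leaves (frag_tree k x y) \<and> z \<in> frag_interval y l" for k
    unfolding split_leaf_def by (rule theI') (use that x in auto)
  have inv: "(\<forall>z\<in>{0..<1}. \<exists>!l. l \<in> leaves (frag_tree k x y) \<and> z \<in> frag_interval y l) \<and>
    (\<forall>i u. i # u \<in> frag_tree k x y \<longrightarrow> u \<in> frag_tree k x y) \<and>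
    internal_nodes (frag_tree k x y) = split_leaf x y ` {..<k} \<and>
    (\<forall>u\<in>frag_tree k x y. length u \<le> k)" for k
  proof (induction k)
    case 0
    then show ?case by (auto simp: leaves_def internal_nodes_def)
  next
    case (Suc k)
    define t where "t = frag_tree k x y"
    define l where "l = split_leaf x y k"
    have t': "frag_tree (Suc k) x y = t \<union> range (\<lambda>i. i # l)"
      by (simp add: frag_tree_Suc t_def l_def del: frag_tree.simps)
    have l: "l \<in> leaves t" "x (Suc k) \<in> frag_interval y l"
      using spl[of k] Suc by (auto simp: l_def t_def)
    have cl: "i # u \<in> t \<Longrightarrow> u \<in> t" for i u using Suc by (auto simp: t_def)
    \<comment> \<open>The new children are leaves: a grandchild of \<open>l\<close> in
      \<open>t\<close> would force a child of \<open>l\<close> into \<open>t\<close>, as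
      \<open>t\<close> is closed under parents.\<close>
    have lv: "leaves (t \<union> range (\<lambda>i. i # l)) = leaves t - {l} \<union> range (\<lambda>i. i # l)"
      using l(1) cl by (auto simp: leaves_def)
    have int: "internal_nodes (t \<union> range (\<lambda>i. i # l)) = insert l (internal_nodes t)"
      using l(1) cl by (auto simp: leaves_def internal_nodes_def)
    have "\<exists>!l'. l' \<in> leaves (frag_tree (Suc k) x y) \<and> z \<in> frag_interval y l'" if z: "z \<in> {0..<1}" for z
    proof -
      have "\<exists>!r. r \<in> leaves t \<and> z \<in> frag_interval y r"
        using Suc z unfolding t_def by simp
      then obtain r where r: "r \<in> leaves t" "z \<in> frag_interval y r"
        and ur: "\<And>r'. r' \<in> leaves t \<Longrightarrow> z \<in> frag_interval y r' \<Longrightarrow> r' = r"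
        by blast
      have ch: "z \<in> frag_interval y l" if "z \<in> frag_interval y (i # l)" for i
        using frag_interval_children(2)[OF y] that by blast
      show ?thesis
      proof (cases "r = l")
        case True
        have "\<exists>!i. z \<in> frag_interval y (i # l)"
          using frag_interval_children(1)[OF y, of z l] r True by simp
        then obtain i where i: "z \<in> frag_interval y (i # l)" "\<And>j. z \<in> frag_interval y (j # l) \<Longrightarrow> j = i"
          by blast
        show ?thesis
          unfolding t' lv
        proof (rule ex1I[of _ "i # l"])
          fix w assume "w \<in> leaves t - {l} \<union> range (\<lambda>i. i # l) \<and> z \<in> frag_interval y w"
          then show "w = i # l" using i(2) ur[of w] True by blast
        qed (use i in blast)
      next
        case False
        show ?thesis
          unfolding t' lv
        proof (rule ex1I[of _ r])
          fix w assume "w \<in> leaves t - {l} \<union> range (\<lambda>i. i # l) \<and> z \<in> frag_interval y w"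
          then show "w = r" using ch ur[of l] ur[of w] l(1) False by blast
        qed (use r False in blast)
      qed
    qed
    moreover have "\<forall>i u. i # u \<in> frag_tree (Suc k) x y \<longrightarrow> u \<in> frag_tree (Suc k) x y"
      unfolding t' using cl l by (auto simp: leaves_def)
    moreover have "internal_nodes (frag_tree (Suc k) x y) = split_leaf x y ` {..<Suc k}"
      unfolding t' int using Suc by (simp add: t_def l_def lessThan_Suc del: frag_tree.simps)
    moreover have "\<forall>u\<in>frag_tree (Suc k) x y. length u \<le> Suc k"
      unfolding t' using Suc l(1) by (auto simp: t_def leaves_def)
    ultimately show ?case by blast
  qed
  show "z \<in> {0..<1} \<Longrightarrow> \<exists>!l. l \<in> leaves (frag_tree k x y) \<and> z \<in> frag_interval y l"
    "internal_nodes (frag_tree k x y) = split_leaf x y ` {..<k}"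
    "u \<in> frag_tree k x y \<Longrightarrow> length u \<le> k"
    using inv[of k] by simp_all
  show "split_leaf x y k \<in> leaves (frag_tree k x y)" "x (Suc k) \<in> frag_interval y (split_leaf x y k)"
    using spl[of k] inv[of k] by simp_all
qed

text \<open>A leaf that has been split is internal in all later trees and cannot be split
  again.\<close>

lemma inj_split_leaf:
  assumes y: "weights y" and x: "\<forall>i\<ge>1. x i \<in> {0..<1}"
  shows "inj (split_leaf x y)"
proof (rule linorder_injI)
  fix j k :: nat assume "j < k"
  then have "split_leaf x y j \<in> internal_nodes (frag_tree k x y)"
    by (auto simp: internal_nodes_frag_tree[OF y x])
  then show "split_leaf x y j \<noteq> split_leaf x y k"
    using split_leaf_leaf[OF y x, of k] by (auto simp: internal_nodes_def leaves_def)
qed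

text \<open>A point of \<open>I\<^sup>u\<close> splits either a descendant of \<open>u\<close> or a proper ancestor, and each of the latter
  is split only once.\<close>

lemma card_split_descendants:
  assumes y: "weights y" and x: "\<forall>i\<ge>1. x i \<in> {0..<1}"
  shows "card {k. k < n \<and> suffix u (split_leaf x y k)} \<le> card {k. k < n \<and> x (Suc k) \<in> frag_interval y u}"
    and "card {k. k < n \<and> x (Suc k) \<in> frag_interval y u} \<le>
           card {k. k < n \<and> suffix u (split_leaf x y k)} + length u"
proof -
  let ?D = "{k. k < n \<and> suffix u (split_leaf x y k)}"
  let ?N = "{k. k < n \<and> x (Suc k) \<in> frag_interval y u}"
  have xs: "x (Suc k) \<in> frag_interval y (split_leaf x y k)" for k
    using split_leaf_interval[OF y x] by blast
  show "card ?D \<le> card ?N"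
    using xs frag_interval_suffix[OF y] by (intro card_mono) auto
  have inj: "inj (split_leaf x y)" by (rule inj_split_leaf[OF y x])
  \<comment> \<open>The proper ancestors of \<open>u\<close> are its proper suffixes
    \<open>drop k u\<close> with k between 1 and the length of \<open>u\<close>; their number is the
    error term.\<close>
  have "split_leaf x y ` (?N - ?D) \<subseteq> (\<lambda>k. drop k u) ` {1..length u}"
  proof
    fix w assume "w \<in> split_leaf x y ` (?N - ?D)"
    then obtain k where k: "w = split_leaf x y k" "x (Suc k) \<in> frag_interval y u" "\<not> suffix u w" by auto
    have "\<not> length u \<le> length w"
      using frag_interval_Int_suffix[OF y k(2) xs[of k]] k by auto
    moreover from this have "suffix w u"
      using frag_interval_Int_suffix[OF y xs[of k] k(2)] k by auto
    ultimately show "w \<in> (\<lambda>k. drop k u) ` {1..length u}"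
      by (intro image_eqI[of _ _ "length u - length w"]) (auto simp: suffix_def)
  qed
  then have "card (split_leaf x y ` (?N - ?D)) \<le> card {1..length u}"
    by (meson card_mono card_image_le finite_atLeastAtMost finite_imageI le_trans)
  then have "card (?N - ?D) \<le> length u"
    using inj by (simp add: card_image inj_on_def)
  moreover have "card ?N \<le> card (?N - ?D) + card ?D"
    by (rule order_trans[OF card_mono card_Un_le]) auto
  ultimately show "card ?N \<le> card ?D + length u" by linarith
qed

section \<open>Nested triangles in barycentric coordinates\<close>

text \<open>Indexing the vertices by letters makes the recursion uniform: the child with letter i is
  obtained by moving the vertex of index i to M_u.\<close>

definition corner :: "(node \<Rightarrow> real ^ 3) \<Rightarrow> node \<Rightarrow> 3 \<Rightarrow> complex" where
  "corner p u j = (let (a, b, c) = triangle p u in if j = 1 then a else if j = 2 then b else c)"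

definition bary :: "(node \<Rightarrow> real ^ 3) \<Rightarrow> node \<Rightarrow> real ^ 3 \<Rightarrow> complex" where
  "bary p u q = (\<Sum>j\<in>UNIV. (q $ j) *\<^sub>R corner p u j)"

lemma inner_vertex_bary: "inner_vertex p u = bary p u (p u)"
  by (simp add: inner_vertex_def bary_def corner_def sum_3 split_beta)

lemma corner_Cons: "corner p (i # u) j = (if j = i then inner_vertex p u else corner p u j)"
  using exhaust_3[of i] exhaust_3[of j]
  by (auto simp: inner_vertex_def corner_def Let_def split_beta)

lemma filled_triangle_bary:
  "filled_triangle p u = {bary p u q | q. (\<forall>i. q $ i \<ge> 0) \<and> (\<Sum>i\<in>UNIV. q $ i) = 1}"
proof -
  obtain a b c where abc: "triangle p u = (a, b, c)" by (metis prod_cases3)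
  have b: "bary p u q = q $ 1 *\<^sub>R a + q $ 2 *\<^sub>R b + q $ 3 *\<^sub>R c" for q
    by (simp add: bary_def corner_def abc sum_3 add.assoc)
  show ?thesis
  proof (intro set_eqI iffI)
    fix z assume "z \<in> filled_triangle p u"
    then obtain s t r where "z = s *\<^sub>R a + t *\<^sub>R b + r *\<^sub>R c" "0 \<le> s" "0 \<le> t" "0 \<le> r" "s + t + r = 1"
      unfolding filled_triangle_def abc Let_def prod.case convex_hull_3 by blast
    then show "z \<in> {bary p u q | q. (\<forall>i. q $ i \<ge> 0) \<and> (\<Sum>i\<in>UNIV. q $ i) = 1}"
      by (intro CollectI exI[of _ "vector [s, t, r]"]) (simp add: b sum_3 forall_3)
  next
    fix z assume "z \<in> {bary p u q | q. (\<forall>i. q $ i \<ge> 0) \<and> (\<Sum>i\<in>UNIV. q $ i) = 1}"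
    then obtain q where "z = bary p u q" "\<And>i. q $ i \<ge> 0" "(\<Sum>i\<in>UNIV. q $ i) = 1" by blast
    then show "z \<in> filled_triangle p u"
      unfolding filled_triangle_def abc Let_def prod.case convex_hull_3 b sum_3 by blast
  qed
qed

text \<open>\<open>coord_map w i\<close> turns barycentric coordinates in the child \<open>u(i)\<close> into those in \<open>u\<close>,
  when \<open>M\<^sub>u\<close> has coordinates \<open>w\<close>.\<close>

definition coord_map :: "real ^ 3 \<Rightarrow> 3 \<Rightarrow> real ^ 3 \<Rightarrow> real ^ 3" where
  "coord_map w i q = (\<chi> j. q $ i * w $ j + (if j = i then 0 else q $ j))"

lemma bary_Cons: "bary p (i # u) q = bary p u (coord_map (p u) i q)"
  using exhaust_3[of i]
  by (auto simp: bary_def corner_Cons inner_vertex_bary coord_map_def sum_3 algebra_simps)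

text \<open>The i-th coordinate is redistributed in the proportions \<open>w\<close>, which add up
  to one, and the others are kept.\<close>

lemma sum_coord_map:
  assumes "(\<Sum>j\<in>UNIV. w $ j) = 1"
  shows "(\<Sum>j\<in>UNIV. coord_map w i q $ j) = (\<Sum>j\<in>UNIV. q $ j)"
proof -
  have "(\<Sum>j\<in>UNIV. coord_map w i q $ j) = q $ i * (\<Sum>j\<in>UNIV. w $ j) + (\<Sum>j\<in>UNIV. if j = i then 0 else q $ j)"
    by (simp add: coord_map_def sum.distrib sum_distrib_left)
  also have "(\<Sum>j\<in>UNIV. if j = i then 0 else q $ j) = (\<Sum>j\<in>UNIV - {i}. q $ j)"
    by (rule sum.mono_neutral_cong_right) auto
  finally show ?thesis using assms by (simp add: sum.remove[of UNIV i])
qed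

lemma coord_map_pos: "(\<And>j. w $ j > 0) \<Longrightarrow> (\<And>j. q $ j > 0) \<Longrightarrow> coord_map w i q $ j > 0"
  by (simp add: coord_map_def add_pos_pos)

lemma coord_map_nonneg: "(\<And>j. w $ j > 0) \<Longrightarrow> (\<And>j. q $ j \<ge> 0) \<Longrightarrow> coord_map w i q $ j \<ge> 0"
  by (simp add: coord_map_def less_imp_le)

text \<open>The i-th coordinate of the image is q_i w_i, which determines q_i; the remaining
  coordinates then follow by subtraction.\<close>

lemma coord_map_inject:
  assumes "w $ i > 0" "coord_map w i q = coord_map w i r"
  shows "q = r"
proof -
  have *: "coord_map w i q $ j = coord_map w i r $ j" for j using assms by simp
  have "q $ i = r $ i" using *[of i] assms(1) by (simp add: coord_map_def)
  then have "q $ j = r $ j" for j using *[of j] by (cases "j = i") (auto simp: coord_map_def)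
  then show ?thesis by (simp add: vec_eq_iff)
qed

text \<open>The interior of \<open>u(i)\<close> consists of the points for which the ratio of the \<open>i\<close>-th coordinates
  of the point and of \<open>M\<^sub>u\<close> is strictly minimal.\<close>

lemma coord_map_ratio:
  assumes "\<And>j. w $ j > 0" "\<And>j. q $ j > 0" "j \<noteq> i"
  shows "coord_map w i q $ i / w $ i < coord_map w i q $ j / w $ j"
  using assms by (simp add: coord_map_def field_simps less_imp_neq[THEN not_sym])

text \<open>Take for i an index at which the ratio r_i / w_i attains its minimum m. Then r - m w has
  nonnegative coordinates and vanishes at i, and q is this vector with m put in place of the zero.
  This is why the children cover their parent.\<close>

lemma coord_map_surj:
  assumes "\<And>j. w $ j > 0" "\<And>j. r $ j \<ge> 0"
  obtains i q where "r = coord_map w i q" "\<And>j. q $ j \<ge> 0"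
proof -
  define i where "i = arg_min_on (\<lambda>i. r $ i / w $ i) UNIV"
  define m where "m = r $ i / w $ i"
  have min: "m \<le> r $ j / w $ j" for j
    using arg_min_least[of UNIV j "\<lambda>i. r $ i / w $ i"] by (simp add: i_def m_def)
  define q :: "real ^ 3" where "q = (\<chi> j. if j = i then m else r $ j - m * w $ j)"
  have "m * w $ j \<le> r $ j" for j
    using min[of j] assms(1)[of j] by (simp add: pos_le_divide_eq)
  moreover have "m \<ge> 0" using assms(1)[of i] assms(2)[of i] by (simp add: m_def)
  ultimately have "q $ j \<ge> 0" for j by (simp add: q_def)
  moreover have "w $ i \<noteq> 0" using assms(1)[of i] by simp
  then have "r = coord_map w i q"
    by (auto simp: vec_eq_iff coord_map_def q_def m_def)
  ultimately show thesis using that by blast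
qed

text \<open>No triangle is degenerate. The root is checked by hand: the imaginary part determines
  q_3, the real part then q_2, and the coordinate sum q_1. Descending to a child composes with an
  injective map that preserves coordinate sums.\<close>

lemma bary_inject:
  assumes "weights p" "bary p u q = bary p u r" "(\<Sum>j\<in>UNIV. q $ j) = (\<Sum>j\<in>UNIV. r $ j)"
  shows "q = r"
  using assms(2,3)
proof (induction u arbitrary: q r)
  case Nil
  have "exp (\<i> * pi / 3) = Complex (1 / 2) (sqrt 3 / 2)"
    by (simp add: complex_eq_iff Re_exp Im_exp cos_60 sin_60)
  then have "q $ 2 + q $ 3 / 2 = r $ 2 + r $ 3 / 2 \<and> q $ 3 = r $ 3"
    using Nil(1) unfolding bary_def corner_def sum_3 by (simp add: complex_eq_iff[of "_ + _"])
  then have "q $ 2 + q $ 3 / 2 = r $ 2 + r $ 3 / 2" "q $ 3 = r $ 3" by blast+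
  then show ?case using Nil(2) by (simp add: sum_3 vec_eq_iff forall_3)
next
  case (Cons i u)
  have "coord_map (p u) i q = coord_map (p u) i r"
    by (rule Cons.IH) (use Cons.prems in \<open>simp_all add: bary_Cons sum_coord_map[OF weights_sum[OF assms(1)]]\<close>)
  then show ?case by (rule coord_map_inject[OF weights_pos[OF assms(1)]])
qed

text \<open>The interior, encoded by strictly positive coordinates, so that nesting and disjointness
  become statements about \<open>coord_map\<close> instead of plane topology.\<close>

definition open_triangle :: "(node \<Rightarrow> real ^ 3) \<Rightarrow> node \<Rightarrow> complex set" where
  "open_triangle p u = {bary p u q | q. (\<forall>i. q $ i > 0) \<and> (\<Sum>i\<in>UNIV. q $ i) = 1}"

lemma open_triangle_subset: "open_triangle p u \<subseteq> filled_triangle p u"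
  unfolding open_triangle_def filled_triangle_bary using less_imp_le by blast

lemma filled_triangle_Cons_subset:
  assumes "weights p"
  shows "filled_triangle p (i # u) \<subseteq> filled_triangle p u"
proof
  fix x assume "x \<in> filled_triangle p (i # u)"
  then obtain q where q: "x = bary p u (coord_map (p u) i q)" "\<And>j. q $ j \<ge> 0" "(\<Sum>j\<in>UNIV. q $ j) = 1"
    unfolding filled_triangle_bary bary_Cons by blast
  then show "x \<in> filled_triangle p u"
    unfolding filled_triangle_bary using coord_map_nonneg[OF weights_pos[OF assms]]
    by (intro CollectI exI[of _ "coord_map (p u) i q"]) (simp add: sum_coord_map[OF weights_sum[OF assms]])
qed

lemma filled_triangle_Cons_cover:
  assumes "weights p"
  shows "filled_triangle p u \<subseteq> (\<Union>i. filled_triangle p (i # u))"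
proof
  fix x assume "x \<in> filled_triangle p u"
  then obtain r where r: "x = bary p u r" "\<And>j. r $ j \<ge> 0" "(\<Sum>j\<in>UNIV. r $ j) = 1"
    by (auto simp: filled_triangle_bary)
  obtain i q where q: "r = coord_map (p u) i q" "\<And>j. q $ j \<ge> 0"
    using coord_map_surj[of "p u" r] weights_pos[OF assms] r(2) by blast
  have "x = bary p (i # u) q" "(\<Sum>j\<in>UNIV. q $ j) = 1"
    using r q sum_coord_map[OF weights_sum[OF assms]] by (simp_all add: bary_Cons)
  then show "x \<in> (\<Union>i. filled_triangle p (i # u))"
    using q(2) by (auto simp: filled_triangle_bary)
qed

lemma open_triangle_Cons_subset:
  assumes "weights p"
  shows "open_triangle p (i # u) \<subseteq> open_triangle p u"
proof
  fix x assume "x \<in> open_triangle p (i # u)"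
  then obtain q where q: "x = bary p u (coord_map (p u) i q)" "\<And>j. q $ j > 0" "(\<Sum>j\<in>UNIV. q $ j) = 1"
    unfolding open_triangle_def bary_Cons by blast
  then show "x \<in> open_triangle p u"
    unfolding open_triangle_def using coord_map_pos[OF weights_pos[OF assms]]
    by (intro CollectI exI[of _ "coord_map (p u) i q"]) (simp add: sum_coord_map[OF weights_sum[OF assms]])
qed

lemma filled_triangle_suffix: "weights p \<Longrightarrow> suffix u v \<Longrightarrow> filled_triangle p v \<subseteq> filled_triangle p u"
proof (induction v)
  case (Cons i v)
  then show ?case using filled_triangle_Cons_subset[of p i v] by (auto simp: suffix_Cons)
qed simp

lemma open_triangle_suffix: "weights p \<Longrightarrow> suffix u v \<Longrightarrow> open_triangle p v \<subseteq> open_triangle p u"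
proof (induction v)
  case (Cons i v)
  then show ?case using open_triangle_Cons_subset[of p i v] by (auto simp: suffix_Cons)
qed simp

lemma inner_vertex_open: "weights p \<Longrightarrow> inner_vertex p u \<in> open_triangle p u"
  by (auto simp: inner_vertex_bary open_triangle_def weights_pos weights_sum)

lemma open_triangle_coordsE:
  assumes "weights p" "x \<in> open_triangle p (i # u)"
  obtains q where "x = bary p u q" "(\<Sum>j\<in>UNIV. q $ j) = 1" "\<And>j. j \<noteq> i \<Longrightarrow> q $ i / p u $ i < q $ j / p u $ j"
proof -
  from assms(2) obtain q where q: "x = bary p (i # u) q" "\<And>j. q $ j > 0" "(\<Sum>j\<in>UNIV. q $ j) = 1"
    by (auto simp: open_triangle_def)
  show thesis
    by (rule that[of "coord_map (p u) i q"])
      (use q weights_pos[OF assms(1)] sum_coord_map[OF weights_sum[OF assms(1)]] coord_map_ratio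
        in \<open>auto simp: bary_Cons\<close>)
qed

text \<open>The coordinates of M_u are \<open>p u\<close> itself, so all ratios equal 1 and none is
  strictly smallest.\<close>

lemma inner_vertex_notin_child:
  assumes "weights p"
  shows "inner_vertex p u \<notin> open_triangle p (i # u)"
proof
  assume "inner_vertex p u \<in> open_triangle p (i # u)"
  then obtain q where q: "inner_vertex p u = bary p u q" "(\<Sum>j\<in>UNIV. q $ j) = 1"
    "\<And>j. j \<noteq> i \<Longrightarrow> q $ i / p u $ i < q $ j / p u $ j"
    by (rule open_triangle_coordsE[OF assms]) blast
  have "q = p u"
    using bary_inject[OF assms, of u q "p u"] q weights_sum[OF assms] by (simp add: inner_vertex_bary)
  moreover obtain j :: 3 where "j \<noteq> i" by (metis neq_3(1))
  ultimately show False using q(3)[of j] weights_pos[OF assms, of u] by (simp add: less_imp_neq[THEN not_sym])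
qed

text \<open>Coordinates are unique, and a strict minimum of the ratios cannot be attained at two
  indices.\<close>

lemma open_triangle_children_disjoint:
  assumes "weights p" "i \<noteq> j"
  shows "open_triangle p (i # u) \<inter> open_triangle p (j # u) = {}"
proof -
  have False if x: "x \<in> open_triangle p (i # u)" "x \<in> open_triangle p (j # u)" for x
  proof -
    obtain q where q: "x = bary p u q" "(\<Sum>j\<in>UNIV. q $ j) = 1"
      "\<And>j. j \<noteq> i \<Longrightarrow> q $ i / p u $ i < q $ j / p u $ j"
      using x(1) by (rule open_triangle_coordsE[OF assms(1)]) blast
    obtain r where r: "x = bary p u r" "(\<Sum>j\<in>UNIV. r $ j) = 1"
      "\<And>i. i \<noteq> j \<Longrightarrow> r $ j / p u $ j < r $ i / p u $ i"
      using x(2) by (rule open_triangle_coordsE[OF assms(1)]) blast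
    have "q = r" using bary_inject[OF assms(1)] q(1,2) r(1,2) by metis
    then show False using q(3)[of j] r(3)[of i] assms(2) by simp
  qed
  then show ?thesis by blast
qed

text \<open>The position of a vertex reveals its ancestors. By induction \<open>v\<close> lies at or
  below the parent. If it is the parent, its vertex lies in no open child; otherwise
  \<open>v\<close> passes through some child, and disjointness leaves only the child with letter
  i.\<close>

lemma inner_vertex_open_suffix:
  assumes "weights p" "inner_vertex p v \<in> open_triangle p u"
  shows "suffix u v"
  using assms(2)
proof (induction u)
  case (Cons i u)
  have "inner_vertex p v \<in> open_triangle p u"
    using Cons.prems open_triangle_Cons_subset[OF assms(1)] by blast
  then have "suffix u v" by (rule Cons.IH)
  then obtain w where w: "v = w @ u" by (auto simp: suffix_def)
  show ?case
  proof (cases w rule: rev_cases)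
    case Nil
    then show ?thesis using Cons.prems inner_vertex_notin_child[OF assms(1)] w by auto
  next
    case (snoc w' j)
    then have "suffix (j # u) v" using w by (simp add: suffix_def)
    then have "inner_vertex p v \<in> open_triangle p (j # u)"
      using inner_vertex_open[OF assms(1)] open_triangle_suffix[OF assms(1)] by blast
    then have "j = i" using open_triangle_children_disjoint[OF assms(1)] Cons.prems by blast
    then show ?thesis using \<open>suffix (j # u) v\<close> by simp
  qed
qed simp

text \<open>The occupation measure is built from a set of points, so coincident vertices would make
  its mass smaller than one.\<close>

lemma inj_inner_vertex:
  assumes "weights p"
  shows "inj (inner_vertex p)"
proof (rule injI)
  fix u v assume "inner_vertex p u = inner_vertex p v"
  then have "suffix u v" "suffix v u"
    using inner_vertex_open_suffix[OF assms] inner_vertex_open[OF assms] by metis+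
  then show "u = v" by (rule suffix_order.antisym)
qed

lemma inner_vertex_filled: "weights p \<Longrightarrow> suffix u v \<Longrightarrow> inner_vertex p v \<in> filled_triangle p u"
  using inner_vertex_open open_triangle_subset filled_triangle_suffix by blast

lemma filled_triangle_Nil: "filled_triangle p [] = root_triangle"
  by (simp add: filled_triangle_def root_triangle_def)

lemma root_triangle_cover:
  assumes "weights p"
  shows "root_triangle \<subseteq> (\<Union>u\<in>{u. length u = k}. filled_triangle p u)"
proof (induction k)
  case (Suc k)
  also have "(\<Union>u\<in>{u. length u = k}. filled_triangle p u) \<subseteq> (\<Union>u\<in>{u. length u = Suc k}. filled_triangle p u)"
  proof
    fix x assume "x \<in> (\<Union>u\<in>{u. length u = k}. filled_triangle p u)"
    then obtain u i where "length u = k" "x \<in> filled_triangle p (i # u)"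
      using filled_triangle_Cons_cover[OF assms] by blast
    then show "x \<in> (\<Union>u\<in>{u. length u = Suc k}. filled_triangle p u)"
      by (intro UN_I[of "i # u"]) auto
  qed
  finally show ?case .
qed (simp add: filled_triangle_Nil)

lemma compact_filled_triangle: "compact (filled_triangle p u)"
  by (auto simp: filled_triangle_def split_beta intro: compact_convex_hull)

lemma compact_root_triangle: "compact root_triangle"
  using compact_filled_triangle[of undefined "[]"] by (simp add: filled_triangle_Nil)

lemma filled_triangle_subset_root: "weights p \<Longrightarrow> filled_triangle p u \<subseteq> root_triangle"
  using filled_triangle_suffix[of p "[]" u] by (simp add: filled_triangle_Nil)

text \<open>The sum runs over ordered pairs, so every squared edge length is counted twice. Its
  growth from one generation to the next is bounded linearly in the weights, so that only their
  means matter.\<close>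

definition spread :: "(node \<Rightarrow> real ^ 3) \<Rightarrow> node \<Rightarrow> real" where
  "spread p u = (\<Sum>i\<in>UNIV. \<Sum>j\<in>UNIV. (norm (corner p u i - corner p u j))\<^sup>2)"

lemma spread_nonneg: "spread p u \<ge> 0"
  by (auto simp: spread_def intro!: sum_nonneg)

lemma corner_dist_le_spread: "(norm (corner p u i - corner p u j))\<^sup>2 \<le> spread p u"
proof -
  have "(norm (corner p u i - corner p u j))\<^sup>2 \<le> (\<Sum>j\<in>UNIV. (norm (corner p u i - corner p u j))\<^sup>2)"
    by (rule member_le_sum) auto
  also have "\<dots> \<le> spread p u"
    unfolding spread_def by (rule member_le_sum) (auto intro: sum_nonneg)
  finally show ?thesis .
qed

text \<open>The diameter of a triangle is attained at two of its vertices.\<close>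

lemma filled_triangle_dist_le_spread:
  assumes "x \<in> filled_triangle p u" "y \<in> filled_triangle p u"
  shows "(norm (x - y))\<^sup>2 \<le> spread p u"
proof -
  obtain a b c where abc: "triangle p u = (a, b, c)" by (metis prod_cases3)
  let ?C = "{a, b, c}"
  have ab: "a = corner p u 1" "b = corner p u 2" "c = corner p u 3"
    by (auto simp: corner_def abc)
  have "\<exists>i. r = corner p u i" if "r \<in> ?C" for r
    using that ab by blast
  then have *: "(norm (r - s))\<^sup>2 \<le> spread p u" if "r \<in> ?C" "s \<in> ?C" for r s
    using that corner_dist_le_spread[of p u] by metis
  have "x \<in> convex hull ?C" "y \<in> convex hull ?C"
    using assms by (simp_all add: filled_triangle_def abc)
  then obtain r s where rs: "r \<in> ?C" "s \<in> ?C" "norm (x - y) \<le> norm (r - s)"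
    using simplex_extremal_le[of ?C] by (meson finite.emptyI finite.insertI insert_not_empty)
  have "(norm (x - y))\<^sup>2 \<le> (norm (r - s))\<^sup>2" using rs(3) by (intro power_mono) auto
  also note *[OF rs(1,2)]
  finally show ?thesis .
qed

text \<open>By Leibniz' formula, with the nonpositive terms \<open>- 3 p\<^sub>i p\<^sub>j |e|\<^sup>2\<close> of the squared distances
  to \<open>M\<^sub>u\<close> dropped.\<close>

lemma sum_spread_children:
  assumes "weights p"
  shows "(\<Sum>i\<in>UNIV. spread p (i # u)) \<le> spread p u +
    2 * (\<Sum>i\<in>UNIV. \<Sum>j\<in>UNIV. (p u $ i + p u $ j) * (norm (corner p u i - corner p u j))\<^sup>2)"
proof -
  define x y z where "x = p u $ 1" "y = p u $ 2" "z = p u $ 3"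
  define a b c where "a = corner p u 1" "b = corner p u 2" "c = corner p u 3"
  have xyz: "x \<ge> 0" "y \<ge> 0" "z \<ge> 0" "x = 1 - y - z"
    using weights_pos[OF assms, of u] weights_sum[OF assms, of u]
    unfolding x_y_z_def sum_3 by (simp_all add: less_imp_le)
  define m where "m = x *\<^sub>R a + y *\<^sub>R b + z *\<^sub>R c"
  have m: "inner_vertex p u = m"
    by (simp add: inner_vertex_bary bary_def sum_3 m_def x_y_z_def a_b_c_def)
  define L where "L = x * y * (norm (a - b))\<^sup>2 + y * z * (norm (b - c))\<^sup>2 + x * z * (norm (a - c))\<^sup>2"
  have L: "L \<ge> 0" using xyz by (simp add: L_def)
  \<comment> \<open>Leibniz' formula on the line, to be used for the real and the imaginary parts.
    Eliminating \<open>x\<close> turns it into a polynomial identity.\<close>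
  have leibniz: "(x * r + y * s + z * t - r)\<^sup>2 = y * (r - s)\<^sup>2 + z * (r - t)\<^sup>2 -
      (x * y * (r - s)\<^sup>2 + y * z * (s - t)\<^sup>2 + x * z * (r - t)\<^sup>2)"
    "(x * r + y * s + z * t - s)\<^sup>2 = x * (r - s)\<^sup>2 + z * (s - t)\<^sup>2 -
      (x * y * (r - s)\<^sup>2 + y * z * (s - t)\<^sup>2 + x * z * (r - t)\<^sup>2)"
    "(x * r + y * s + z * t - t)\<^sup>2 = x * (r - t)\<^sup>2 + y * (s - t)\<^sup>2 -
      (x * y * (r - s)\<^sup>2 + y * z * (s - t)\<^sup>2 + x * z * (r - t)\<^sup>2)" for r s t :: real
    unfolding xyz(4) by algebra+
  have "(norm (m - a))\<^sup>2 = y * (norm (a - b))\<^sup>2 + z * (norm (a - c))\<^sup>2 - L"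
    "(norm (m - b))\<^sup>2 = x * (norm (a - b))\<^sup>2 + z * (norm (b - c))\<^sup>2 - L"
    "(norm (m - c))\<^sup>2 = x * (norm (a - c))\<^sup>2 + y * (norm (b - c))\<^sup>2 - L"
    using leibniz[of "Re a" "Re b" "Re c"] leibniz[of "Im a" "Im b" "Im c"]
    unfolding m_def L_def cmod_power2 by (simp_all add: distrib_left)
  then have "(norm (m - a))\<^sup>2 + (norm (m - b))\<^sup>2 + (norm (m - c))\<^sup>2 \<le>
     (x + y) * (norm (a - b))\<^sup>2 + (y + z) * (norm (b - c))\<^sup>2 + (x + z) * (norm (a - c))\<^sup>2"
    using L by (simp add: algebra_simps)
  \<comment> \<open>Among the three children each old edge occurs once and each segment ending at
    \<open>m\<close> twice. Ordered pairs double these counts, hence four times the preceding bound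
    on top of \<open>spread p u\<close>.\<close>
  then show ?thesis
    by (simp add: spread_def corner_Cons m sum_3 norm_minus_commute[of _ m] 
       norm_minus_commute[of b a] norm_minus_commute[of c a] norm_minus_commute[of c b] algebra_simps
       flip: x_y_z_def a_b_c_def)
qed

section \<open>Weak convergence on a compact set\<close>

text \<open>A uniformly continuous function is, up to a small error, Lipschitz with a large
  constant, hence close to the upper envelope of cones of that slope below its graph. Finitely many
  cones suffice, with centres in \<open>D\<close>, rational heights and an integer slope, which
  leaves countably many candidates when \<open>D\<close> is countable.\<close>

lemma continuous_on_approx_max_cones:
  fixes f :: "'a::metric_space \<Rightarrow> real"
  assumes S: "compact S" "S \<noteq> {}" and f: "continuous_on S f" and e: "e > 0"
    and D: "\<And>d. d > 0 \<Longrightarrow> \<exists>T. finite T \<and> T \<subseteq> D \<and> T \<subseteq> S \<and> S \<subseteq> (\<Union>y\<in>T. ball y d)"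
  shows "\<exists>A K. finite A \<and> A \<noteq> {} \<and> A \<subseteq> D \<times> \<rat> \<and>
           (\<forall>x\<in>S. \<bar>f x - Max ((\<lambda>(y, r). r - real K * dist x y) ` A)\<bar> < e)"
proof -
  \<comment> \<open>The error is spent as 4a for the height of a cone, 2a for the modulus of
    \<open>f\<close>, and a twice for slope times mesh, once in the estimate \<open>mod\<close> and
    once in the cone itself.\<close>
  define a where "a = e / 8"
  have a: "a > 0" using e by (simp add: a_def)
  have "uniformly_continuous_on S f" using S f by (simp add: compact_uniformly_continuous)
  then obtain d where d: "d > 0" "\<And>x y. x \<in> S \<Longrightarrow> y \<in> S \<Longrightarrow> dist y x < d \<Longrightarrow> dist (f y) (f x) < 2 * a"
    unfolding uniformly_continuous_on_def using a by (metis mult_pos_pos zero_less_numeral)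
  obtain B where B: "\<And>x. x \<in> S \<Longrightarrow> \<bar>f x\<bar> \<le> B"
    using compact_continuous_image[OF f S(1), THEN compact_imp_bounded] by (auto simp: bounded_iff)
  obtain K :: nat where K: "2 * B / d \<le> real K" using real_arch_simple by blast
  \<comment> \<open>Points closer than \<open>d\<close> are handled by uniform continuity; beyond
    \<open>d\<close> the slope alone makes up for the largest possible oscillation 2 B.\<close>
  have mod: "f x \<le> f y + 2 * a + real K * dist x y" if "x \<in> S" "y \<in> S" for x y
  proof (cases "dist x y < d")
    case True
    then have "f x < f y + 2 * a" using d(2)[OF that(2,1)] by (auto simp: dist_real_def)
    moreover have "real K * dist x y \<ge> 0" by simp
    ultimately show ?thesis by linarith
  next
    case False
    have "f x - f y \<le> 2 * B / d * d" using B[OF that(1)] B[OF that(2)] d(1) by simp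
    also have "\<dots> \<le> real K * dist x y"
      using K False d(1) by (intro mult_mono) auto
    finally show ?thesis using a by linarith
  qed
  have "a / (real K + 1) > 0" using a by simp
  from D[OF this] obtain T where T: "finite T" "T \<subseteq> D" "T \<subseteq> S" "S \<subseteq> (\<Union>y\<in>T. ball y (a / (real K + 1)))"
    by blast
  have "T \<noteq> {}" using T(4) S(2) by auto
  have "\<exists>q. q \<in> \<rat> \<and> f y - 4 * a < q \<and> q < f y - 2 * a" for y
    using Rats_dense_in_real[of "f y - 4 * a" "f y - 2 * a"] a by auto
  then obtain q where q: "\<And>y. q y \<in> \<rat>" "\<And>y. f y - 4 * a < q y" "\<And>y. q y < f y - 2 * a"
    by metis
  define A where "A = (\<lambda>y. (y, q y)) ` T"
  define h where "h = (\<lambda>x. Max ((\<lambda>y. q y - real K * dist x y) ` T))"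
  have h: "Max ((\<lambda>(y, r). r - real K * dist x y) ` A) = h x" for x
    by (simp add: A_def h_def image_image)
  have "\<bar>f x - h x\<bar> < e" if x: "x \<in> S" for x
  proof -
    obtain y where y: "y \<in> T" "dist x y < a / (real K + 1)"
      using T(4) x by (auto simp: dist_commute)
    have ys: "y \<in> S" using y T(3) by blast
    have "real K * dist x y \<le> (real K + 1) * (a / (real K + 1))"
      using y(2) by (intro mult_mono) auto
    then have Ka: "real K * dist x y \<le> a" by simp
    have "q y - real K * dist x y \<le> h x"
      unfolding h_def using T(1) y(1) by (intro Max_ge) auto
    moreover have "f x \<le> f y + 2 * a + real K * dist x y" using mod[OF x ys] .
    ultimately have "f x - e < h x" using q(2)[of y] Ka a e unfolding a_def by argo
    moreover have "h x \<le> f x"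
      unfolding h_def
    proof (subst Max_le_iff)
      show "\<forall>r\<in>(\<lambda>y. q y - real K * dist x y) ` T. r \<le> f x"
      proof
        fix r assume "r \<in> (\<lambda>y. q y - real K * dist x y) ` T"
        then obtain z where z: "z \<in> T" "r = q z - real K * dist x z" by blast
        have "f z \<le> f x + 2 * a + real K * dist x z"
          using mod[of z x] x z(1) T(3) by (auto simp: dist_commute)
        then show "r \<le> f x" using q(3)[of z] z(2) by linarith
      qed
    qed (use T(1) \<open>T \<noteq> {}\<close> in auto)
    ultimately show ?thesis using e by linarith
  qed
  moreover have "finite A" "A \<noteq> {}" "A \<subseteq> D \<times> \<rat>"
    using T(1,2) \<open>T \<noteq> {}\<close> q(1) by (auto simp: A_def)
  ultimately show ?thesis by (intro exI[of _ A] exI[of _ K]) (simp add: h)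
qed

text \<open>Separability of the continuous functions in the uniform norm. Total boundedness yields a
  countable set of centres, and the maxima of cones over it are parametrised by a finite set of
  centres with rational heights and a natural number.\<close>

lemma countable_dense_continuous:
  fixes S :: "'a::metric_space set"
  assumes "compact S"
  obtains F :: "('a \<Rightarrow> real) set" where "countable F" "\<And>g. g \<in> F \<Longrightarrow> continuous_on S g"
    "\<And>f e. continuous_on S f \<Longrightarrow> e > 0 \<Longrightarrow> \<exists>g\<in>F. \<forall>x\<in>S. \<bar>f x - g x\<bar> < e"
proof (cases "S = {}")
  case True
  show thesis by (rule that[of "{\<lambda>_. 0}"]) (use True in auto)
next
  case False
  have "\<exists>T. finite T \<and> T \<subseteq> S \<and> S \<subseteq> (\<Union>y\<in>T. ball y d)" if "d > 0" for d
    using seq_compact_imp_totally_bounded[of S] assms that by (simp add: compact_eq_seq_compact_metric)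
  then have "\<exists>T. finite T \<and> T \<subseteq> S \<and> S \<subseteq> (\<Union>y\<in>T. ball y (1 / real (Suc n)))" for n by simp
  then obtain T where T: "\<And>n. finite (T n)" "\<And>n. T n \<subseteq> S" "\<And>n. S \<subseteq> (\<Union>y\<in>T n. ball y (1 / real (Suc n)))"
    by metis
  define D where "D = (\<Union>n. T n)"
  have "countable D" unfolding D_def using T(1) by (auto intro: countable_finite)
  have D: "\<exists>U. finite U \<and> U \<subseteq> D \<and> U \<subseteq> S \<and> S \<subseteq> (\<Union>y\<in>U. ball y d)" if d: "d > 0" for d
  proof -
    obtain n where n: "1 / real (Suc n) < d" using d nat_approx_posE by blast
    have "(\<Union>y\<in>T n. ball y (1 / real (Suc n))) \<subseteq> (\<Union>y\<in>T n. ball y d)"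
      using n by (intro UN_mono subset_ball) auto
    then have "S \<subseteq> (\<Union>y\<in>T n. ball y d)" using T(3)[of n] by (rule subset_trans[rotated])
    moreover have "T n \<subseteq> D" by (auto simp: D_def)
    ultimately show ?thesis using T(1,2)[of n] by (intro exI[of _ "T n"]) simp
  qed
  define F where "F = (\<lambda>(A, K) x. Max ((\<lambda>(y, r). r - real K * dist x y) ` A)) `
     ({A. finite A \<and> A \<subseteq> D \<times> \<rat>} \<times> (UNIV :: nat set))"
  have "countable F"
    unfolding F_def using \<open>countable D\<close> countable_rat
    by (intro countable_image countable_SIGMA countable_Collect_finite_subset) auto
  have approx: "\<exists>g\<in>F. continuous_on S g \<and> (\<forall>x\<in>S. \<bar>f x - g x\<bar> < e)" if f: "continuous_on S f" and e: "e > 0" for f e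
  proof -
    obtain A K where A: "finite A" "A \<noteq> {}" "A \<subseteq> D \<times> \<rat>"
      "\<forall>x\<in>S. \<bar>f x - Max ((\<lambda>(y, r). r - real K * dist x y) ` A)\<bar> < e"
      using continuous_on_approx_max_cones[OF assms False f e, of D, OF D] by metis
    let ?g = "\<lambda>x. Max ((\<lambda>(y, r). r - real K * dist x y) ` A)"
    have "continuous_on S ?g"
      using A(1,2)
    proof (induction A rule: finite_ne_induct)
      case (singleton a)
      show ?case by (auto simp: split_beta intro!: continuous_intros)
    next
      case (insert a A)
      have eq: "(\<lambda>x. Max ((\<lambda>(y, r). r - real K * dist x y) ` insert a A)) =
         (\<lambda>x. max (snd a - real K * dist x (fst a)) (Max ((\<lambda>(y, r). r - real K * dist x y) ` A)))"
        using insert.hyps by (simp add: split_beta)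
      show ?case unfolding eq by (intro continuous_intros insert.IH)
    qed
    moreover have "?g \<in> F" unfolding F_def
      by (rule image_eqI[of _ _ "(A, K)"]) (use A in auto)
    ultimately show ?thesis using A(4) by blast
  qed
  show thesis
  proof (rule that[of "{g \<in> F. continuous_on S g}"])
    show "countable {g \<in> F. continuous_on S g}"
      by (rule countable_subset[OF _ \<open>countable F\<close>]) auto
    show "\<exists>g\<in>{g \<in> F. continuous_on S g}. \<forall>x\<in>S. \<bar>f x - g x\<bar> < e"
      if "continuous_on S f" "e > 0" for f e
      using approx[OF that] by blast
  qed auto
qed

section \<open>The weak topology and its Borel sets\<close>

definition prob_measures_on :: "'a::topological_space set \<Rightarrow> 'a measure set" where
  "prob_measures_on S = space (prob_algebra (restrict_space borel S))"

lemma prob_measures_onD: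
  assumes "N \<in> prob_measures_on S"
  shows "prob_space N" "sets N = sets (restrict_space borel S)" "space N = S"
proof -
  show *: "prob_space N" "sets N = sets (restrict_space borel S)"
    using assms by (auto simp: prob_measures_on_def space_prob_algebra)
  show "space N = S" using sets_eq_imp_space_eq[OF *(2)] by (simp add: space_restrict_space)
qed

lemma integrable_prob_measures_on:
  fixes f :: "'a::metric_space \<Rightarrow> real"
  assumes "N \<in> prob_measures_on S" "compact S" "continuous_on S f"
  shows "integrable N f"
proof -
  interpret prob_space N using assms(1) by (rule prob_measures_onD)
  obtain B where B: "\<And>x. x \<in> S \<Longrightarrow> \<bar>f x\<bar> \<le> B"
    using compact_continuous_image[OF assms(3,2), THEN compact_imp_bounded] by (auto simp: bounded_iff)
  have "f \<in> borel_measurable N"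
    using borel_measurable_continuous_on_restrict[OF assms(3)]
      measurable_cong_sets[OF prob_measures_onD(2)[OF assms(1)] refl] by blast
  then show ?thesis
    by (intro integrable_const_bound[of _ B]) (use B prob_measures_onD(3)[OF assms(1)] in auto)
qed

lemma integral_prob_measures_on_close:
  fixes f g :: "'a::metric_space \<Rightarrow> real"
  assumes N: "N \<in> prob_measures_on S" and "compact S" "continuous_on S f" "continuous_on S g"
    and "\<And>x. x \<in> S \<Longrightarrow> \<bar>f x - g x\<bar> \<le> e"
  shows "\<bar>integral\<^sup>L N f - integral\<^sup>L N g\<bar> \<le> e"
proof -
  interpret prob_space N using assms(1) by (rule prob_measures_onD)
  note int = integrable_prob_measures_on[OF N \<open>compact S\<close>]
  have "\<bar>\<integral>x. f x - g x \<partial>N\<bar> \<le> (\<integral>x. \<bar>f x - g x\<bar> \<partial>N)" by (rule integral_abs_bound)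
  also have "\<dots> \<le> (\<integral>x. e \<partial>N)"
    using assms prob_measures_onD(3)[OF N]
    by (intro integral_mono integrable_abs Bochner_Integration.integrable_diff int) auto
  finally show ?thesis using int assms by (simp add: prob_space)
qed

definition weak_subbasis :: "'a::topological_space set \<Rightarrow> 'a measure set set" where
  "weak_subbasis S = {{N \<in> prob_measures_on S. (\<integral>x. f x \<partial>N) \<in> V} | (f :: 'a \<Rightarrow> real) V.
     continuous_on S f \<and> bounded (f ` S) \<and> open V}"

lemma openin_weak_topology: "openin (weak_topology S) U \<longleftrightarrow> generate_topology_on (weak_subbasis S) U"
  by (simp add: weak_topology_def weak_subbasis_def prob_measures_on_def openin_topology_generated_by_iff)

lemma topspace_weak_topology: "topspace (weak_topology S) = prob_measures_on S"
proof
  show "topspace (weak_topology S) \<subseteq> prob_measures_on S"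
    by (auto simp: weak_topology_def prob_measures_on_def)
  have "prob_measures_on S \<in> weak_subbasis S"
    unfolding weak_subbasis_def
    by (intro CollectI exI[of _ "\<lambda>_. 0"] exI[of _ UNIV]) (auto simp: bounded_iff)
  then show "prob_measures_on S \<subseteq> topspace (weak_topology S)"
    by (auto simp: weak_topology_def weak_subbasis_def prob_measures_on_def)
qed

text \<open>For finite \<open>A\<close> this is a basic neighbourhood, given by finitely many test
  functions with open intervals. Countably many test functions and rational endpoints leave
  countably many such sets.\<close>

definition weak_cylinder :: "'a::topological_space set \<Rightarrow> (('a \<Rightarrow> real) \<times> real \<times> real) set \<Rightarrow> 'a measure set" where
  "weak_cylinder S A = {N \<in> prob_measures_on S. \<forall>(g, a, b)\<in>A. integral\<^sup>L N g \<in> {a<..<b}}"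

text \<open>For compact \<open>S\<close> the weak topology is second countable, so that its Borel sets are generated by
  the evaluations \<open>N \<mapsto> \<integral>f dN\<close>.\<close>

lemma weak_topology_countable_base:
  fixes S :: "'a::metric_space set"
  assumes "compact S"
  obtains F :: "('a \<Rightarrow> real) set" where "countable F" "\<And>g. g \<in> F \<Longrightarrow> continuous_on S g"
    "\<And>U N. openin (weak_topology S) U \<Longrightarrow> N \<in> U \<Longrightarrow>
       \<exists>A. finite A \<and> A \<subseteq> F \<times> \<rat> \<times> \<rat> \<and> N \<in> weak_cylinder S A \<and> weak_cylinder S A \<subseteq> U"
proof -
  obtain F :: "('a \<Rightarrow> real) set" where F: "countable F" "\<And>g. g \<in> F \<Longrightarrow> continuous_on S g"
    "\<And>f e. continuous_on S f \<Longrightarrow> e > 0 \<Longrightarrow> \<exists>g\<in>F. \<forall>x\<in>S. \<bar>f x - g x\<bar> < e"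
    using countable_dense_continuous[OF assms] by metis
  have "\<forall>N\<in>U. \<exists>A. finite A \<and> A \<subseteq> F \<times> \<rat> \<times> \<rat> \<and> N \<in> weak_cylinder S A \<and> weak_cylinder S A \<subseteq> U"
    if "generate_topology_on (weak_subbasis S) U" for U
    using that
  proof induction
    case (Int a b)
    show ?case
    proof
      fix N assume N: "N \<in> a \<inter> b"
      obtain A where A: "finite A" "A \<subseteq> F \<times> \<rat> \<times> \<rat>" "N \<in> weak_cylinder S A" "weak_cylinder S A \<subseteq> a"
        using bspec[OF Int.IH(1), of N] N by blast
      obtain B where B: "finite B" "B \<subseteq> F \<times> \<rat> \<times> \<rat>" "N \<in> weak_cylinder S B" "weak_cylinder S B \<subseteq> b"
        using bspec[OF Int.IH(2), of N] N by blast
      have "weak_cylinder S (A \<union> B) = weak_cylinder S A \<inter> weak_cylinder S B"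
        unfolding weak_cylinder_def ball_Un by blast
      then show "\<exists>A. finite A \<and> A \<subseteq> F \<times> \<rat> \<times> \<rat> \<and> N \<in> weak_cylinder S A \<and> weak_cylinder S A \<subseteq> a \<inter> b"
        using A B by (intro exI[of _ "A \<union> B"]) blast
    qed
  next
    case (UN K)
    show ?case
    proof
      fix N assume "N \<in> \<Union>K"
      then obtain k where k: "k \<in> K" "N \<in> k" by blast
      obtain A where "finite A" "A \<subseteq> F \<times> \<rat> \<times> \<rat>" "N \<in> weak_cylinder S A" "weak_cylinder S A \<subseteq> k"
        using bspec[OF UN.IH[OF k(1)] k(2)] by blast
      then show "\<exists>A. finite A \<and> A \<subseteq> F \<times> \<rat> \<times> \<rat> \<and> N \<in> weak_cylinder S A \<and> weak_cylinder S A \<subseteq> \<Union>K"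
        using k(1) by (intro exI[of _ A]) blast
    qed
  next
    case (Basis s)
    then obtain f :: "'a \<Rightarrow> real" and V where fV: "s = {N \<in> prob_measures_on S. (\<integral>x. f x \<partial>N) \<in> V}"
      "continuous_on S f" "open V" unfolding weak_subbasis_def by blast
    show ?case
    proof
      fix N assume N: "N \<in> s"
      then have NP: "N \<in> prob_measures_on S" and "integral\<^sup>L N f \<in> V" using fV by auto
      then obtain e where e: "e > 0" "ball (integral\<^sup>L N f) e \<subseteq> V" using fV(3) by (metis openE)
      \<comment> \<open>Quarters suffice: replacing \<open>f\<close> by \<open>g\<close> costs one
        for each of the two measures, and the rational interval around the integral of
        \<open>g\<close> costs a third.\<close>
      obtain g where g: "g \<in> F" "\<forall>x\<in>S. \<bar>f x - g x\<bar> < e / 4"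
        using F(3)[OF fV(2), of "e / 4"] e(1) by auto
      have close: "\<bar>integral\<^sup>L N' f - integral\<^sup>L N' g\<bar> \<le> e / 4" if "N' \<in> prob_measures_on S" for N'
        using integral_prob_measures_on_close[OF that assms fV(2) F(2)[OF g(1)]] g(2) less_imp_le by blast
      obtain a where a: "a \<in> \<rat>" "integral\<^sup>L N g - e / 4 < a" "a < integral\<^sup>L N g"
        using Rats_dense_in_real[of "integral\<^sup>L N g - e / 4" "integral\<^sup>L N g"] e(1) by auto
      obtain b where b: "b \<in> \<rat>" "integral\<^sup>L N g < b" "b < integral\<^sup>L N g + e / 4"
        using Rats_dense_in_real[of "integral\<^sup>L N g" "integral\<^sup>L N g + e / 4"] e(1) by auto
      have "N \<in> weak_cylinder S {(g, a, b)}" using NP a b by (simp add: weak_cylinder_def)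
      moreover have "weak_cylinder S {(g, a, b)} \<subseteq> s"
      proof
        fix N' assume "N' \<in> weak_cylinder S {(g, a, b)}"
        then have N': "N' \<in> prob_measures_on S" "a < integral\<^sup>L N' g" "integral\<^sup>L N' g < b"
          by (simp_all add: weak_cylinder_def)
        have "\<bar>integral\<^sup>L N f - integral\<^sup>L N' f\<bar> < e"
          using close[OF N'(1)] close[OF NP] N' a b by linarith
        then show "N' \<in> s" using e(2) N'(1) unfolding fV(1) by (auto simp: dist_real_def)
      qed
      ultimately show "\<exists>A. finite A \<and> A \<subseteq> F \<times> \<rat> \<times> \<rat> \<and> N \<in> weak_cylinder S A \<and> weak_cylinder S A \<subseteq> s"
        using g(1) a(1) b(1) by (intro exI[of _ "{(g, a, b)}"]) auto
    qed
  qed simp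
  then show thesis
    using that[OF F(1,2)] unfolding openin_weak_topology by simp
qed

text \<open>The sigma-algebra of \<open>prob_algebra\<close> only controls integrals of measurable
  functions, that is, preimages of cylinders. An open set is a union of basic cylinders, and its
  preimage is measurable because countably many of them suffice.\<close>

lemma measurable_weak_topology:
  fixes S :: "'a::metric_space set"
  assumes "compact S" and Z: "Z \<in> M \<rightarrow>\<^sub>M prob_algebra (restrict_space borel S)"
  shows "Z \<in> M \<rightarrow>\<^sub>M borel_of (weak_topology S)"
proof -
  obtain F :: "('a \<Rightarrow> real) set" where F: "countable F" "\<And>g. g \<in> F \<Longrightarrow> continuous_on S g"
    "\<And>U N. openin (weak_topology S) U \<Longrightarrow> N \<in> U \<Longrightarrow>
       \<exists>A. finite A \<and> A \<subseteq> F \<times> \<rat> \<times> \<rat> \<and> N \<in> weak_cylinder S A \<and> weak_cylinder S A \<subseteq> U"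
    using weak_topology_countable_base[OF assms(1)] by metis
  have ZP: "Z \<omega> \<in> prob_measures_on S" if "\<omega> \<in> space M" for \<omega>
    using measurable_space[OF Z that] by (simp add: prob_measures_on_def)
  have int: "(\<lambda>\<omega>. integral\<^sup>L (Z \<omega>) g) \<in> borel_measurable M" if "g \<in> F" for g
    using measurable_compose[OF measurable_prob_algebraD[OF Z] integral_measurable_subprob_algebra]
      borel_measurable_continuous_on_restrict[OF F(2)[OF that]] by blast
  have W: "Z -` weak_cylinder S A \<inter> space M \<in> sets M" if A: "finite A" "A \<subseteq> F \<times> \<rat> \<times> \<rat>" for A
  proof -
    have "Z -` weak_cylinder S A \<inter> space M = {\<omega> \<in> space M. \<forall>x\<in>A. integral\<^sup>L (Z \<omega>) (fst x) \<in> {fst (snd x)<..<snd (snd x)}}"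
      using ZP by (auto simp: weak_cylinder_def split_beta)
    also have "\<dots> \<in> sets M"
    proof (rule sets.sets_Collect_finite_All[OF _ A(1)])
      show "{\<omega> \<in> space M. integral\<^sup>L (Z \<omega>) (fst x) \<in> {fst (snd x)<..<snd (snd x)}} \<in> sets M" if "x \<in> A" for x
        by (rule measurable_sets_Collect[OF int, of "fst x"]) (use A(2) that in auto)
    qed
    finally show ?thesis .
  qed
  show ?thesis
    unfolding borel_of_def
  proof (rule measurable_sigma_sets)
    show "sets (sigma (topspace (weak_topology S)) {U. openin (weak_topology S) U}) =
        sigma_sets (topspace (weak_topology S)) {U. openin (weak_topology S) U}"
      by (rule sets_measure_of) (auto dest: openin_subset)
    show "{U. openin (weak_topology S) U} \<subseteq> Pow (topspace (weak_topology S))"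
      by (auto dest: openin_subset)
    show "Z \<in> space M \<rightarrow> topspace (weak_topology S)"
      using ZP by (auto simp: topspace_weak_topology)
    fix U assume "U \<in> {U. openin (weak_topology S) U}"
    then have U: "openin (weak_topology S) U" by simp
    define \<A> where "\<A> = {A. (finite A \<and> A \<subseteq> F \<times> \<rat> \<times> \<rat>) \<and> weak_cylinder S A \<subseteq> U}"
    have "countable {A. finite A \<and> A \<subseteq> F \<times> (\<rat> :: real set) \<times> (\<rat> :: real set)}"
      using F(1) countable_rat by (intro countable_Collect_finite_subset countable_SIGMA) auto
    then have "countable \<A>" by (rule countable_subset[rotated]) (auto simp: \<A>_def)
    have "U = (\<Union>A\<in>\<A>. weak_cylinder S A)"
    proof (intro set_eqI iffI)
      fix N assume "N \<in> U"
      from F(3)[OF U this] obtain A where "A \<in> \<A>" "N \<in> weak_cylinder S A"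
        unfolding \<A>_def by blast
      then show "N \<in> (\<Union>A\<in>\<A>. weak_cylinder S A)" by (rule UN_I)
    qed (auto simp: \<A>_def)
    then have "Z -` U \<inter> space M = (\<Union>A\<in>\<A>. Z -` weak_cylinder S A \<inter> space M)" by auto
    also have "\<dots> \<in> sets M"
      using \<open>countable \<A>\<close> W by (intro sets.countable_UN') (auto simp: \<A>_def)
    finally show "Z -` U \<inter> space M \<in> sets M" .
  qed
qed

lemma limitin_weak_topology:
  assumes N: "N \<in> prob_measures_on S" and Z: "\<And>n. Z n \<in> prob_measures_on S"
    and lim: "\<And>f. continuous_on S f \<Longrightarrow> (\<lambda>n. \<integral>x. f x \<partial>(Z n)) \<longlonglongrightarrow> (\<integral>x. f x \<partial>N :: real)"
  shows "limitin (weak_topology S) Z N sequentially"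
proof -
  have "N \<in> U \<longrightarrow> (\<forall>\<^sub>F n in sequentially. Z n \<in> U)"
    if "generate_topology_on (weak_subbasis S) U" for U
    using that
  proof induction
    case (Int a b)
    then show ?case by (auto intro: eventually_conj)
  next
    case (UN K)
    show ?case
    proof
      assume "N \<in> \<Union>K"
      then obtain k where k: "k \<in> K" "N \<in> k" by blast
      then have "\<forall>\<^sub>F n in sequentially. Z n \<in> k" using UN by blast
      then show "\<forall>\<^sub>F n in sequentially. Z n \<in> \<Union>K" by (rule eventually_mono) (use k in blast)
    qed
  next
    case (Basis s)
    then obtain f :: "'a \<Rightarrow> real" and V where fV: "s = {N \<in> prob_measures_on S. (\<integral>x. f x \<partial>N) \<in> V}"
      "continuous_on S f" "open V" unfolding weak_subbasis_def by blast
    show ?case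
      using topological_tendstoD[OF lim[OF fV(2)] fV(3)] Z by (auto simp: fV(1))
  qed simp
  then show ?thesis
    using N by (auto simp: limitin_def topspace_weak_topology openin_weak_topology)
qed

text \<open>Almost sure weak convergence gives convergence of every continuous bounded functional
  along almost every realisation, and dominated convergence passes to the means. Working with
  integrals of test functions keeps the topology on measures out of the probabilistic part.\<close>

lemma converges_in_distribution_weakI:
  fixes S :: "'a::metric_space set"
  assumes "prob_space M" "compact S"
    and Z: "\<And>n. Z n \<in> M \<rightarrow>\<^sub>M prob_algebra (restrict_space borel S)"
    and Z': "Z' \<in> M \<rightarrow>\<^sub>M prob_algebra (restrict_space borel S)"
    and X: "\<And>n. AE \<omega> in M. Z n \<omega> = X n \<omega>"
    and lim: "AE \<omega> in M. \<forall>f. continuous_on S f \<longrightarrow>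
        (\<lambda>n. \<integral>x. f x \<partial>(Z n \<omega>)) \<longlonglongrightarrow> (\<integral>x. f x \<partial>(Z' \<omega>) :: real)"
  shows "converges_in_distribution M (weak_topology S) X Z'"
  unfolding converges_in_distribution_def
proof (rule exI[of _ Z], rule exI[of _ Z'], intro conjI allI impI)
  interpret prob_space M by fact
  show mZ: "Z n \<in> M \<rightarrow>\<^sub>M borel_of (weak_topology S)" for n
    by (rule measurable_weak_topology[OF assms(2) Z])
  show mZ': "Z' \<in> M \<rightarrow>\<^sub>M borel_of (weak_topology S)"
    by (rule measurable_weak_topology[OF assms(2) Z'])
  show "AE \<omega> in M. Z n \<omega> = X n \<omega>" for n by (rule X)
  show "AE \<omega> in M. Z' \<omega> = Z' \<omega>" by simp
  fix \<Phi> assume \<Phi>: "continuous_map (weak_topology S) euclideanreal \<Phi> \<and> bounded (\<Phi> ` topspace (weak_topology S))"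
  have P: "Z n \<omega> \<in> prob_measures_on S" "Z' \<omega> \<in> prob_measures_on S" if "\<omega> \<in> space M" for n \<omega>
    using measurable_space[OF Z that] measurable_space[OF Z' that] by (auto simp: prob_measures_on_def)
  have m\<Phi>: "\<Phi> \<in> borel_of (weak_topology S) \<rightarrow>\<^sub>M borel"
  proof (rule borel_measurableI)
    fix V :: "real set" assume V: "open V"
    have "openin (weak_topology S) {x \<in> topspace (weak_topology S). \<Phi> x \<in> V}"
      using \<Phi> V by (intro openin_continuous_map_preimage[of _ euclideanreal]) auto
    moreover have "\<Phi> -` V \<inter> space (borel_of (weak_topology S)) = {x \<in> topspace (weak_topology S). \<Phi> x \<in> V}"
      by (auto simp: borel_of_def space_measure_of_conv)
    moreover have "{U. openin (weak_topology S) U} \<subseteq> Pow (topspace (weak_topology S))"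
      by (auto dest: openin_subset)
    ultimately show "\<Phi> -` V \<inter> space (borel_of (weak_topology S)) \<in> sets (borel_of (weak_topology S))"
      unfolding borel_of_def by (simp add: sigma_sets.Basic)
  qed
  obtain B where B: "\<And>N. N \<in> prob_measures_on S \<Longrightarrow> \<bar>\<Phi> N\<bar> \<le> B"
    using \<Phi> by (auto simp: bounded_iff topspace_weak_topology)
  show "(\<lambda>n. \<integral>\<omega>. \<Phi> (Z n \<omega>) \<partial>M) \<longlonglongrightarrow> (\<integral>\<omega>. \<Phi> (Z' \<omega>) \<partial>M)"
  proof (rule integral_dominated_convergence[where w = "\<lambda>_. B"])
    show "(\<lambda>\<omega>. \<Phi> (Z' \<omega>)) \<in> borel_measurable M" "(\<lambda>\<omega>. \<Phi> (Z n \<omega>)) \<in> borel_measurable M" for n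
      using measurable_compose[OF mZ m\<Phi>] measurable_compose[OF mZ' m\<Phi>] by auto
    show "AE \<omega> in M. norm (\<Phi> (Z n \<omega>)) \<le> B" for n using B P by (intro AE_I2) auto
    show "AE \<omega> in M. (\<lambda>n. \<Phi> (Z n \<omega>)) \<longlonglongrightarrow> \<Phi> (Z' \<omega>)"
      using lim
    proof (rule AE_mp, intro AE_I2 impI)
      fix \<omega> assume \<omega>: "\<omega> \<in> space M" and l: "\<forall>f. continuous_on S f \<longrightarrow>
        (\<lambda>n. \<integral>x. f x \<partial>(Z n \<omega>)) \<longlonglongrightarrow> (\<integral>x. f x \<partial>(Z' \<omega>) :: real)"
      have "limitin (weak_topology S) (\<lambda>n. Z n \<omega>) (Z' \<omega>) sequentially"
        using P[OF \<omega>] l by (intro limitin_weak_topology) auto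
      then have "limitin euclideanreal (\<Phi> \<circ> (\<lambda>n. Z n \<omega>)) (\<Phi> (Z' \<omega>)) sequentially"
        using \<Phi> by (intro continuous_map_limit) auto
      then show "(\<lambda>n. \<Phi> (Z n \<omega>)) \<longlonglongrightarrow> \<Phi> (Z' \<omega>)" by (simp add: comp_def)
    qed
  qed simp
qed

section \<open>Convergence of the integrals\<close>

text \<open>At distances of at least \<open>d\<close> the quadratic term alone exceeds the
  oscillation 2 B, whence the constant 2 B / d^2. The square matches \<open>spread\<close>, which
  bounds squared distances.\<close>

lemma uniformly_continuous_square_modulus:
  fixes f :: "'a::real_normed_vector \<Rightarrow> real"
  assumes "compact S" "continuous_on S f" "e > 0"
  obtains K where "K \<ge> 0" "\<And>x y. x \<in> S \<Longrightarrow> y \<in> S \<Longrightarrow> \<bar>f x - f y\<bar> \<le> e + K * (norm (x - y))\<^sup>2"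
proof -
  have "uniformly_continuous_on S f" using assms by (simp add: compact_uniformly_continuous)
  then obtain d where d: "d > 0" "\<And>x y. x \<in> S \<Longrightarrow> y \<in> S \<Longrightarrow> dist y x < d \<Longrightarrow> dist (f y) (f x) < e"
    unfolding uniformly_continuous_on_def using assms(3) by metis
  obtain B where B: "\<And>x. x \<in> S \<Longrightarrow> \<bar>f x\<bar> \<le> B"
    using compact_continuous_image[OF assms(2,1), THEN compact_imp_bounded] by (auto simp: bounded_iff)
  define K where "K = 2 * \<bar>B\<bar> / d\<^sup>2"
  have K: "K \<ge> 0" by (simp add: K_def)
  have "\<bar>f x - f y\<bar> \<le> e + K * (norm (x - y))\<^sup>2" if "x \<in> S" "y \<in> S" for x y
  proof (cases "dist y x < d")
    case True
    then have "\<bar>f x - f y\<bar> < e" using d(2)[OF that] by (simp add: dist_real_def abs_minus_commute)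
    moreover have "K * (norm (x - y))\<^sup>2 \<ge> 0" using K by simp
    ultimately show ?thesis by linarith
  next
    case False
    have "\<bar>f x - f y\<bar> \<le> K * d\<^sup>2" using B[OF that(1)] B[OF that(2)] d(1) by (simp add: K_def)
    also have "\<dots> \<le> K * (norm (x - y))\<^sup>2"
      using False d(1) K by (intro mult_left_mono power_mono) (auto simp: dist_norm norm_minus_commute)
    finally show ?thesis using assms(3) by linarith
  qed
  then show thesis using K that by blast
qed

text \<open>A word of length at least \<open>K\<close> has exactly one ancestor of length
  \<open>K\<close> (possibly itself), and a shorter word has none. Split nodes can thus be sorted by
  their ancestor at a fixed level.\<close>

lemma sum_suffix_of_length:
  "(\<Sum>u | length u = K. if suffix u v then r else 0) = (if K \<le> length v then r else 0)"
  for v :: node and r :: real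
proof (cases "K \<le> length v")
  case True
  have "{u. length u = K \<and> suffix u v} = {drop (length v - K) v}"
    using True suffix_drop[of "length v - K" v] by (auto simp: suffix_def)
  then show ?thesis
    using True by (simp add: sum.If_cases Collect_conj_eq)
next
  case False
  then have "\<not> suffix u v" if "length u = K" for u
    using suffix_length_le[of u v] that by auto
  then show ?thesis using False by (simp add: sum.neutral)
qed

lemma corner_in_filled_triangle: "corner p u i \<in> filled_triangle p u"
proof -
  have "corner p u i = bary p u (axis i 1)"
    by (simp add: bary_def axis_def if_distrib[of "\<lambda>r. r *\<^sub>R _"] cong: if_cong)
  moreover have "(\<Sum>j\<in>UNIV. axis i (1::real) $ j) = 1" by (simp add: axis_def)
  moreover have "axis i (1::real) $ j \<ge> 0" for j by (simp add: axis_def)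
  ultimately show ?thesis unfolding filled_triangle_bary by blast
qed

lemma integral_approx_corners:
  assumes p: "weights p" and y: "weights y" and N: "N \<in> prob_measures_on root_triangle"
    and meas: "\<And>u. measure N (filled_triangle p u) = frag_length y u"
    and f: "continuous_on root_triangle f"
    and K: "\<And>x y. x \<in> root_triangle \<Longrightarrow> y \<in> root_triangle \<Longrightarrow> \<bar>f x - f y\<bar> \<le> e + C * (norm (x - y))\<^sup>2"
    and C: "C \<ge> 0"
  shows "\<bar>integral\<^sup>L N f - (\<Sum>u | length u = k. frag_length y u * f (corner p u 1))\<bar> \<le>
           e + C * (\<Sum>u | length u = k. frag_length y u * spread p u)"
proof -
  let ?L = "{u :: node. length u = k}"
  interpret prob_space N using N by (rule prob_measures_onD)
  note sN = prob_measures_onD(2,3)[OF N]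
  have Int_root [simp]: "filled_triangle p u \<inter> root_triangle = filled_triangle p u" for u
    using filled_triangle_subset_root[OF p, of u] by blast
  have prob_root [simp]: "prob root_triangle = 1" using prob_space sN(2) by simp
  have mT [measurable]: "filled_triangle p u \<in> sets N" for u
    unfolding sN(1) sets_restrict_space
    using compact_filled_triangle[of p u] filled_triangle_subset_root[OF p, of u]
    by (intro image_eqI[of _ _ "filled_triangle p u"]) (auto intro: borel_compact)
  have int_f: "integrable N f"
    by (rule integrable_prob_measures_on[OF N compact_root_triangle f])
  have int_ind: "integrable N (indicator (filled_triangle p u) :: complex \<Rightarrow> real)" for u
    by (rule integrable_real_indicator) (auto simp: emeasure_eq_measure)
  have int_fi: "integrable N (\<lambda>x. indicator (filled_triangle p u) x * f x)" for u
    using integrable_mult_indicator[OF mT int_f] by simp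
  obtain B where B: "\<And>x. x \<in> root_triangle \<Longrightarrow> \<bar>f x\<bar> \<le> B"
    using compact_continuous_image[OF f compact_root_triangle, THEN compact_imp_bounded]
    by (auto simp: bounded_iff)
  \<comment> \<open>The number of triangles of level k that contain x, beyond the first. As
    \<open>h\<close> is nonnegative with integral zero and \<open>f\<close> is bounded, the product
    of the two also integrates to zero.\<close>
  define h where "h x = (\<Sum>u\<in>?L. indicator (filled_triangle p u) x) - (1::real)" for x
  have h0: "h x \<ge> 0" if x: "x \<in> root_triangle" for x
  proof -
    obtain u where u: "u \<in> ?L" "x \<in> filled_triangle p u"
      using subsetD[OF root_triangle_cover[OF p, of k] x] by blast
    have "indicator (filled_triangle p u) x \<le> (\<Sum>u\<in>?L. indicator (filled_triangle p u) x :: real)"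
      by (rule member_le_sum[OF u(1)]) auto
    then show ?thesis using u(2) by (simp add: h_def)
  qed
  have int_h: "integrable N h"
    unfolding h_def by (intro Bochner_Integration.integrable_diff Bochner_Integration.integrable_sum int_ind) auto
  have "integral\<^sup>L N h = (\<Sum>u\<in>?L. frag_length y u) - 1"
    unfolding h_def using int_ind meas by (simp add: prob_space sN(2))
  then have h_int: "integral\<^sup>L N h = 0" using sum_frag_length[OF y] by simp
  have int_fh: "integrable N (\<lambda>x. h x * f x)"
    unfolding h_def left_diff_distrib sum_distrib_right
    by (intro Bochner_Integration.integrable_diff Bochner_Integration.integrable_sum int_fi) (use int_f in auto)
  have "\<bar>\<integral>x. h x * f x \<partial>N\<bar> \<le> (\<integral>x. \<bar>h x * f x\<bar> \<partial>N)" by (rule integral_abs_bound)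
  also have "\<dots> \<le> (\<integral>x. B * h x \<partial>N)"
  proof (rule integral_mono)
    fix x assume "x \<in> space N"
    then have x: "x \<in> root_triangle" using sN(2) by simp
    show "\<bar>h x * f x\<bar> \<le> B * h x"
      using mult_right_mono[OF B[OF x] h0[OF x]] h0[OF x] by (simp add: abs_mult mult.commute)
  qed (use int_fh int_h in auto)
  finally have fh: "(\<integral>x. h x * f x \<partial>N) = 0" using h_int by simp
  have "integral\<^sup>L N f = (\<integral>x. (\<Sum>u\<in>?L. indicator (filled_triangle p u) x * f x) - h x * f x \<partial>N)"
    by (simp add: h_def sum_distrib_right[symmetric] left_diff_distrib)
  also have "\<dots> = (\<Sum>u\<in>?L. \<integral>x. indicator (filled_triangle p u) x * f x \<partial>N)"
    by (simp only: Bochner_Integration.integral_diff[OF Bochner_Integration.integrable_sum[OF int_fi] int_fh]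
       Bochner_Integration.integral_sum[OF int_fi] fh diff_0_right)
  finally have eq: "integral\<^sup>L N f = (\<Sum>u\<in>?L. \<integral>x. indicator (filled_triangle p u) x * f x \<partial>N)" .
  have piece: "\<bar>(\<integral>x. indicator (filled_triangle p u) x * f x \<partial>N) - frag_length y u * f (corner p u 1)\<bar>
      \<le> frag_length y u * (e + C * spread p u)" for u
  proof -
    have "(\<integral>x. indicator (filled_triangle p u) x * f x \<partial>N) - frag_length y u * f (corner p u 1) =
      (\<integral>x. indicator (filled_triangle p u) x * f x - indicator (filled_triangle p u) x * f (corner p u 1) \<partial>N)"
      unfolding Bochner_Integration.integral_diff[OF int_fi integrable_mult_left[OF int_ind]]
      by (simp add: sN(2) meas)
    also have "\<bar>\<dots>\<bar> \<le> (\<integral>x. \<bar>indicator (filled_triangle p u) x * f x - indicator (filled_triangle p u) x * f (corner p u 1)\<bar> \<partial>N)"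
      by (rule integral_abs_bound)
    also have "\<dots> \<le> (\<integral>x. indicator (filled_triangle p u) x * (e + C * spread p u) \<partial>N)"
    proof (rule integral_mono)
      fix x
      show "\<bar>indicator (filled_triangle p u) x * f x - indicator (filled_triangle p u) x * f (corner p u 1)\<bar>
         \<le> indicator (filled_triangle p u) x * (e + C * spread p u)"
      proof (cases "x \<in> filled_triangle p u")
        case True
        have "\<bar>f x - f (corner p u 1)\<bar> \<le> e + C * (norm (x - corner p u 1))\<^sup>2"
          using filled_triangle_subset_root[OF p, of u] True corner_in_filled_triangle[of p u 1]
          by (intro K) auto
        also have "\<dots> \<le> e + C * spread p u"
          using filled_triangle_dist_le_spread[OF True corner_in_filled_triangle] C
          by (simp add: mult_left_mono)
        finally show ?thesis using True by simp
      qed simp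
    qed (use int_fi int_ind in auto)
    also have "\<dots> = frag_length y u * (e + C * spread p u)"
      using int_ind meas by (simp add: sN(2))
    finally show ?thesis .
  qed
  have "\<bar>integral\<^sup>L N f - (\<Sum>u\<in>?L. frag_length y u * f (corner p u 1))\<bar>
     \<le> (\<Sum>u\<in>?L. frag_length y u * (e + C * spread p u))"
    unfolding eq sum_subtractf[symmetric] by (rule order_trans[OF sum_abs sum_mono[OF piece]])
  also have "\<dots> = e * (\<Sum>u\<in>?L. frag_length y u) + C * (\<Sum>u\<in>?L. frag_length y u * spread p u)"
    by (simp add: distrib_left sum.distrib sum_distrib_left ac_simps)
  finally show ?thesis by (simp add: sum_frag_length[OF y])
qed

text \<open>Words carry their last letter first, so \<open>suffix u v\<close> says that
  \<open>v\<close> is \<open>u\<close> or one of its descendants.\<close>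

definition descendant_count :: "(nat \<Rightarrow> real) \<Rightarrow> (node \<Rightarrow> real ^ 3) \<Rightarrow> nat \<Rightarrow> node \<Rightarrow> real" where
  "descendant_count x y n u = real (card {k. k < n \<and> suffix u (split_leaf x y k)})"

lemma descendant_count_limit:
  assumes y: "weights y" and x: "\<forall>i\<ge>1. x i \<in> {0..<1}"
    and freq: "(\<lambda>n. real (card {k. k < n \<and> x (Suc k) \<in> frag_interval y u}) / real n) \<longlonglongrightarrow> frag_length y u"
  shows "(\<lambda>n. descendant_count x y n u / real n) \<longlonglongrightarrow> frag_length y u"
proof (rule tendsto_sandwich[OF _ _ _ freq])
  let ?N = "\<lambda>n. real (card {k. k < n \<and> x (Suc k) \<in> frag_interval y u})"
  show "(\<lambda>n. ?N n / real n - real (length u) / real n) \<longlonglongrightarrow> frag_length y u"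
    using tendsto_diff[OF freq lim_const_over_n[of "real (length u)"]] by simp
  show "\<forall>\<^sub>F n in sequentially. ?N n / real n - real (length u) / real n \<le> descendant_count x y n u / real n"
  proof (intro always_eventually allI)
    fix n
    have "?N n - real (length u) \<le> descendant_count x y n u"
      using card_split_descendants(2)[OF y x, of n u] unfolding descendant_count_def by linarith
    then show "?N n / real n - real (length u) / real n \<le> descendant_count x y n u / real n"
      by (simp add: diff_divide_distrib[symmetric] divide_right_mono)
  qed
  show "\<forall>\<^sub>F n in sequentially. descendant_count x y n u / real n \<le> ?N n / real n"
    using card_split_descendants(1)[OF y x, where u = u]
    by (intro always_eventually allI) (simp add: descendant_count_def divide_right_mono)
qed

text \<open>A split node of length at least \<open>k\<close> is charged to its ancestor of level
  \<open>k\<close>, whose triangle contains its vertex. The shorter split nodes are distinct words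
  of length less than \<open>k\<close>, so their contribution is bounded uniformly in
  \<open>n\<close> and disappears after division by \<open>n\<close>.\<close>

lemma sum_inner_vertices_approx:
  assumes p: "weights p" and y: "weights y" and x: "\<forall>i\<ge>1. x i \<in> {0..<1}"
    and B: "\<And>x. x \<in> root_triangle \<Longrightarrow> \<bar>f x\<bar> \<le> B"
    and K: "\<And>x y. x \<in> root_triangle \<Longrightarrow> y \<in> root_triangle \<Longrightarrow> \<bar>f x - f y\<bar> \<le> e + C * (norm (x - y))\<^sup>2"
    and C: "C \<ge> 0"
  shows "\<bar>(\<Sum>j<n. f (inner_vertex p (split_leaf x y j))) -
            (\<Sum>u | length u = k. descendant_count x y n u * f (corner p u 1))\<bar> \<le>
          (\<Sum>u | length u = k. descendant_count x y n u * (e + C * spread p u)) +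
            B * real (card {u :: node. length u < k})"
proof -
  let ?L = "{u :: node. length u = k}"
  let ?s = "split_leaf x y"
  let ?M = "\<lambda>j. inner_vertex p (?s j)"
  have count: "descendant_count x y n u * r = (\<Sum>j<n. if suffix u (?s j) then r else 0)" for u r
    by (simp add: descendant_count_def sum.If_cases Collect_conj_eq lessThan_def)
  have M: "?M j \<in> root_triangle" for j
    using inner_vertex_filled[OF p, of "[]" "?s j"] by (simp add: filled_triangle_Nil)
  have B0: "B \<ge> 0" using B[OF M] by (metis abs_ge_zero order_trans)
  have "(\<Sum>j<n. f (?M j)) - (\<Sum>u\<in>?L. descendant_count x y n u * f (corner p u 1)) =
     (\<Sum>j<n. (\<Sum>u\<in>?L. if suffix u (?s j) then f (?M j) - f (corner p u 1) else 0) + (if length (?s j) < k then f (?M j) else 0))"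
  proof -
    have "f (?M j) = (\<Sum>u\<in>?L. if suffix u (?s j) then f (?M j) else 0) + (if length (?s j) < k then f (?M j) else 0)" for j
      unfolding sum_suffix_of_length by auto
    then have "(\<Sum>j<n. f (?M j)) = (\<Sum>j<n. (\<Sum>u\<in>?L. if suffix u (?s j) then f (?M j) else 0) + (if length (?s j) < k then f (?M j) else 0))"
      by (intro sum.cong refl)
    moreover have "(\<Sum>u\<in>?L. descendant_count x y n u * f (corner p u 1)) =
       (\<Sum>j<n. \<Sum>u\<in>?L. if suffix u (?s j) then f (corner p u 1) else 0)"
      unfolding count by (rule sum.swap)
    ultimately show ?thesis
      by (simp only: sum_subtractf[symmetric]) (auto intro!: sum.cong simp: sum_subtractf[symmetric] add_diff_eq diff_add_eq[symmetric])
  qed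
  also have "\<bar>\<dots>\<bar> \<le> (\<Sum>j<n. (\<Sum>u\<in>?L. if suffix u (?s j) then e + C * spread p u else 0) + (if length (?s j) < k then B else 0))"
  proof (intro order_trans[OF sum_abs] sum_mono order_trans[OF abs_triangle_ineq] add_mono)
    fix j u assume "u \<in> ?L"
    show "\<bar>if suffix u (?s j) then f (?M j) - f (corner p u 1) else 0\<bar> \<le> (if suffix u (?s j) then e + C * spread p u else 0)"
    proof (cases "suffix u (?s j)")
      case True
      note MT = inner_vertex_filled[OF p True]
      have "\<bar>f (?M j) - f (corner p u 1)\<bar> \<le> e + C * (norm (?M j - corner p u 1))\<^sup>2"
        using M filled_triangle_subset_root[OF p, of u] corner_in_filled_triangle[of p u 1] by (intro K) auto
      also have "\<dots> \<le> e + C * spread p u"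
        using filled_triangle_dist_le_spread[OF MT corner_in_filled_triangle] C by (simp add: mult_left_mono)
      finally show ?thesis using True by simp
    qed simp
  qed (use B[OF M] in simp)
  also have "\<dots> = (\<Sum>u\<in>?L. descendant_count x y n u * (e + C * spread p u)) + (\<Sum>j<n. if length (?s j) < k then B else 0)"
    unfolding count sum.distrib by (rule arg_cong2[where f = "(+)", OF sum.swap refl])
  also have "(\<Sum>j<n. if length (?s j) < k then B else 0) = B * real (card {j. j < n \<and> length (?s j) < k})"
    by (simp add: sum.If_cases Collect_conj_eq lessThan_def)
  also have "\<dots> \<le> B * real (card {u :: node. length u < k})"
  proof (intro mult_left_mono B0 of_nat_mono card_inj_on_le[of ?s])
    show "inj_on ?s {j. j < n \<and> length (?s j) < k}"
      using inj_split_leaf[OF y x] by (rule inj_on_subset) simp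
  qed auto
  finally show ?thesis by simp
qed

text \<open>The level \<open>k\<close> is fixed before \<open>n\<close>: it makes the weighted
  spread small, and then only finitely many counts have to converge. The same sum over vertices at
  that level approximates both integrals.\<close>

proposition occupation_integral_limit:
  assumes p: "weights p" and y: "weights y" and x: "\<forall>i\<ge>1. x i \<in> {0..<1}"
    and N: "N \<in> prob_measures_on root_triangle"
    and meas: "\<And>u. measure N (filled_triangle p u) = frag_length y u"
    and freq: "\<And>u. (\<lambda>n. real (card {k. k < n \<and> x (Suc k) \<in> frag_interval y u}) / real n) \<longlonglongrightarrow> frag_length y u"
    and spread: "\<And>d. d > 0 \<Longrightarrow> \<exists>k. (\<Sum>u | length u = k. frag_length y u * spread p u) < d"
    and f: "continuous_on root_triangle f"
  shows "(\<lambda>n. (\<Sum>j<n. f (inner_vertex p (split_leaf x y j))) / real n) \<longlonglongrightarrow> integral\<^sup>L N f"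
proof (rule LIMSEQ_I)
  fix r :: real assume "r > 0"
  \<comment> \<open>Five of the six parts are used: 2e for the vertices against the level sum, e for
    the convergence of the counts, and 2e for the level sum against the limit integral.\<close>
  define e where "e = r / 6"
  have e: "e > 0" using \<open>r > 0\<close> by (simp add: e_def)
  obtain C where C: "C \<ge> 0"
    "\<And>x y. x \<in> root_triangle \<Longrightarrow> y \<in> root_triangle \<Longrightarrow> \<bar>f x - f y\<bar> \<le> e + C * (norm (x - y))\<^sup>2"
    using uniformly_continuous_square_modulus[OF compact_root_triangle f e] by blast
  obtain B where B: "\<And>x. x \<in> root_triangle \<Longrightarrow> \<bar>f x\<bar> \<le> B"
    using compact_continuous_image[OF f compact_root_triangle, THEN compact_imp_bounded]
    by (auto simp: bounded_iff)
  \<comment> \<open>The added 1 avoids dividing by zero when \<open>C\<close> vanishes.\<close>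
  obtain k where k: "(\<Sum>u | length u = k. frag_length y u * spread p u) < e / (C + 1)"
    using spread[of "e / (C + 1)"] e C(1) by auto
  define X where "X = (\<Sum>u | length u = k. frag_length y u * spread p u)"
  have "X \<ge> 0" unfolding X_def
    using spread_nonneg frag_length_pos[OF y] by (intro sum_nonneg) (simp add: less_imp_le)
  then have "C * X \<le> (C + 1) * X" by (simp add: mult_right_mono)
  also have "\<dots> < e" using k C(1) unfolding X_def[symmetric] by (simp add: pos_less_divide_eq mult.commute)
  finally have CX: "C * X < e" .
  let ?D = "descendant_count x y"
  define c where "c = B * real (card {u :: node. length u < k})"
  define b where "b n = (\<Sum>u | length u = k. ?D n u / real n * (e + C * spread p u)) + c / real n" for n
  define g where "g n = (\<Sum>u | length u = k. ?D n u / real n * f (corner p u 1))" for n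
  define G where "G = (\<Sum>u | length u = k. frag_length y u * f (corner p u 1))"
  note lim = descendant_count_limit[OF y x freq]
  have "b \<longlonglongrightarrow> (\<Sum>u | length u = k. frag_length y u * (e + C * spread p u)) + 0"
    unfolding b_def by (intro tendsto_intros lim lim_const_over_n)
  also have "(\<Sum>u | length u = k. frag_length y u * (e + C * spread p u)) + 0 = e + C * X"
    using sum_frag_length[OF y, of k]
    by (simp add: X_def distrib_left sum.distrib sum_distrib_left[symmetric] sum_distrib_right[symmetric] mult.left_commute[of _ C])
  finally have "\<forall>\<^sub>F n in sequentially. b n < 2 * e" using CX by (intro order_tendstoD(2)) auto
  moreover have "g \<longlonglongrightarrow> G" unfolding g_def G_def by (intro tendsto_intros lim)
  then have "\<forall>\<^sub>F n in sequentially. \<bar>g n - G\<bar> < e"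
    using e tendstoD[of g G sequentially e] by (simp add: dist_real_def)
  ultimately have "\<forall>\<^sub>F n in sequentially. n > 0 \<and> b n < 2 * e \<and> \<bar>g n - G\<bar> < e"
    by (intro eventually_conj eventually_gt_at_top)
  then obtain n0 where n0: "\<And>n. n \<ge> n0 \<Longrightarrow> n > 0 \<and> b n < 2 * e \<and> \<bar>g n - G\<bar> < e"
    unfolding eventually_sequentially by blast
  have G: "\<bar>integral\<^sup>L N f - G\<bar> \<le> e + C * X"
    unfolding G_def X_def by (rule integral_approx_corners[OF p y N meas f C(2) C(1)])
  show "\<exists>n0. \<forall>n\<ge>n0. norm ((\<Sum>j<n. f (inner_vertex p (split_leaf x y j))) / real n - integral\<^sup>L N f) < r"
  proof (intro exI[of _ n0] allI impI)
    fix n assume n: "n \<ge> n0"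
    define R where "R = (\<Sum>j<n. f (inner_vertex p (split_leaf x y j)))"
    have n_pos: "real n > 0" using n0[OF n] by simp
    have "\<bar>R - (\<Sum>u | length u = k. ?D n u * f (corner p u 1))\<bar> \<le>
       (\<Sum>u | length u = k. ?D n u * (e + C * spread p u)) + c"
      unfolding R_def c_def by (rule sum_inner_vertices_approx[OF p y x B C(2) C(1)])
    then have "\<bar>R - (\<Sum>u | length u = k. ?D n u * f (corner p u 1))\<bar> / real n \<le>
       ((\<Sum>u | length u = k. ?D n u * (e + C * spread p u)) + c) / real n"
      by (rule divide_right_mono) simp
    also have "\<dots> = b n" by (simp add: b_def add_divide_distrib sum_divide_distrib)
    also have "\<bar>R - (\<Sum>u | length u = k. ?D n u * f (corner p u 1))\<bar> / real n = \<bar>R / real n - g n\<bar>"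
      by (simp add: g_def diff_divide_distrib[symmetric] sum_divide_distrib[symmetric])
    finally have "\<bar>R / real n - g n\<bar> \<le> b n" .
    moreover have "6 * e = r" by (simp add: e_def)
    ultimately have "\<bar>R / real n - integral\<^sup>L N f\<bar> < r" using n0[OF n] G CX e by linarith
    then show "norm ((\<Sum>j<n. f (inner_vertex p (split_leaf x y j))) / real n - integral\<^sup>L N f) < r"
      by (simp add: R_def)
  qed
qed

section \<open>Empirical frequencies\<close>

text \<open>For variables with values in [0,1], Hoeffding's inequality bounds the probability of a
  deviation by a geometric sequence, and Borel-Cantelli makes deviations of each fixed size finite
  in number.\<close>

lemma (in prob_space) average_of_indep_bounded_converges:
  fixes X :: "nat \<Rightarrow> 'a \<Rightarrow> real"
  assumes X: "indep_vars (\<lambda>_. borel) X {1..}" and bd: "\<And>k. k \<ge> 1 \<Longrightarrow> AE \<omega> in M. X k \<omega> \<in> {0..1}"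
    and m: "\<And>k. k \<ge> 1 \<Longrightarrow> expectation (X k) = m"
  shows "AE \<omega> in M. (\<lambda>n. (\<Sum>k=1..n. X k \<omega>) / real n) \<longlonglongrightarrow> m"
proof -
  have [measurable]: "random_variable borel (X k)" if "k \<ge> 1" for k
    using X that by (auto simp: indep_vars_def)
  have [measurable]: "(\<lambda>\<omega>. \<Sum>k=1..n. X k \<omega>) \<in> borel_measurable M" for n
    by (rule borel_measurable_sum) auto
  have ev: "AE \<omega> in M. eventually (\<lambda>n. \<bar>(\<Sum>k=1..n. X k \<omega>) / real n - m\<bar> < e) sequentially" if e: "e > 0" for e
  proof -
    define A where "A n = {\<omega> \<in> space M. \<bar>(\<Sum>k=1..n. X k \<omega>) - real n * m\<bar> \<ge> real n * e}" for n
    have [measurable]: "A n \<in> sets M" for n unfolding A_def by measurable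
    have le: "prob (A n) \<le> 2 * exp (- 2 * e\<^sup>2) ^ n" for n
    proof (cases "n = 0")
      case False
      interpret H: Hoeffding_ineq M "{1..n}" X "\<lambda>_. 0" "\<lambda>_. 1" "\<Sum>k=1..n. expectation (X k)"
        by unfold_locales (use X bd in \<open>auto intro: indep_vars_subset\<close>)
      have "prob (A n) \<le> 2 * exp (- 2 * (real n * e)\<^sup>2 / (\<Sum>k=1..n. (1 - 0)\<^sup>2))"
        using H.Hoeffding_ineq_abs_ge[of "real n * e"] e False by (simp add: A_def m)
      also have "- 2 * (real n * e)\<^sup>2 / (\<Sum>k=1..n. (1 - 0)\<^sup>2) = real n * (- 2 * e\<^sup>2)"
        using False by (simp add: power2_eq_square field_simps)
      finally show ?thesis by (simp only: exp_of_nat_mult)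
    qed (auto intro: order_trans[OF prob_le_1])
    have "summable (\<lambda>n. 2 * exp (- 2 * e\<^sup>2) ^ n)"
      using e by (intro summable_mult summable_geometric) simp
    then have "summable (\<lambda>n. prob (A n))"
      by (rule summable_comparison_test') (simp only: real_norm_def abs_of_nonneg[OF measure_nonneg] le)
    then have "AE \<omega> in M. eventually (\<lambda>n. \<omega> \<in> space M - A n) sequentially"
      by (intro borel_cantelli_AE1) (auto simp: emeasure_eq_measure)
    then show ?thesis
    proof (rule AE_mp, intro AE_I2 impI)
      fix \<omega> assume "\<omega> \<in> space M" and ev: "eventually (\<lambda>n. \<omega> \<in> space M - A n) sequentially"
      show "eventually (\<lambda>n. \<bar>(\<Sum>k=1..n. X k \<omega>) / real n - m\<bar> < e) sequentially"
        using ev eventually_gt_at_top[of 0]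
      proof eventually_elim
        case (elim n)
        then have "\<bar>(\<Sum>k=1..n. X k \<omega>) - real n * m\<bar> / real n < e"
          by (simp add: A_def pos_divide_less_eq mult.commute not_le)
        also have "\<bar>(\<Sum>k=1..n. X k \<omega>) - real n * m\<bar> / real n = \<bar>((\<Sum>k=1..n. X k \<omega>) - real n * m) / real n\<bar>"
          by simp
        also have "((\<Sum>k=1..n. X k \<omega>) - real n * m) / real n = (\<Sum>k=1..n. X k \<omega>) / real n - m"
          using elim by (simp add: diff_divide_distrib)
        finally show ?case .
      qed
    qed
  qed
  have "AE \<omega> in M. \<forall>j. eventually (\<lambda>n. \<bar>(\<Sum>k=1..n. X k \<omega>) / real n - m\<bar> < 1 / real (Suc j)) sequentially"
    unfolding AE_all_countable by (intro allI ev) simp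
  then show ?thesis
  proof (rule AE_mp, intro AE_I2 impI)
    fix \<omega> assume *: "\<forall>j. eventually (\<lambda>n. \<bar>(\<Sum>k=1..n. X k \<omega>) / real n - m\<bar> < 1 / real (Suc j)) sequentially"
    show "(\<lambda>n. (\<Sum>k=1..n. X k \<omega>) / real n) \<longlonglongrightarrow> m"
    proof (rule tendstoI)
      fix e :: real assume "e > 0"
      then obtain j where j: "1 / real (Suc j) < e" using nat_approx_posE by blast
      show "eventually (\<lambda>n. dist ((\<Sum>k=1..n. X k \<omega>) / real n) m < e) sequentially"
        using *[rule_format, of j] by eventually_elim (use j in \<open>simp add: dist_real_def\<close>)
    qed
  qed
qed

text \<open>Convergence at rational points suffices, since both sides are monotone and the limit is
  continuous.\<close>

lemma empirical_cdf_limit: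
  fixes x :: "nat \<Rightarrow> real"
  assumes x: "\<And>k. x k \<in> {0..<1}"
    and lim: "\<And>q. q \<in> \<rat> \<Longrightarrow> 0 \<le> q \<Longrightarrow> q \<le> 1 \<Longrightarrow>
      (\<lambda>n. real (card {k. k < n \<and> x k < q}) / real n) \<longlonglongrightarrow> q"
    and a: "0 \<le> a" "a \<le> 1"
  shows "(\<lambda>n. real (card {k. k < n \<and> x k < a}) / real n) \<longlonglongrightarrow> a"
proof -
  let ?F = "\<lambda>a n. real (card {k. k < n \<and> x k < a}) / real n"
  have mono: "?F a n \<le> ?F b n" if "a \<le> b" for a b n
    using that by (intro divide_right_mono of_nat_mono card_mono) auto
  have le1: "?F b n \<le> 1" for b n
  proof -
    have "card {k. k < n \<and> x k < b} \<le> card {..<n}" by (rule card_mono) auto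
    then show ?thesis by (simp add: divide_le_eq_1) linarith
  qed
  show ?thesis
  proof (rule order_tendstoI)
    fix c assume c: "c < a"
    show "eventually (\<lambda>n. c < ?F a n) sequentially"
    \<comment> \<open>The convergence is known only at rationals in [0,1], and an interpolated
      rational is sure to lie there once bounds beyond the range of the frequencies are treated
      apart.\<close>
    proof (cases "c < 0")
      case True
      have "c < ?F a n" for n using True by (rule less_le_trans) simp
      then show ?thesis by simp
    next
      case False
      obtain q where q: "q \<in> \<rat>" "c < q" "q < a" using Rats_dense_in_real[OF c] by blast
      have "eventually (\<lambda>n. c < ?F q n) sequentially"
        using lim[of q] q False a by (intro order_tendstoD(1)) auto
      then show ?thesis by eventually_elim (use mono[of q a] q in \<open>auto intro: less_le_trans\<close>)
    qed
  next
    fix c assume c: "c > a"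
    show "eventually (\<lambda>n. ?F a n < c) sequentially"
    proof (cases "c > 1")
      case True
      have "?F a n < c" for n using le1 True by (rule le_less_trans)
      then show ?thesis by simp
    next
      case False
      obtain q where q: "q \<in> \<rat>" "a < q" "q < c" using Rats_dense_in_real[OF c] by blast
      have "eventually (\<lambda>n. ?F q n < c) sequentially"
        using lim[of q] q False a by (intro order_tendstoD(2)) auto
      then show ?thesis by eventually_elim (use mono[of a q] q in \<open>auto intro: le_less_trans\<close>)
    qed
  qed
qed

text \<open>The endpoints vary with the realisation, so convergence is needed at all real thresholds
  simultaneously. A half-open interval is a difference of two half-lines, which matches the strict
  inequality in the counts.\<close>

lemma frag_interval_frequency:
  assumes y: "weights y"
    and cdf: "\<And>a. 0 \<le> a \<Longrightarrow> a \<le> 1 \<Longrightarrow> (\<lambda>n. real (card {k. k < n \<and> x (Suc k) < a}) / real n) \<longlonglongrightarrow> a"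
  shows "(\<lambda>n. real (card {k. k < n \<and> x (Suc k) \<in> frag_interval y u}) / real n) \<longlonglongrightarrow> frag_length y u"
proof -
  obtain a b where ab: "interval_bounds y u = (a, b)" by fastforce
  have I: "frag_interval y u = {a..<b}" by (simp add: frag_interval_def ab)
  have "a < b" using frag_length_pos[OF y, of u] by (simp add: frag_length_def ab)
  have "{a..<b} \<subseteq> {0..<1}"
    using frag_interval_suffix[OF y, of "[]" u] by (simp add: I)
  with \<open>a < b\<close> have "0 \<le> a" "b \<le> 1" by (simp_all add: atLeastLessThan_subset_iff)
  have "real (card {k. k < n \<and> x (Suc k) \<in> frag_interval y u}) =
      real (card {k. k < n \<and> x (Suc k) < b}) - real (card {k. k < n \<and> x (Suc k) < a})" for n
  proof -
    have "{k. k < n \<and> x (Suc k) \<in> frag_interval y u} =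
        {k. k < n \<and> x (Suc k) < b} - {k. k < n \<and> x (Suc k) < a}"
      by (auto simp: I)
    then have "card {k. k < n \<and> x (Suc k) \<in> frag_interval y u} =
        card {k. k < n \<and> x (Suc k) < b} - card {k. k < n \<and> x (Suc k) < a}"
      using \<open>a < b\<close> by (simp add: card_Diff_subset subset_iff)
    moreover have "card {k. k < n \<and> x (Suc k) < a} \<le> card {k. k < n \<and> x (Suc k) < b}"
      using \<open>a < b\<close> by (intro card_mono) auto
    ultimately show ?thesis by simp
  qed
  then have "(\<lambda>n. real (card {k. k < n \<and> x (Suc k) \<in> frag_interval y u}) / real n) =
     (\<lambda>n. real (card {k. k < n \<and> x (Suc k) < b}) / real n - real (card {k. k < n \<and> x (Suc k) < a}) / real n)"
    by (simp add: diff_divide_distrib)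
  moreover have "\<dots> \<longlonglongrightarrow> b - a"
    using \<open>0 \<le> a\<close> \<open>b \<le> 1\<close> \<open>a < b\<close> by (intro tendsto_diff cdf) auto
  ultimately show ?thesis by (simp add: frag_length_def ab)
qed

text \<open>The law of large numbers is applied to indicators of half-lines with rational ends, so
  that the exceptional set remains null; passing to real ends is then deterministic.\<close>

lemma AE_empirical_cdf:
  fixes U :: "nat \<Rightarrow> 'w \<Rightarrow> real"
  assumes "prob_space M" and U: "iid M (uniform_measure lborel {0..<1}) U {1..}"
  shows "AE \<omega> in M. (\<forall>i\<ge>1. U i \<omega> \<in> {0..<1}) \<and>
    (\<forall>a. 0 \<le> a \<longrightarrow> a \<le> 1 \<longrightarrow> (\<lambda>n. real (card {k. k < n \<and> U (Suc k) \<omega> < a}) / real n) \<longlonglongrightarrow> a)"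
proof -
  interpret prob_space M by fact
  have U_indep: "indep_vars (\<lambda>_. borel) U {1..}"
    and U_distr: "\<And>i. i \<ge> 1 \<Longrightarrow> distr M borel (U i) = uniform_measure lborel {0..<1}"
    using U by (auto simp: iid_def)
  have mU: "U i \<in> borel_measurable M" if "i \<ge> 1" for i
    using U_indep that by (auto simp: indep_vars_def)
  have "AE \<omega> in M. U i \<omega> \<in> {0..<1}" if "i \<ge> 1" for i
  proof -
    have "AE x in distr M borel (U i). x \<in> {0..<1}"
      unfolding U_distr[OF that] by (rule AE_uniform_measureI) auto
    then show ?thesis by (rule AE_distrD[OF mU[OF that]])
  qed
  then have range: "AE \<omega> in M. \<forall>i\<in>{1..}. U i \<omega> \<in> {0..<1}"
    by (subst AE_ball_countable) auto
  have rat: "AE \<omega> in M. (\<lambda>n. real (card {k. k < n \<and> U (Suc k) \<omega> < q}) / real n) \<longlonglongrightarrow> q"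
    if q: "0 \<le> q" "q \<le> 1" for q :: real
  proof -
    define X where "X k \<omega> = (indicator {..<q} (U k \<omega>) :: real)" for k \<omega>
    have "indep_vars (\<lambda>_. borel) X {1..}"
      unfolding X_def by (rule indep_vars_compose2[OF U_indep]) auto
    moreover have "AE \<omega> in M. X k \<omega> \<in> {0..1}" for k
      by (simp add: X_def indicator_def)
    moreover have "expectation (X k) = q" if k: "k \<ge> 1" for k
    proof -
      have "expectation (X k) = (\<integral>x. indicator {..<q} x \<partial>distr M borel (U k))"
        unfolding X_def using mU[OF k] by (subst integral_distr) auto
      also have "\<dots> = measure (distr M borel (U k)) {..<q}" by simp
      also have "\<dots> = measure lborel ({0..<1} \<inter> {..<q}) / measure lborel {0..<1::real}"
        unfolding U_distr[OF k] by (rule measure_uniform_measure) auto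
      also have "{0..<1} \<inter> {..<q} = {0..<q}" using q by auto
      finally show ?thesis using q by simp
    qed
    ultimately have "AE \<omega> in M. (\<lambda>n. (\<Sum>k=1..n. X k \<omega>) / real n) \<longlonglongrightarrow> q"
      by (rule average_of_indep_bounded_converges)
    moreover have "(\<Sum>k=1..n. X k \<omega>) = real (card {k. k < n \<and> U (Suc k) \<omega> < q})" for n \<omega>
      by (simp add: X_def sum.atLeast1_atMost_eq indicator_def sum.If_cases Collect_conj_eq lessThan_def)
    ultimately show ?thesis by simp
  qed
  have "AE \<omega> in M. \<forall>q\<in>\<rat> \<inter> {0..1}. (\<lambda>n. real (card {k. k < n \<and> U (Suc k) \<omega> < q}) / real n) \<longlonglongrightarrow> q"
    using rat by (subst AE_ball_countable) (auto intro: countable_subset[OF _ countable_rat])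
  then show ?thesis
    using range
  proof eventually_elim
    case (elim \<omega>)
    show ?case
    proof (intro conjI allI impI)
      show "(\<lambda>n. real (card {k. k < n \<and> U (Suc k) \<omega> < a}) / real n) \<longlonglongrightarrow> a" if "0 \<le> a" "a \<le> 1" for a
      proof (rule empirical_cdf_limit[where x = "\<lambda>k. U (Suc k) \<omega>", OF _ _ that])
        show "U (Suc k) \<omega> \<in> {0..<1}" for k using elim(2) by simp
        show "(\<lambda>n. real (card {k. k < n \<and> U (Suc k) \<omega> < q}) / real n) \<longlonglongrightarrow> q"
          if "q \<in> \<rat>" "0 \<le> q" "q \<le> 1" for q using elim(1) that by simp
      qed
      show "U i \<omega> \<in> {0..<1}" if "i \<ge> 1" for i using elim(2) that by simp
    qed
  qed
qed

section \<open>Mean weights\<close>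

lemma AE_splitting_law:
  assumes "splitting_law \<nu>"
  shows "AE x in \<nu>. (\<forall>i. x $ i > 0) \<and> (\<Sum>i\<in>UNIV. x $ i) = 1"
proof -
  have "AE x in \<nu>. \<forall>i\<in>UNIV. x $ i > 0"
    using assms by (subst AE_ball_countable) (auto simp: splitting_law_def)
  moreover have "AE x in \<nu>. x $ 1 + x $ 2 + x $ 3 = 1"
    using assms by (simp add: splitting_law_def)
  ultimately show ?thesis by eventually_elim (simp add: sum_3)
qed

text \<open>The three equal means add up to the mean of the constant 1. With nonnegative integrals
  this equation itself excludes an infinite mean.\<close>

lemma mean_third:
  fixes D :: "(real ^ 3) measure"
  assumes "prob_space D" and sets: "sets D = sets borel"
    and AE: "AE x in D. (\<forall>i. x $ i > 0) \<and> (\<Sum>i\<in>UNIV. x $ i) = 1"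
    and eq: "\<And>i. (\<integral>\<^sup>+x. ennreal (x $ i) \<partial>D) = (\<integral>\<^sup>+x. ennreal (x $ 1) \<partial>D)"
  shows "(\<integral>\<^sup>+x. ennreal (x $ i) \<partial>D) = ennreal (1 / 3)"
proof -
  interpret prob_space D by fact
  have [measurable]: "(\<lambda>x. x $ i) \<in> borel_measurable D" for i
    using measurable_cong_sets[OF sets refl] borel_measurable_nth by blast
  define a where "a = (\<integral>\<^sup>+x. ennreal (x $ 1) \<partial>D)"
  have "(\<Sum>i\<in>(UNIV::3 set). a) = (\<Sum>i\<in>UNIV. \<integral>\<^sup>+x. ennreal (x $ i) \<partial>D)"
    unfolding a_def by (rule sum.cong[OF refl eq[symmetric]])
  also have "\<dots> = (\<integral>\<^sup>+x. (\<Sum>i\<in>UNIV. ennreal (x $ i)) \<partial>D)"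
    by (rule nn_integral_sum[symmetric]) auto
  also have "\<dots> = (\<integral>\<^sup>+x. 1 \<partial>D)"
    by (rule nn_integral_cong_AE, use AE in eventually_elim) (simp add: sum_ennreal less_imp_le)
  finally have 3: "3 * a = 1" by (simp add: emeasure_space_1)
  then have "a \<noteq> top" by (auto simp: ennreal_mult_top)
  then obtain r where r: "a = ennreal r" "r \<ge> 0" by (cases a) auto
  have "ennreal (3 * r) = ennreal 1" using 3 r by (simp add: ennreal_mult)
  then have "r = 1 / 3" using r(2) by (simp add: ennreal_eq_1)
  then show ?thesis using eq[of i] r by (simp add: a_def)
qed

lemma splitting_law_mean:
  assumes "splitting_law \<nu>"
  shows "(\<integral>\<^sup>+x. ennreal (x $ i) \<partial>\<nu>) = ennreal (1 / 3)"
proof (rule mean_third)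
  show "prob_space \<nu>" and sets: "sets \<nu> = sets borel" using assms by (auto simp: splitting_law_def)
  show "AE x in \<nu>. (\<forall>i. x $ i > 0) \<and> (\<Sum>i\<in>UNIV. x $ i) = 1" by (rule AE_splitting_law[OF assms])
  fix i :: 3
  \<comment> \<open>Exchanging i and 1 is the only symmetry needed to compare these two
    means.\<close>
  define \<pi> where "\<pi> = Transposition.transpose i (1::3)"
  have "bij \<pi>" unfolding \<pi>_def by (rule bij_transpose)
  then have "\<nu> = distr \<nu> borel (\<lambda>x. \<chi> i. x $ \<pi> i)" using assms by (simp add: splitting_law_def)
  then have "(\<integral>\<^sup>+x. ennreal (x $ i) \<partial>\<nu>) = (\<integral>\<^sup>+x. ennreal (x $ i) \<partial>distr \<nu> borel (\<lambda>x. \<chi> i. x $ \<pi> i))"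
    by simp
  also have "\<dots> = (\<integral>\<^sup>+x. ennreal ((\<chi> i. x $ \<pi> i) $ i) \<partial>\<nu>)"
  proof (rule nn_integral_distr)
    have "(\<lambda>x. \<chi> i. x $ \<pi> i) \<in> borel \<rightarrow>\<^sub>M (borel :: (real ^ 3) measure)"
      by (intro borel_measurable_continuous_onI continuous_intros)
    then show "(\<lambda>x. \<chi> i. x $ \<pi> i) \<in> \<nu> \<rightarrow>\<^sub>M borel"
      using measurable_cong_sets[OF sets refl] by blast
  qed measurable
  also have "\<dots> = (\<integral>\<^sup>+x. ennreal (x $ 1) \<partial>\<nu>)" by (simp add: \<pi>_def)
  finally show "(\<integral>\<^sup>+x. ennreal (x $ i) \<partial>\<nu>) = (\<integral>\<^sup>+x. ennreal (x $ 1) \<partial>\<nu>)" .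
qed

section \<open>Symmetry and means of the Dirichlet law\<close>

definition dirichlet2_density :: "real \<Rightarrow> real \<Rightarrow> real \<Rightarrow> ennreal" where
  "dirichlet2_density \<alpha> x y = ennreal (if x > 0 \<and> y > 0 \<and> x + y < 1
     then Gamma (3 * \<alpha>) / Gamma \<alpha> ^ 3 *
       (x powr (\<alpha> - 1) * y powr (\<alpha> - 1) * (1 - x - y) powr (\<alpha> - 1))
     else 0)"

lemma dirichlet2_density_measurable [measurable]:
  "(\<lambda>(x, y). dirichlet2_density \<alpha> x y) \<in> borel_measurable borel"
proof -
  have [measurable]: "fst \<in> borel_measurable (borel :: (real \<times> real) measure)"
    "snd \<in> borel_measurable (borel :: (real \<times> real) measure)"
    by (auto intro!: borel_measurable_continuous_onI continuous_intros)
  have "(\<lambda>z. dirichlet2_density \<alpha> (fst z) (snd z)) \<in> borel_measurable borel"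
    unfolding dirichlet2_density_def by measurable
  then show ?thesis by (simp add: split_beta')
qed

lemma dirichlet2_density_swap: "dirichlet2_density \<alpha> y x = dirichlet2_density \<alpha> x y"
proof -
  have "1 - y - x = 1 - x - y" by simp
  then show ?thesis
    unfolding dirichlet2_density_def by (simp only: conj_ac add.commute mult_ac)
qed

text \<open>This exchanges the second and third coordinates of the simplex point; together with the
  swap of the first two it generates all permutations.\<close>

lemma dirichlet2_density_reflect: "dirichlet2_density \<alpha> x (1 - x - y) = dirichlet2_density \<alpha> x y"
  by (auto simp: dirichlet2_density_def mult_ac)

lemma simplex_point_measurable [measurable]:
  "(\<lambda>(x, y). vector [x, y, 1 - x - y] :: real ^ 3) \<in> borel_measurable borel"
proof -
  have "(\<lambda>z. vector [fst z, snd z, 1 - fst z - snd z] \<bullet> b :: real) \<in> borel_measurable borel"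
    if "b \<in> (Basis :: (real ^ 3) set)" for b
  proof -
    have "\<exists>i. b = axis i 1" using that by (auto simp: Basis_vec_def)
    then obtain i where b: "b = axis i 1" by blast
    show ?thesis using exhaust_3[of i] by (auto simp: b inner_axis) (auto intro!: borel_measurable_continuous_onI continuous_intros)
  qed
  then have "(\<lambda>z. vector [fst z, snd z, 1 - fst z - snd z] :: real ^ 3) \<in> borel_measurable borel"
    by (subst borel_measurable_euclidean_space) blast
  then show ?thesis by (simp add: split_beta')
qed

lemma dirichlet2_distr_density:
  "dirichlet2 \<alpha> = distr (density lborel (\<lambda>(x, y). dirichlet2_density \<alpha> x y)) borel
     (\<lambda>(x, y). vector [x, y, 1 - x - y])"
  by (simp add: dirichlet2_def dirichlet2_density_def)

lemma AE_dirichlet2: "AE x in dirichlet2 \<alpha>. (\<forall>i. x $ i > 0) \<and> (\<Sum>i\<in>UNIV. x $ i) = 1"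
proof -
  let ?g = "case_prod (dirichlet2_density \<alpha>)"
  let ?v = "case_prod (\<lambda>x y. vector [x, y, 1 - x - y] :: real ^ 3)"
  have "?g z > 0 \<longrightarrow> (\<forall>i. ?v z $ i > 0) \<and> (\<Sum>i\<in>UNIV. ?v z $ i) = 1" for z
    by (auto simp: dirichlet2_density_def forall_3 sum_3 split: prod.splits if_splits)
  then have "AE z in density lborel ?g. (\<forall>i. ?v z $ i > 0) \<and> (\<Sum>i\<in>UNIV. ?v z $ i) = 1"
    by (subst AE_density) auto
  moreover have "{x :: real ^ 3. (\<forall>i. x $ i > 0) \<and> (\<Sum>i\<in>UNIV. x $ i) = 1} \<in> sets borel"
    unfolding forall_3 sum_3 by measurable
  ultimately show ?thesis
    unfolding dirichlet2_distr_density by (subst AE_distr_iff) simp_all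
qed

lemma nn_integral_dirichlet2:
  assumes [measurable]: "f \<in> borel_measurable borel"
  shows "(\<integral>\<^sup>+z. f z \<partial>dirichlet2 \<alpha>) =
    (\<integral>\<^sup>+x. \<integral>\<^sup>+y. dirichlet2_density \<alpha> x y * f (vector [x, y, 1 - x - y]) \<partial>lborel \<partial>lborel)"
proof -
  have "(\<integral>\<^sup>+z. f z \<partial>dirichlet2 \<alpha>) = (\<integral>\<^sup>+z. (case z of (x, y) \<Rightarrow> dirichlet2_density \<alpha> x y) *
      f (case z of (x, y) \<Rightarrow> vector [x, y, 1 - x - y]) \<partial>lborel)"
    unfolding dirichlet2_distr_density by (subst nn_integral_distr) (auto simp: nn_integral_density)
  also have "\<dots> = (\<integral>\<^sup>+x. \<integral>\<^sup>+y. (case (x, y) of (x, y) \<Rightarrow> dirichlet2_density \<alpha> x y) *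
      f (case (x, y) of (x, y) \<Rightarrow> vector [x, y, 1 - x - y]) \<partial>lborel \<partial>lborel)"
    unfolding lborel_prod[symmetric] by (rule lborel.nn_integral_fst[symmetric]) (simp add: lborel_prod)
  finally show ?thesis by simp
qed

text \<open>The first two means agree by Fubini and the swap symmetry, the last two by the
  substitution of 1 - x - y for y. Total mass one is a hypothesis, later supplied by a random
  variable with this law, so the Gamma factors are never evaluated.\<close>

lemma dirichlet2_mean:
  assumes "prob_space (dirichlet2 \<alpha>)"
  shows "(\<integral>\<^sup>+x. ennreal (x $ i) \<partial>dirichlet2 \<alpha>) = ennreal (1 / 3)"
proof (rule mean_third[OF assms])
  show "sets (dirichlet2 \<alpha>) = sets borel" by (simp add: dirichlet2_def)
  show "AE x in dirichlet2 \<alpha>. (\<forall>i. x $ i > 0) \<and> (\<Sum>i\<in>UNIV. x $ i) = 1" by (rule AE_dirichlet2)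
  let ?g = "dirichlet2_density \<alpha>"
  have [measurable]: "case_prod (\<lambda>x y. ?g x y * ennreal y) \<in> borel_measurable (lborel \<Otimes>\<^sub>M lborel)"
    using dirichlet2_density_measurable[of \<alpha>] unfolding borel_prod[symmetric] by measurable
  have gy [measurable]: "(\<lambda>y. ?g x y) \<in> borel_measurable borel" for x
    using measurable_compose[OF measurable_Pair1' dirichlet2_density_measurable[unfolded borel_prod[symmetric]], of x] by simp
  have mean: "(\<integral>\<^sup>+x. ennreal (x $ i) \<partial>dirichlet2 \<alpha>) = (\<integral>\<^sup>+x. \<integral>\<^sup>+y. ?g x y *
      ennreal ((vector [x, y, 1 - x - y] :: real ^ 3) $ i) \<partial>lborel \<partial>lborel)" for i
    by (rule nn_integral_dirichlet2) measurable
  have "(\<integral>\<^sup>+x. \<integral>\<^sup>+y. ?g x y * ennreal y \<partial>lborel \<partial>lborel) = (\<integral>\<^sup>+y. \<integral>\<^sup>+x. ?g x y * ennreal y \<partial>lborel \<partial>lborel)"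
    by (rule lborel_pair.Fubini') measurable
  then have 21: "(\<integral>\<^sup>+x. ennreal (x $ 2) \<partial>dirichlet2 \<alpha>) = (\<integral>\<^sup>+x. ennreal (x $ 1) \<partial>dirichlet2 \<alpha>)"
    unfolding mean by (simp add: dirichlet2_density_swap)
  have "(\<integral>\<^sup>+y. ?g x y * ennreal y \<partial>lborel) = (\<integral>\<^sup>+y. ?g x y * ennreal (1 - x - y) \<partial>lborel)" for x
  proof -
    have "(\<integral>\<^sup>+y. ?g x y * ennreal y \<partial>lborel) = \<bar>-1::real\<bar> *
        (\<integral>\<^sup>+y. ?g x (1 - x + (-1) * y) * ennreal (1 - x + (-1) * y) \<partial>lborel)"
      by (rule nn_integral_real_affine) auto
    then show ?thesis using dirichlet2_density_reflect[of \<alpha> x] by simp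
  qed
  then have 32: "(\<integral>\<^sup>+x. ennreal (x $ 3) \<partial>dirichlet2 \<alpha>) = (\<integral>\<^sup>+x. ennreal (x $ 2) \<partial>dirichlet2 \<alpha>)"
    unfolding mean by simp
  show "(\<integral>\<^sup>+x. ennreal (x $ i) \<partial>dirichlet2 \<alpha>) = (\<integral>\<^sup>+x. ennreal (x $ 1) \<partial>dirichlet2 \<alpha>)" for i
    using exhaust_3[of i] 21 32 by auto
qed

lemma countable_nodes: "countable (UNIV :: node set)"
proof -
  have "(UNIV :: node set) = (\<Union>k. {u. length u = k})" by auto
  then show ?thesis by (metis countable_UN countable_finite countableI_type finite_length_node(1))
qed

lemma AE_all_nodes:
  assumes "\<And>u :: node. AE \<omega> in M. Q u \<omega>"
  shows "AE \<omega> in M. \<forall>u. Q u \<omega>"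
  using AE_ball_countable[OF countable_nodes, of "\<lambda>\<omega> u. Q u \<omega>" M] assms by simp

lemma iid_measurable: "prob_space M \<Longrightarrow> iid M N X I \<Longrightarrow> i \<in> I \<Longrightarrow> X i \<in> borel_measurable M"
  by (auto simp: iid_def prob_space.indep_vars_def)

lemma AE_iid_weights:
  assumes "prob_space M" "iid M N X UNIV"
    and "AE x in N. (\<forall>i. x $ i > 0) \<and> (\<Sum>i\<in>UNIV. x $ i) = 1"
  shows "AE \<omega> in M. weights (\<lambda>v. X v \<omega>)"
  unfolding weights_def
proof (rule AE_all_nodes)
  fix u
  have "distr M borel (X u) = N" using assms(2) by (simp add: iid_def)
  then show "AE \<omega> in M. (\<forall>i. X u \<omega> $ i > 0) \<and> (\<Sum>i\<in>UNIV. X u \<omega> $ i) = 1"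
    using AE_distrD[OF iid_measurable[OF assms(1,2)]] assms(3) by blast
qed

section \<open>Mean spread\<close>

lemma (in prob_space) indep_var_nn_integral:
  fixes f g :: "'a \<Rightarrow> ennreal"
  assumes "indep_var borel f borel g"
  shows "(\<integral>\<^sup>+\<omega>. f \<omega> * g \<omega> \<partial>M) = (\<integral>\<^sup>+\<omega>. f \<omega> \<partial>M) * (\<integral>\<^sup>+\<omega>. g \<omega> \<partial>M)"
proof -
  have *: "case_bool borel borel = (\<lambda>_. borel :: ennreal measure)" by (auto split: bool.split)
  have "indep_vars (\<lambda>_. borel) (case_bool f g) UNIV"
    using assms unfolding indep_var_def * .
  from indep_vars_nn_integral[OF _ this] show ?thesis by (simp add: UNIV_bool mult.commute)
qed

lemma component_borel_measurable:
  "v \<in> A \<Longrightarrow> (\<lambda>p. p v) \<in> borel_measurable (\<Pi>\<^sub>M v\<in>A. borel)"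
  by (rule measurable_component_singleton)

text \<open>\<open>f\<close> is a function of the weights at the nodes that are shorter than \<open>u\<close>.\<close>

lemma (in prob_space) nn_integral_past_times_present:
  fixes X :: "node \<Rightarrow> 'a \<Rightarrow> real ^ 3"
  assumes X: "indep_vars (\<lambda>_. borel) X UNIV"
    and f: "f \<in> borel_measurable (\<Pi>\<^sub>M v\<in>{v. length v < length u}. borel)"
    and loc: "\<And>p. f (restrict p {v. length v < length u}) = f p"
    and g: "g \<in> borel_measurable borel"
  shows "(\<integral>\<^sup>+\<omega>. f (\<lambda>v. X v \<omega>) * g (X u \<omega>) \<partial>M) =
    (\<integral>\<^sup>+\<omega>. f (\<lambda>v. X v \<omega>) \<partial>M) * (\<integral>\<^sup>+\<omega>. g (X u \<omega>) \<partial>M :: ennreal)"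
proof (rule indep_var_nn_integral)
  let ?A = "{v :: node. length v < length u}"
  have gm: "(\<lambda>p. g (p u)) \<in> borel_measurable (\<Pi>\<^sub>M v\<in>{u}. borel)"
    by (rule measurable_compose[OF component_borel_measurable g]) simp
  have "indep_var (\<Pi>\<^sub>M v\<in>?A. borel) (\<lambda>\<omega>. restrict (\<lambda>v. X v \<omega>) ?A) (\<Pi>\<^sub>M v\<in>{u}. borel) (\<lambda>\<omega>. restrict (\<lambda>v. X v \<omega>) {u})"
    by (rule indep_var_restrict[OF X]) auto
  from indep_var_compose[OF this f gm]
  show "indep_var borel (\<lambda>\<omega>. f (\<lambda>v. X v \<omega>)) borel (\<lambda>\<omega>. g (X u \<omega>))"
    by (simp add: comp_def loc)
qed

text \<open>The extended nonnegative form of \<open>frag_length\<close>. It has the product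
  recursion for arbitrary arguments, whereas \<open>frag_length\<close> has it only for weights that
  add up to one, so independence can be applied without restricting to an event.\<close>

primrec weight_product :: "(node \<Rightarrow> real ^ 3) \<Rightarrow> node \<Rightarrow> ennreal" where
  "weight_product y [] = 1"
| "weight_product y (i # u) = weight_product y u * ennreal (y u $ i)"

lemma weight_product_frag_length: "weights y \<Longrightarrow> weight_product y u = ennreal (frag_length y u)"
  by (induction u) (simp_all add: frag_length_Cons ennreal_mult frag_length_pos weights_pos less_imp_le)

lemma weight_product_measurable:
  assumes "\<And>v. length v < length u \<Longrightarrow> (\<lambda>\<omega>. Y \<omega> v) \<in> borel_measurable M"
  shows "(\<lambda>\<omega>. weight_product (Y \<omega>) u) \<in> borel_measurable M"
  using assms
proof (induction u)
  case (Cons i u)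
  have "(\<lambda>\<omega>. weight_product (Y \<omega>) u) \<in> borel_measurable M" "(\<lambda>\<omega>. Y \<omega> u) \<in> borel_measurable M"
    using Cons by auto
  show ?case unfolding weight_product.simps
    by (intro borel_measurable_times_ennreal measurable_compose[OF _ measurable_ennreal]
        measurable_compose[OF _ borel_measurable_nth]) fact+
qed simp

lemma weight_product_local:
  "(\<And>v. length v < length u \<Longrightarrow> p v = q v) \<Longrightarrow> weight_product p u = weight_product q u"
  by (induction u) auto

lemma (in prob_space) weight_product_mean:
  assumes Y: "indep_vars (\<lambda>_. borel) Y UNIV"
    and mean: "\<And>u i. (\<integral>\<^sup>+\<omega>. ennreal (Y u \<omega> $ i) \<partial>M) = ennreal (1 / 3)"
  shows "(\<integral>\<^sup>+\<omega>. weight_product (\<lambda>v. Y v \<omega>) u \<partial>M) = ennreal (1 / 3) ^ length u"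
proof (induction u)
  case (Cons i u)
  have "(\<integral>\<^sup>+\<omega>. weight_product (\<lambda>v. Y v \<omega>) u * ennreal (Y u \<omega> $ i) \<partial>M) =
    (\<integral>\<^sup>+\<omega>. weight_product (\<lambda>v. Y v \<omega>) u \<partial>M) * (\<integral>\<^sup>+\<omega>. ennreal (Y u \<omega> $ i) \<partial>M)"
    by (rule nn_integral_past_times_present[OF Y, where f = "\<lambda>p. weight_product p u" and g = "\<lambda>w. ennreal (w $ i)"])
      (auto intro!: weight_product_measurable component_borel_measurable weight_product_local)
  then show ?case using Cons mean by (simp add: mult.commute)
qed (simp add: emeasure_space_1)

lemma corner_measurable:
  assumes "\<And>v. length v < length u \<Longrightarrow> (\<lambda>\<omega>. P \<omega> v) \<in> borel_measurable M"
  shows "(\<lambda>\<omega>. corner (P \<omega>) u j) \<in> borel_measurable M"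
  using assms
proof (induction u arbitrary: j)
  case Nil
  show ?case by (simp add: corner_def)
next
  case (Cons i u)
  have c: "(\<lambda>\<omega>. corner (P \<omega>) u j) \<in> borel_measurable M" and Pu: "(\<lambda>\<omega>. P \<omega> u) \<in> borel_measurable M" for j
    using Cons by auto
  have "(\<lambda>\<omega>. inner_vertex (P \<omega>) u) \<in> borel_measurable M"
    unfolding inner_vertex_bary bary_def
    by (intro borel_measurable_sum borel_measurable_scaleR c measurable_compose[OF Pu borel_measurable_nth])
  then show ?case unfolding corner_Cons using c by (cases "j = i") simp_all
qed

lemma corner_local:
  "(\<And>v. length v < length u \<Longrightarrow> p v = q v) \<Longrightarrow> corner p u j = corner q u j"
proof (induction u arbitrary: j)
  case (Cons i u)
  then have "corner p u j = corner q u j" "p u = q u" for j by auto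
  then show ?case by (simp add: corner_Cons inner_vertex_bary bary_def)
qed (simp add: corner_def)

lemma spread_measurable:
  assumes "\<And>v. length v < length u \<Longrightarrow> (\<lambda>\<omega>. P \<omega> v) \<in> borel_measurable M"
  shows "(\<lambda>\<omega>. spread (P \<omega>) u) \<in> borel_measurable M"
proof -
  have [measurable]: "(\<lambda>\<omega>. corner (P \<omega>) u j) \<in> borel_measurable M" for j
    using assms by (rule corner_measurable)
  show ?thesis unfolding spread_def by measurable
qed

text \<open>The vertices of \<open>u\<close> depend only on the weights at shorter words and are
  thus independent of \<open>P u\<close>, whose coordinates may be replaced by their means. The
  constant is 1 + 2 (1/3 + 1/3).\<close>

lemma (in prob_space) spread_children_mean:
  assumes P: "indep_vars (\<lambda>_. borel) P UNIV" and w: "AE \<omega> in M. weights (\<lambda>v. P v \<omega>)"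
    and mean: "\<And>u i. (\<integral>\<^sup>+\<omega>. ennreal (P u \<omega> $ i) \<partial>M) = ennreal (1 / 3)"
  shows "(\<Sum>i\<in>UNIV. \<integral>\<^sup>+\<omega>. ennreal (spread (\<lambda>v. P v \<omega>) (i # u)) \<partial>M) \<le>
    ennreal (7 / 3) * (\<integral>\<^sup>+\<omega>. ennreal (spread (\<lambda>v. P v \<omega>) u) \<partial>M)"
proof -
  have mP [measurable]: "random_variable borel (P v)" for v using P by (auto simp: indep_vars_def)
  have mPn [measurable]: "(\<lambda>\<omega>. P v \<omega> $ l) \<in> borel_measurable M" for v l
    by (rule measurable_compose[OF mP borel_measurable_nth])
  define E where "E i j p = ennreal ((norm (corner p u i - corner p u j))\<^sup>2)" for i j p
  have mS [measurable]: "(\<lambda>\<omega>. spread (\<lambda>v. P v \<omega>) u) \<in> borel_measurable M" for u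
    by (rule spread_measurable) simp
  have [measurable]: "(\<lambda>\<omega>. corner (\<lambda>v. P v \<omega>) u j) \<in> borel_measurable M" for j
    by (rule corner_measurable) simp
  have [measurable]: "(\<lambda>\<omega>. E i j (\<lambda>v. P v \<omega>)) \<in> borel_measurable M" for i j
    unfolding E_def by measurable
  have S: "ennreal (spread p u) = (\<Sum>i\<in>UNIV. \<Sum>j\<in>UNIV. E i j p)" for p
    by (simp add: spread_def E_def sum_ennreal sum_nonneg)
  have EP: "(\<integral>\<^sup>+\<omega>. E i j (\<lambda>v. P v \<omega>) * ennreal (P u \<omega> $ l) \<partial>M) =
      (\<integral>\<^sup>+\<omega>. E i j (\<lambda>v. P v \<omega>) \<partial>M) * ennreal (1 / 3)" for i j l
  proof -
    have "(\<integral>\<^sup>+\<omega>. E i j (\<lambda>v. P v \<omega>) * ennreal (P u \<omega> $ l) \<partial>M) =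
      (\<integral>\<^sup>+\<omega>. E i j (\<lambda>v. P v \<omega>) \<partial>M) * (\<integral>\<^sup>+\<omega>. ennreal (P u \<omega> $ l) \<partial>M)"
    proof (rule nn_integral_past_times_present[OF P, where f = "E i j" and g = "\<lambda>w. ennreal (w $ l)"])
      have [measurable]: "(\<lambda>p. corner p u j) \<in> borel_measurable (\<Pi>\<^sub>M v\<in>{v. length v < length u}. borel)" for j
        by (rule corner_measurable) (auto intro: component_borel_measurable)
      show "E i j \<in> borel_measurable (\<Pi>\<^sub>M v\<in>{v. length v < length u}. borel)"
        unfolding E_def by measurable
      show "E i j (restrict p {v. length v < length u}) = E i j p" for p
        using corner_local[of u "restrict p {v. length v < length u}" p] by (simp add: E_def)
    qed simp
    then show ?thesis by (simp only: mean)
  qed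
  have "(\<Sum>i\<in>UNIV. \<integral>\<^sup>+\<omega>. ennreal (spread (\<lambda>v. P v \<omega>) (i # u)) \<partial>M) =
      (\<integral>\<^sup>+\<omega>. (\<Sum>i\<in>UNIV. ennreal (spread (\<lambda>v. P v \<omega>) (i # u))) \<partial>M)"
    by (rule nn_integral_sum[symmetric]) measurable
  also have "\<dots> \<le> (\<integral>\<^sup>+\<omega>. ennreal (spread (\<lambda>v. P v \<omega>) u) + 2 * (\<Sum>i\<in>UNIV. \<Sum>j\<in>UNIV.
      E i j (\<lambda>v. P v \<omega>) * ennreal (P u \<omega> $ i) + E i j (\<lambda>v. P v \<omega>) * ennreal (P u \<omega> $ j)) \<partial>M)"
  proof (rule nn_integral_mono_AE, use w in eventually_elim)
    case (elim \<omega>)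
    let ?p = "\<lambda>v. P v \<omega>"
    have nn: "?p u $ i \<ge> 0" for i using weights_pos[OF elim, of u i] by simp
    have "(\<Sum>i\<in>UNIV. ennreal (spread ?p (i # u))) = ennreal (\<Sum>i\<in>UNIV. spread ?p (i # u))"
      by (simp add: sum_ennreal spread_nonneg)
    also have "\<dots> \<le> ennreal (spread ?p u +
        2 * (\<Sum>i\<in>UNIV. \<Sum>j\<in>UNIV. (?p u $ i + ?p u $ j) * (norm (corner ?p u i - corner ?p u j))\<^sup>2))"
      by (rule ennreal_leI[OF sum_spread_children[OF elim]])
    also have "\<dots> = ennreal (spread ?p u) + 2 * (\<Sum>i\<in>UNIV. \<Sum>j\<in>UNIV.
       ennreal ((?p u $ i + ?p u $ j) * (norm (corner ?p u i - corner ?p u j))\<^sup>2))"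
      using nn by (simp add: ennreal_plus ennreal_mult sum_ennreal[symmetric] sum_nonneg spread_nonneg del: sum_ennreal)
    also have "(\<Sum>i\<in>UNIV. \<Sum>j\<in>UNIV. ennreal ((?p u $ i + ?p u $ j) * (norm (corner ?p u i - corner ?p u j))\<^sup>2)) =
       (\<Sum>i\<in>UNIV. \<Sum>j\<in>UNIV. E i j ?p * ennreal (?p u $ i) + E i j ?p * ennreal (?p u $ j))"
      using nn by (intro sum.cong refl) (simp add: E_def ennreal_mult[symmetric] ennreal_plus[symmetric] algebra_simps del: ennreal_plus)
    finally show ?case .
  qed
  also have "\<dots> = (\<integral>\<^sup>+\<omega>. ennreal (spread (\<lambda>v. P v \<omega>) u) \<partial>M) + 2 * (\<Sum>i\<in>UNIV. \<Sum>j\<in>UNIV.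
      (\<integral>\<^sup>+\<omega>. E i j (\<lambda>v. P v \<omega>) \<partial>M) * ennreal (1 / 3) + (\<integral>\<^sup>+\<omega>. E i j (\<lambda>v. P v \<omega>) \<partial>M) * ennreal (1 / 3))"
  proof -
    let ?F = "\<lambda>i j \<omega>. E i j (\<lambda>v. P v \<omega>) * ennreal (P u \<omega> $ i) + E i j (\<lambda>v. P v \<omega>) * ennreal (P u \<omega> $ j)"
    have m: "(\<lambda>\<omega>. E i j (\<lambda>v. P v \<omega>) * ennreal (P u \<omega> $ l)) \<in> borel_measurable M" for i j l by measurable
    have "(\<integral>\<^sup>+\<omega>. ?F i j \<omega> \<partial>M) = (\<integral>\<^sup>+\<omega>. E i j (\<lambda>v. P v \<omega>) \<partial>M) * ennreal (1 / 3) + (\<integral>\<^sup>+\<omega>. E i j (\<lambda>v. P v \<omega>) \<partial>M) * ennreal (1 / 3)" for i j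
      unfolding nn_integral_add[OF m m] EP ..
    moreover have "(\<integral>\<^sup>+\<omega>. (\<Sum>i\<in>UNIV. \<Sum>j\<in>UNIV. ?F i j \<omega>) \<partial>M) = (\<Sum>i\<in>UNIV. \<Sum>j\<in>UNIV. \<integral>\<^sup>+\<omega>. ?F i j \<omega> \<partial>M)"
      by (subst nn_integral_sum, measurable, intro sum.cong refl nn_integral_sum, measurable)
    moreover have "(\<integral>\<^sup>+\<omega>. ennreal (spread (\<lambda>v. P v \<omega>) u) + 2 * (\<Sum>i\<in>UNIV. \<Sum>j\<in>UNIV. ?F i j \<omega>) \<partial>M) =
       (\<integral>\<^sup>+\<omega>. ennreal (spread (\<lambda>v. P v \<omega>) u) \<partial>M) + 2 * (\<integral>\<^sup>+\<omega>. (\<Sum>i\<in>UNIV. \<Sum>j\<in>UNIV. ?F i j \<omega>) \<partial>M)"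
      by (subst nn_integral_add, measurable, subst nn_integral_cmult, measurable)
    ultimately show ?thesis by (simp only:)
  qed
  also have "\<dots> = (\<integral>\<^sup>+\<omega>. ennreal (spread (\<lambda>v. P v \<omega>) u) \<partial>M) + 2 * (ennreal (1 / 3) + ennreal (1 / 3)) *
      (\<Sum>i\<in>UNIV. \<Sum>j\<in>UNIV. \<integral>\<^sup>+\<omega>. E i j (\<lambda>v. P v \<omega>) \<partial>M)"
  proof -
    have "a * t + a * t = (t + t) * a" for a t :: ennreal
      by (metis distrib_left mult.commute)
    then show ?thesis by (simp only: sum_distrib_left mult.assoc)
  qed
  also have "(\<Sum>i\<in>UNIV. \<Sum>j\<in>UNIV. \<integral>\<^sup>+\<omega>. E i j (\<lambda>v. P v \<omega>) \<partial>M) = (\<integral>\<^sup>+\<omega>. ennreal (spread (\<lambda>v. P v \<omega>) u) \<partial>M)"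
  proof -
    have "(\<integral>\<^sup>+\<omega>. (\<Sum>i\<in>UNIV. \<Sum>j\<in>UNIV. E i j (\<lambda>v. P v \<omega>)) \<partial>M) = (\<Sum>i\<in>UNIV. \<Sum>j\<in>UNIV. \<integral>\<^sup>+\<omega>. E i j (\<lambda>v. P v \<omega>) \<partial>M)"
      by (subst nn_integral_sum, measurable, intro sum.cong refl nn_integral_sum, measurable)
    then show ?thesis by (simp only: S)
  qed
  also have "(\<integral>\<^sup>+\<omega>. ennreal (spread (\<lambda>v. P v \<omega>) u) \<partial>M) + 2 * (ennreal (1 / 3) + ennreal (1 / 3)) * (\<integral>\<^sup>+\<omega>. ennreal (spread (\<lambda>v. P v \<omega>) u) \<partial>M)
    = (1 + 2 * (ennreal (1 / 3) + ennreal (1 / 3))) * (\<integral>\<^sup>+\<omega>. ennreal (spread (\<lambda>v. P v \<omega>) u) \<partial>M)"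
    by (simp only: distrib_right mult_1)
  also have "1 + 2 * (ennreal (1 / 3) + ennreal (1 / 3)) = ennreal (1 + 2 * (1 / 3 + 1 / 3))"
    by (subst ennreal_plus, simp, simp, subst ennreal_mult, simp, simp, subst ennreal_plus)
      (simp_all del: ennreal_plus)
  also have "(1::real) + 2 * (1 / 3 + 1 / 3) = 7 / 3" by simp
  finally show ?thesis .
qed

lemma (in prob_space) sum_spread_mean:
  assumes P: "indep_vars (\<lambda>_. borel) P UNIV" and w: "AE \<omega> in M. weights (\<lambda>v. P v \<omega>)"
    and mean: "\<And>u i. (\<integral>\<^sup>+\<omega>. ennreal (P u \<omega> $ i) \<partial>M) = ennreal (1 / 3)"
  obtains c where "c \<ge> 0" "\<And>k. (\<Sum>u | length u = k. \<integral>\<^sup>+\<omega>. ennreal (spread (\<lambda>v. P v \<omega>) u) \<partial>M) \<le> ennreal c * ennreal (7 / 3) ^ k"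
proof -
  \<comment> \<open>The root triangle does not depend on the weights, so any argument serves
    here.\<close>
  define c where "c = spread undefined []"
  have c: "spread p [] = c" for p by (simp add: c_def spread_def corner_def)
  have "(\<Sum>u | length u = k. \<integral>\<^sup>+\<omega>. ennreal (spread (\<lambda>v. P v \<omega>) u) \<partial>M) \<le> ennreal c * ennreal (7 / 3) ^ k" for k
  proof (induction k)
    case 0
    then show ?case by (simp add: c emeasure_space_1)
  next
    case (Suc k)
    have "(\<Sum>u | length u = Suc k. \<integral>\<^sup>+\<omega>. ennreal (spread (\<lambda>v. P v \<omega>) u) \<partial>M) \<le>
       (\<Sum>u | length u = k. ennreal (7 / 3) * (\<integral>\<^sup>+\<omega>. ennreal (spread (\<lambda>v. P v \<omega>) u) \<partial>M))"
      unfolding sum_Cons_3 by (rule sum_mono[OF spread_children_mean[OF P w mean]])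
    also have "\<dots> = ennreal (7 / 3) * (\<Sum>u | length u = k. \<integral>\<^sup>+\<omega>. ennreal (spread (\<lambda>v. P v \<omega>) u) \<partial>M)"
      by (simp add: sum_distrib_left)
    also have "\<dots> \<le> ennreal (7 / 3) * (ennreal c * ennreal (7 / 3) ^ k)"
      by (rule mult_left_mono[OF Suc]) simp
    finally show ?case by (simp add: ac_simps)
  qed
  then show thesis using that[of c] spread_nonneg[of undefined "[]"] by (simp add: c_def)
qed

text \<open>The independence of the families is given for their sigma-algebras; a function
  measurable for one of these generates a smaller sigma-algebra, so the two functions are
  independent variables.\<close>

lemma (in prob_space) indep_set_nn_integral:
  fixes f g :: "'a \<Rightarrow> ennreal"
  assumes ind: "indep_set A B"
    and f: "f \<in> borel_measurable (sigma (space M) A)" and g: "g \<in> borel_measurable (sigma (space M) B)"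
    and A: "sigma_algebra (space M) A" and B: "sigma_algebra (space M) B"
  shows "(\<integral>\<^sup>+\<omega>. f \<omega> * g \<omega> \<partial>M) = (\<integral>\<^sup>+\<omega>. f \<omega> \<partial>M) * (\<integral>\<^sup>+\<omega>. g \<omega> \<partial>M)"
proof (rule indep_var_nn_integral)
  have AB: "A \<subseteq> events" "B \<subseteq> events" "\<And>a b. a \<in> A \<Longrightarrow> b \<in> B \<Longrightarrow> prob (a \<inter> b) = prob a * prob b"
    using ind unfolding indep_sets2_eq by blast+
  have sA: "sets (sigma (space M) A) = A" "space (sigma (space M) A) = space M"
    using sigma_algebra.sets_measure_of_eq[OF A] sigma_algebra.space_measure_of_eq[OF A] by auto
  have sB: "sets (sigma (space M) B) = B" "space (sigma (space M) B) = space M"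
    using sigma_algebra.sets_measure_of_eq[OF B] sigma_algebra.space_measure_of_eq[OF B] by auto
  have fA: "f -` S \<inter> space M \<in> A" if "S \<in> sets borel" for S
    using measurable_sets[OF f that] unfolding sA .
  have gB: "g -` S \<inter> space M \<in> B" if "S \<in> sets borel" for S
    using measurable_sets[OF g that] unfolding sB .
  have fs: "sigma_sets (space M) {f -` S \<inter> space M | S. S \<in> sets borel} \<subseteq> A"
    by (rule sigma_algebra.sigma_sets_subset[OF A]) (auto intro: fA)
  have gs: "sigma_sets (space M) {g -` S \<inter> space M | S. S \<in> sets borel} \<subseteq> B"
    by (rule sigma_algebra.sigma_sets_subset[OF B]) (auto intro: gB)
  have "f \<in> borel_measurable M" "g \<in> borel_measurable M"
    using fA gB AB(1,2) by (auto intro!: measurableI)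
  moreover have "indep_set (sigma_sets (space M) {f -` S \<inter> space M | S. S \<in> sets borel})
      (sigma_sets (space M) {g -` S \<inter> space M | S. S \<in> sets borel})"
    unfolding indep_sets2_eq
    using subset_trans[OF fs AB(1)] subset_trans[OF gs AB(2)] AB(3)[OF subsetD[OF fs] subsetD[OF gs]]
    by (intro conjI ballI)
  ultimately show "indep_var borel f borel g"
    unfolding indep_var_eq by (intro conjI)
qed

lemma generated_events_sigma:
  shows "sigma_algebra (space M) (generated_events M X I)"
    and "i \<in> I \<Longrightarrow> X i \<in> borel_measurable (sigma (space M) (generated_events M X I))"
proof -
  let ?G = "\<Union>i\<in>I. {X i -` A \<inter> space M | A. A \<in> sets borel}"
  have "?G \<subseteq> Pow (space M)" by auto
  then show *: "sigma_algebra (space M) (generated_events M X I)"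
    unfolding generated_events_def by (rule sigma_algebra_sigma_sets)
  show "X i \<in> borel_measurable (sigma (space M) (generated_events M X I))" if "i \<in> I"
  proof (rule measurableI)
    fix S :: "'c set" assume "S \<in> sets borel"
    then have "X i -` S \<inter> space M \<in> ?G" using that by blast
    then show "X i -` S \<inter> space (sigma (space M) (generated_events M X I)) \<in> sets (sigma (space M) (generated_events M X I))"
      using sigma_algebra.sets_measure_of_eq[OF *] sigma_algebra.space_measure_of_eq[OF *]
      by (simp add: generated_events_def sigma_sets.Basic)
  qed simp
qed

lemma AE_weighted_spread_small:
  fixes M :: "'w measure" and P Y :: "node \<Rightarrow> 'w \<Rightarrow> real ^ 3"
  assumes M: "prob_space M"
    and P: "prob_space.indep_vars M (\<lambda>_. borel) P UNIV" and wP: "AE \<omega> in M. weights (\<lambda>v. P v \<omega>)"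
    and meanP: "\<And>u i. (\<integral>\<^sup>+\<omega>. ennreal (P u \<omega> $ i) \<partial>M) = ennreal (1 / 3)"
    and Y: "prob_space.indep_vars M (\<lambda>_. borel) Y UNIV" and wY: "AE \<omega> in M. weights (\<lambda>v. Y v \<omega>)"
    and meanY: "\<And>u i. (\<integral>\<^sup>+\<omega>. ennreal (Y u \<omega> $ i) \<partial>M) = ennreal (1 / 3)"
    and ind: "prob_space.indep_set M (generated_events M Y UNIV) (generated_events M P UNIV)"
  shows "AE \<omega> in M. \<forall>d>0. \<exists>k. (\<Sum>u | length u = k. frag_length (\<lambda>v. Y v \<omega>) u * spread (\<lambda>v. P v \<omega>) u) < d"
proof -
  interpret prob_space M by fact
  obtain c where c: "c \<ge> 0" "\<And>k. (\<Sum>u | length u = k. \<integral>\<^sup>+\<omega>. ennreal (spread (\<lambda>v. P v \<omega>) u) \<partial>M) \<le> ennreal c * ennreal (7 / 3) ^ k"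
    using sum_spread_mean[OF P wP meanP] by blast
  define W where "W k \<omega> = (\<Sum>u | length u = k. weight_product (\<lambda>v. Y v \<omega>) u * ennreal (spread (\<lambda>v. P v \<omega>) u))" for k \<omega>
  have mv: "random_variable borel (Y v)" "random_variable borel (P v)" for v
    using Y P by (auto simp: indep_vars_def)
  have [measurable]: "(\<lambda>\<omega>. weight_product (\<lambda>v. Y v \<omega>) u) \<in> borel_measurable M"
    "(\<lambda>\<omega>. spread (\<lambda>v. P v \<omega>) u) \<in> borel_measurable M" for u
    using mv by (auto intro: weight_product_measurable spread_measurable)
  have [measurable]: "W k \<in> borel_measurable M" for k unfolding W_def by measurable
  have prod: "(\<integral>\<^sup>+\<omega>. weight_product (\<lambda>v. Y v \<omega>) u * ennreal (spread (\<lambda>v. P v \<omega>) u) \<partial>M) =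
     (\<integral>\<^sup>+\<omega>. weight_product (\<lambda>v. Y v \<omega>) u \<partial>M) * (\<integral>\<^sup>+\<omega>. ennreal (spread (\<lambda>v. P v \<omega>) u) \<partial>M)" for u
  proof (rule indep_set_nn_integral[OF ind])
    show "(\<lambda>\<omega>. weight_product (\<lambda>v. Y v \<omega>) u) \<in> borel_measurable (sigma (space M) (generated_events M Y UNIV))"
      by (rule weight_product_measurable) (rule generated_events_sigma(2)[OF UNIV_I])
    show "(\<lambda>\<omega>. ennreal (spread (\<lambda>v. P v \<omega>) u)) \<in> borel_measurable (sigma (space M) (generated_events M P UNIV))"
      by (intro measurable_compose[OF _ measurable_ennreal] spread_measurable) (rule generated_events_sigma(2)[OF UNIV_I])
  qed (rule generated_events_sigma)+
  have W_mean: "(\<integral>\<^sup>+\<omega>. W k \<omega> \<partial>M) \<le> ennreal (c * (7 / 9) ^ k)" for k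
  proof -
    have "(\<integral>\<^sup>+\<omega>. W k \<omega> \<partial>M) = (\<Sum>u | length u = k. \<integral>\<^sup>+\<omega>. weight_product (\<lambda>v. Y v \<omega>) u * ennreal (spread (\<lambda>v. P v \<omega>) u) \<partial>M)"
      unfolding W_def by (rule nn_integral_sum) measurable
    also have "\<dots> = (\<Sum>u | length u = k. ennreal (1 / 3) ^ k * (\<integral>\<^sup>+\<omega>. ennreal (spread (\<lambda>v. P v \<omega>) u) \<partial>M))"
      by (rule sum.cong) (simp_all add: prod weight_product_mean[OF Y meanY])
    also have "\<dots> = ennreal (1 / 3) ^ k * (\<Sum>u | length u = k. \<integral>\<^sup>+\<omega>. ennreal (spread (\<lambda>v. P v \<omega>) u) \<partial>M)"
      by (rule sum_distrib_left[symmetric])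
    also have "\<dots> \<le> ennreal (1 / 3) ^ k * (ennreal c * ennreal (7 / 3) ^ k)"
      by (rule mult_left_mono[OF c(2)]) simp
    also have "\<dots> = ennreal ((1 / 3) ^ k * (c * (7 / 3) ^ k))"
      using c(1) by (simp add: ennreal_power ennreal_mult[symmetric])
    also have "(1 / 3) ^ k * (c * (7 / 3) ^ k) = c * (7 / 9 :: real) ^ k"
      by (simp add: power_mult_distrib[symmetric] mult.left_commute)
    finally show ?thesis .
  qed
  \<comment> \<open>The infimum lies below every \<open>W k\<close>, so its mean lies below a null
    sequence. An infimum equal to zero already provides a level for each tolerance, and the
    \<open>W k\<close> themselves need not be shown to converge.\<close>
  have "(\<integral>\<^sup>+\<omega>. (INF k. W k \<omega>) \<partial>M) \<le> 0"
  proof (rule LIMSEQ_le_const)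
    have "(\<lambda>k. c * (7 / 9 :: real) ^ k) \<longlonglongrightarrow> c * 0"
      by (intro tendsto_intros LIMSEQ_power_zero) simp
    then show "(\<lambda>k. ennreal (c * (7 / 9) ^ k)) \<longlonglongrightarrow> 0"
      using tendsto_ennrealI by fastforce
    have "(\<integral>\<^sup>+\<omega>. (INF k. W k \<omega>) \<partial>M) \<le> ennreal (c * (7 / 9) ^ k)" for k
      by (rule order_trans[OF nn_integral_mono W_mean]) (rule INF_lower, simp)
    then show "\<exists>N. \<forall>k\<ge>N. (\<integral>\<^sup>+\<omega>. (INF k. W k \<omega>) \<partial>M) \<le> ennreal (c * (7 / 9) ^ k)" by blast
  qed
  then have "(\<integral>\<^sup>+\<omega>. (INF k. W k \<omega>) \<partial>M) = 0" by simp
  then have "AE \<omega> in M. (INF k. W k \<omega>) = 0"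
    by (subst (asm) nn_integral_0_iff_AE) auto
  then show ?thesis
    using wY
  proof eventually_elim
    case (elim \<omega>)
    have W: "W k \<omega> = ennreal (\<Sum>u | length u = k. frag_length (\<lambda>v. Y v \<omega>) u * spread (\<lambda>v. P v \<omega>) u)" for k
      unfolding W_def weight_product_frag_length[OF elim(2)]
      using frag_length_pos[OF elim(2), THEN less_imp_le] spread_nonneg
      by (subst sum_ennreal[symmetric]) (simp_all add: ennreal_mult)
    show ?case
    proof (intro allI impI)
      fix d :: real assume "d > 0"
      then have "(INF k. W k \<omega>) < ennreal d" using elim(1) by simp
      then obtain k where "W k \<omega> < ennreal d" unfolding INF_less_iff by blast
      then show "\<exists>k. (\<Sum>u | length u = k. frag_length (\<lambda>v. Y v \<omega>) u * spread (\<lambda>v. P v \<omega>) u) < d"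
        unfolding W by (intro exI[of _ k]) (simp add: ennreal_less_iff sum_nonneg frag_length_pos[OF elim(2), THEN less_imp_le] spread_nonneg)
    qed
  qed
qed

section \<open>Occupation measures\<close>

lemma scale_measure_density: "scale_measure r M = density M (\<lambda>_. r)"
  by (rule measure_eqI) (auto simp: emeasure_density nn_integral_cmult_indicator)

lemma
  assumes V: "finite V" "V \<subseteq> root_triangle"
  shows emeasure_occupation: "A \<in> sets (restrict_space borel root_triangle) \<Longrightarrow>
      emeasure (occupation_measure n V) A = (\<Sum>x\<in>V. ennreal (1 / real n) * indicator A x)"
    and integral_occupation: "continuous_on root_triangle f \<Longrightarrow>
      (\<integral>x. f x \<partial>occupation_measure n V) = (\<Sum>x\<in>V. f x) / real n"
    and prob_occupation: "card V = n \<Longrightarrow> n > 0 \<Longrightarrow> occupation_measure n V \<in> prob_measures_on root_triangle"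
proof -
  let ?R = "restrict_space borel root_triangle"
  have id: "(\<lambda>x. x) \<in> count_space V \<rightarrow>\<^sub>M ?R"
    using V by (auto simp: space_restrict_space)
  have emeas: "emeasure (occupation_measure n V) A = (\<Sum>x\<in>V. ennreal (1 / real n) * indicator A x)"
    if A: "A \<in> sets ?R" for A
  proof -
    have "emeasure (occupation_measure n V) A = ennreal (1 / real n) * emeasure (count_space V) (A \<inter> V)"
      unfolding occupation_measure_def by (simp add: emeasure_distr[OF id A])
    also have "emeasure (count_space V) (A \<inter> V) = (\<Sum>x\<in>V. indicator A x)"
      using V(1) by (simp add: indicator_def sum.If_cases Int_commute)
    finally show ?thesis by (simp only: sum_distrib_left)
  qed
  then show "A \<in> sets ?R \<Longrightarrow> emeasure (occupation_measure n V) A = (\<Sum>x\<in>V. ennreal (1 / real n) * indicator A x)" .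
  show "(\<integral>x. f x \<partial>occupation_measure n V) = (\<Sum>x\<in>V. f x) / real n" if f: "continuous_on root_triangle f"
  proof -
    have mf: "f \<in> borel_measurable ?R" by (rule borel_measurable_continuous_on_restrict[OF f])
    have "(\<integral>x. f x \<partial>occupation_measure n V) = (\<integral>x. 1 / real n * f x \<partial>distr (count_space V) ?R (\<lambda>x. x))"
      unfolding occupation_measure_def scale_measure_density
      by (subst integral_density) (use mf in auto)
    also have "\<dots> = (\<integral>x. 1 / real n * f x \<partial>count_space V)"
      by (rule integral_distr[OF id]) (use mf in auto)
    also have "\<dots> = (\<Sum>x\<in>V. 1 / real n * f x)" by (rule lebesgue_integral_count_space_finite[OF V(1)])
    finally show ?thesis by (simp add: sum_divide_distrib)
  qed
  show "occupation_measure n V \<in> prob_measures_on root_triangle" if n: "card V = n" "n > 0"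
  proof -
    have "emeasure (occupation_measure n V) root_triangle = of_nat n * ennreal (1 / real n)"
      using V n emeas[of root_triangle] sets.top[of ?R]
      by (simp add: space_restrict_space indicator_def sum.If_cases Int_absorb2 subset_iff)
    also have "\<dots> = 1" using n by (simp add: ennreal_of_nat_eq_real_of_nat ennreal_mult[symmetric])
    finally have "prob_space (occupation_measure n V)"
      by (intro prob_spaceI) (simp add: occupation_measure_def space_scale_measure space_restrict_space)
    then show ?thesis by (simp add: prob_measures_on_def space_prob_algebra occupation_measure_def)
  qed
qed

text \<open>Injectivity turns sums over the vertex set into sums over split times or over nodes. The
  last form has an index set that does not depend on the realisation, since a tree with n splits has
  internal nodes of length less than n; measurability can then be checked term by term.\<close>

lemma
  assumes p: "weights p" and y: "weights y" and x: "\<forall>i\<ge>1. x i \<in> {0..<1}"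
  shows internal_vertices_frag_tree:
      "internal_vertices (frag_tree n x y) p = (\<lambda>k. inner_vertex p (split_leaf x y k)) ` {..<n}"
    and internal_vertices_subset: "internal_vertices (frag_tree n x y) p \<subseteq> root_triangle"
    and card_internal_vertices: "card (internal_vertices (frag_tree n x y) p) = n"
    and sum_internal_vertices: "(\<Sum>z\<in>internal_vertices (frag_tree n x y) p. f z) = (\<Sum>k<n. f (inner_vertex p (split_leaf x y k)))"
    and sum_internal_vertices_bounded: "(\<Sum>z\<in>internal_vertices (frag_tree n x y) p. f z) =
       (\<Sum>u | length u < n. if u \<in> internal_nodes (frag_tree n x y) then f (inner_vertex p u) else 0)"
proof -
  show eq: "internal_vertices (frag_tree n x y) p = (\<lambda>k. inner_vertex p (split_leaf x y k)) ` {..<n}"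
    by (simp add: internal_vertices_def internal_nodes_frag_tree[OF y x] image_image)
  show "internal_vertices (frag_tree n x y) p \<subseteq> root_triangle"
    using inner_vertex_filled[OF p, of "[]"] by (auto simp: internal_vertices_def filled_triangle_Nil)
  have inj: "inj_on (\<lambda>k. inner_vertex p (split_leaf x y k)) {..<n}"
    using inj_compose[OF inj_inner_vertex[OF p] inj_split_leaf[OF y x]] by (auto simp: inj_on_def)
  then show "card (internal_vertices (frag_tree n x y) p) = n" unfolding eq by (simp add: card_image)
  show "(\<Sum>z\<in>internal_vertices (frag_tree n x y) p. f z) = (\<Sum>k<n. f (inner_vertex p (split_leaf x y k)))"
    unfolding eq by (simp add: sum.reindex[OF inj])
  have sub: "internal_nodes (frag_tree n x y) \<subseteq> {u. length u < n}"
  proof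
    fix u assume "u \<in> internal_nodes (frag_tree n x y)"
    then obtain k where k: "k < n" "u = split_leaf x y k"
      by (auto simp: internal_nodes_frag_tree[OF y x])
    have "u \<in> frag_tree k x y" using split_leaf_leaf[OF y x, of k] k(2) by (simp add: leaves_def)
    then have "length u \<le> k" by (rule frag_tree_length[OF y x])
    then show "u \<in> {u. length u < n}" using k(1) by simp
  qed
  have "inj_on (inner_vertex p) (internal_nodes (frag_tree n x y))"
    using inj_inner_vertex[OF p] by (rule inj_on_subset) simp
  then have "(\<Sum>z\<in>internal_vertices (frag_tree n x y) p. f z) = (\<Sum>u\<in>internal_nodes (frag_tree n x y). f (inner_vertex p u))"
    unfolding internal_vertices_def by (rule sum.reindex[THEN trans]) (simp add: comp_def)
  also have "\<dots> = (\<Sum>u | length u < n. if u \<in> internal_nodes (frag_tree n x y) then f (inner_vertex p u) else 0)"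
    using sub by (intro sum.mono_neutral_cong_left) auto
  finally show "(\<Sum>z\<in>internal_vertices (frag_tree n x y) p. f z) =
       (\<Sum>u | length u < n. if u \<in> internal_nodes (frag_tree n x y) then f (inner_vertex p u) else 0)" .
qed

text \<open>This removes the definite description: a new word enters exactly when its parent is a
  leaf whose interval contains the new point. Membership thereby becomes a finite combination of
  simpler events.\<close>

lemma frag_tree_mem_Suc:
  assumes y: "weights y" and x: "\<forall>i\<ge>1. x i \<in> {0..<1}"
  shows "u \<in> frag_tree (Suc k) x y \<longleftrightarrow> u \<in> frag_tree k x y \<or>
    (u \<noteq> [] \<and> tl u \<in> frag_tree k x y \<and> (\<forall>i. i # tl u \<notin> frag_tree k x y) \<and> x (Suc k) \<in> frag_interval y (tl u))"
proof -
  have "l = split_leaf x y k \<longleftrightarrow> l \<in> leaves (frag_tree k x y) \<and> x (Suc k) \<in> frag_interval y l" for l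
    using frag_tree_leaf_ex1[OF y x, of "x (Suc k)" k] x split_leaf_leaf[OF y x, of k] split_leaf_interval[OF y x, of k]
    by auto
  then show ?thesis
    unfolding frag_tree_Suc by (cases u) (auto simp: leaves_def)
qed

lemma interval_bounds_measurable:
  assumes "\<And>v. (\<lambda>\<omega>. Y v \<omega>) \<in> borel_measurable M"
  shows "(\<lambda>\<omega>. fst (interval_bounds (\<lambda>v. Y v \<omega>) u)) \<in> borel_measurable M \<and>
    (\<lambda>\<omega>. snd (interval_bounds (\<lambda>v. Y v \<omega>) u)) \<in> borel_measurable M"
proof (induction u)
  case (Cons i u)
  then have [measurable]: "(\<lambda>\<omega>. fst (interval_bounds (\<lambda>v. Y v \<omega>) u)) \<in> borel_measurable M"
    "(\<lambda>\<omega>. snd (interval_bounds (\<lambda>v. Y v \<omega>) u)) \<in> borel_measurable M" by auto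
  have [measurable]: "(\<lambda>\<omega>. Y u \<omega> $ j) \<in> borel_measurable M" for j
    by (rule measurable_compose[OF assms borel_measurable_nth])
  show ?case using exhaust_3[of i] by (auto simp: Let_def split_beta)
qed simp

text \<open>The restriction to \<open>G\<close> is essential to the argument, since only there does
  the description of the split leaf denote a unique leaf.\<close>

lemma frag_tree_measurable:
  assumes Y: "\<And>v. (\<lambda>\<omega>. Y v \<omega>) \<in> borel_measurable M" and U: "\<And>i. i \<ge> 1 \<Longrightarrow> U i \<in> borel_measurable M"
    and G: "G \<in> sets M" "\<And>\<omega>. \<omega> \<in> G \<Longrightarrow> weights (\<lambda>v. Y v \<omega>) \<and> (\<forall>i\<ge>1. U i \<omega> \<in> {0..<1})"
  shows "{\<omega> \<in> G. u \<in> frag_tree k (\<lambda>i. U i \<omega>) (\<lambda>v. Y v \<omega>)} \<in> sets M"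
proof (induction k arbitrary: u)
  case 0
  then show ?case using G by simp
next
  case (Suc k)
  let ?t = "\<lambda>k \<omega>. frag_tree k (\<lambda>i. U i \<omega>) (\<lambda>v. Y v \<omega>)"
  define S where "S u = {\<omega> \<in> G. u \<in> ?t k \<omega>}" for u
  have S [measurable]: "S u \<in> sets M" for u unfolding S_def by (rule Suc)
  have [measurable]: "(\<lambda>\<omega>. fst (interval_bounds (\<lambda>v. Y v \<omega>) u)) \<in> borel_measurable M"
    "(\<lambda>\<omega>. snd (interval_bounds (\<lambda>v. Y v \<omega>) u)) \<in> borel_measurable M" for u
    using interval_bounds_measurable[of Y M u, OF Y] by auto
  have [measurable]: "U (Suc k) \<in> borel_measurable M" by (rule U) simp
  define I where "I = {\<omega> \<in> space M. U (Suc k) \<omega> \<in> frag_interval (\<lambda>v. Y v \<omega>) (tl u)}"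
  have I [measurable]: "I \<in> sets M"
    unfolding I_def frag_interval_def split_beta Let_def atLeastLessThan_iff by measurable
  have "{\<omega> \<in> G. u \<in> ?t (Suc k) \<omega>} = S u \<union> (if u = [] then {} else (S (tl u) \<inter> I) - (\<Union>i\<in>UNIV. S (i # tl u)))"
    using frag_tree_mem_Suc G sets.sets_into_space[OF G(1)] by (auto simp: S_def I_def simp del: frag_tree.simps)
  also have "\<dots> \<in> sets M" by auto
  finally show ?case .
qed

text \<open>Outside \<open>G\<close> the value is the Dirac mass at the vertex 0, a fixed element of
  the target space. On \<open>G\<close> the mass of a set is a finite sum over words of measurable
  indicators.\<close>

proposition occupation_measure_measurable:
  assumes P: "\<And>v. (\<lambda>\<omega>. P v \<omega>) \<in> borel_measurable M"
    and Y: "\<And>v. (\<lambda>\<omega>. Y v \<omega>) \<in> borel_measurable M" and U: "\<And>i. i \<ge> 1 \<Longrightarrow> U i \<in> borel_measurable M"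
    and G: "G \<in> sets M" "\<And>\<omega>. \<omega> \<in> G \<Longrightarrow> weights (\<lambda>v. P v \<omega>) \<and> weights (\<lambda>v. Y v \<omega>) \<and> (\<forall>i\<ge>1. U i \<omega> \<in> {0..<1})"
    and n: "n > 0"
  shows "(\<lambda>\<omega>. if \<omega> \<in> G
      then occupation_measure n (internal_vertices (frag_tree n (\<lambda>i. U i \<omega>) (\<lambda>v. Y v \<omega>)) (\<lambda>v. P v \<omega>))
      else return (restrict_space borel root_triangle) 0) \<in> M \<rightarrow>\<^sub>M prob_algebra (restrict_space borel root_triangle)"
    (is "?Z \<in> _")
proof -
  let ?R = "restrict_space borel root_triangle"
  let ?t = "\<lambda>\<omega>. frag_tree n (\<lambda>i. U i \<omega>) (\<lambda>v. Y v \<omega>)"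
  let ?V = "\<lambda>\<omega>. internal_vertices (?t \<omega>) (\<lambda>v. P v \<omega>)"
  have V: "finite (?V \<omega>)" "?V \<omega> \<subseteq> root_triangle" "card (?V \<omega>) = n" if "\<omega> \<in> G" for \<omega>
    using G(2)[OF that] internal_vertices_subset card_internal_vertices internal_vertices_frag_tree by auto
  have Z: "?Z \<omega> \<in> prob_measures_on root_triangle" for \<omega>
  proof (cases "\<omega> \<in> G")
    case True
    then show ?thesis using prob_occupation[OF V(1,2)[OF True] V(3)[OF True] n] by simp
  next
    case False
    have "0 \<in> space ?R" by (simp add: space_restrict_space root_triangle_def hull_inc)
    then have "prob_space (return ?R 0)" by (rule prob_space_return)
    then show ?thesis using False by (simp add: prob_measures_on_def space_prob_algebra)
  qed
  have mt: "{\<omega> \<in> G. u \<in> ?t \<omega>} \<in> sets M" for u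
    by (rule frag_tree_measurable[OF Y U G(1)]) (use G(2) in auto)
  have mint: "{\<omega> \<in> space M. \<omega> \<in> G \<and> u \<in> internal_nodes (?t \<omega>)} \<in> sets M" for u
  proof -
    have "{\<omega> \<in> space M. \<omega> \<in> G \<and> u \<in> internal_nodes (?t \<omega>)} = {\<omega> \<in> G. u \<in> ?t \<omega>} \<inter> (\<Inter>i\<in>UNIV. {\<omega> \<in> G. i # u \<in> ?t \<omega>})"
      using sets.sets_into_space[OF G(1)] by (auto simp: internal_nodes_def)
    also have "\<dots> \<in> sets M" using mt by (intro sets.Int sets.finite_INT) auto
    finally show ?thesis .
  qed
  have miv: "(\<lambda>\<omega>. inner_vertex (\<lambda>v. P v \<omega>) u) \<in> borel_measurable M" for u
  proof -
    \<comment> \<open>The inner vertex of u is the first vertex of its first child, so measurability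
      of vertices covers it.\<close>
    have "(\<lambda>\<omega>. corner (\<lambda>v. P v \<omega>) (1 # u) 1) \<in> borel_measurable M"
      by (rule corner_measurable) (rule P)
    then show ?thesis by (simp add: corner_Cons)
  qed
  show ?thesis
  proof (rule measurable_prob_algebraI)
    show "prob_space (?Z \<omega>)" for \<omega> using prob_measures_onD(1)[OF Z] .
    show "?Z \<in> M \<rightarrow>\<^sub>M subprob_algebra ?R"
    proof (rule measurable_subprob_algebra)
      show "subprob_space (?Z \<omega>)" for \<omega>
        using prob_measures_onD(1)[OF Z] by (rule prob_space_imp_subprob_space)
      show "sets (?Z \<omega>) = sets ?R" for \<omega> by (rule prob_measures_onD(2)[OF Z])
      fix A assume A: "A \<in> sets ?R"
      then have "A \<in> sets borel"
        using compact_root_triangle by (auto simp: sets_restrict_space intro: borel_compact)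
      define h where "h u \<omega> = (if \<omega> \<in> G \<and> u \<in> internal_nodes (?t \<omega>)
          then ennreal (1 / real n) * indicator A (inner_vertex (\<lambda>v. P v \<omega>) u) else 0)" for u \<omega>
      have mh: "h u \<in> borel_measurable M" for u
        unfolding h_def
      proof (rule measurable_If[OF _ _ mint])
        show "(\<lambda>\<omega>. ennreal (1 / real n) * indicator A (inner_vertex (\<lambda>v. P v \<omega>) u)) \<in> borel_measurable M"
          by (intro borel_measurable_times_ennreal borel_measurable_const
              measurable_compose[OF miv borel_measurable_indicator] \<open>A \<in> sets borel\<close>)
      qed simp
      have "emeasure (?Z \<omega>) A = (if \<omega> \<in> G then (\<Sum>u | length u < n. h u \<omega>) else indicator A 0)" for \<omega>
      proof (cases "\<omega> \<in> G")
        case True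
        have w: "weights (\<lambda>v. P v \<omega>)" "weights (\<lambda>v. Y v \<omega>)" "\<forall>i\<ge>1. U i \<omega> \<in> {0..<1}"
          using G(2)[OF True] by auto
        show ?thesis
          using emeasure_occupation[OF V(1,2)[OF True] A, of n] True
          unfolding sum_internal_vertices_bounded[OF w] by (simp add: h_def)
      qed (simp add: A)
      moreover have "(\<lambda>\<omega>. if \<omega> \<in> G then (\<Sum>u | length u < n. h u \<omega>) else indicator A 0) \<in> borel_measurable M"
      proof (rule measurable_If)
        have "{\<omega> \<in> space M. \<omega> \<in> G} = G" using sets.sets_into_space[OF G(1)] by auto
        then show "{\<omega> \<in> space M. \<omega> \<in> G} \<in> sets M" using G(1) by simp
      qed (auto intro: borel_measurable_sum mh)
      ultimately show "(\<lambda>\<omega>. emeasure (?Z \<omega>) A) \<in> borel_measurable M" by (simp only:)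
    qed
  qed
qed

section \<open>Almost sure convergence of the occupation measures\<close>

theorem theorem4p5:
  fixes M :: "'w measure"
    and \<nu> :: "(real ^ 3) measure"
    and P :: "node \<Rightarrow> 'w \<Rightarrow> real ^ 3"
    and U :: "nat \<Rightarrow> 'w \<Rightarrow> real"
    and Y :: "node \<Rightarrow> 'w \<Rightarrow> real ^ 3"
    and \<mu> :: "'w \<Rightarrow> complex measure"
  assumes "prob_space M"
    and "splitting_law \<nu>"
    and "iid M \<nu> P UNIV"
    and "iid M (uniform_measure lborel {0..<1}) U {1..}"
    and "iid M (dirichlet2 (1 / 2)) Y UNIV"
    and "prob_space.indep_sets M
           (\<lambda>k :: 3. if k = 1 then generated_events M P UNIV
                     else if k = 2 then generated_events M U {1..}
                     else generated_events M Y UNIV) UNIV"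
    and "\<mu> \<in> M \<rightarrow>\<^sub>M prob_algebra (restrict_space borel root_triangle)"
    and "AE \<omega> in M. \<forall>u.
           measure (\<mu> \<omega>) (filled_triangle (\<lambda>v. P v \<omega>) u) =
             measure lborel (frag_interval (\<lambda>v. Y v \<omega>) u) \<and>
           measure (\<mu> \<omega>) (frontier (filled_triangle (\<lambda>v. P v \<omega>) u)) = 0"
  shows "converges_in_distribution M (weak_topology root_triangle)
           (\<lambda>n. \<lambda>\<omega>. occupation_measure (Suc n)
              (internal_vertices (frag_tree (Suc n) (\<lambda>i. U i \<omega>) (\<lambda>v. Y v \<omega>)) (\<lambda>v. P v \<omega>)))
           \<mu>"
proof -
  interpret prob_space M by fact
  let ?S = "root_triangle"
  let ?t = "\<lambda>n \<omega>. frag_tree n (\<lambda>i. U i \<omega>) (\<lambda>v. Y v \<omega>)"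
  let ?V = "\<lambda>n \<omega>. internal_vertices (?t n \<omega>) (\<lambda>v. P v \<omega>)"
  have P: "indep_vars (\<lambda>_. borel) P UNIV" "distr M borel (P u) = \<nu>" for u
    using assms(3) by (auto simp: iid_def)
  have Y: "indep_vars (\<lambda>_. borel) Y UNIV" "distr M borel (Y u) = dirichlet2 (1 / 2)" for u
    using assms(5) by (auto simp: iid_def)
  have mP: "P u \<in> borel_measurable M" and mY: "Y u \<in> borel_measurable M" for u
    using iid_measurable[OF assms(1,3)] iid_measurable[OF assms(1,5)] by auto
  have mU: "U i \<in> borel_measurable M" if "i \<ge> 1" for i
    using iid_measurable[OF assms(1,4)] that by simp
  have wP: "AE \<omega> in M. weights (\<lambda>v. P v \<omega>)"
    by (rule AE_iid_weights[OF assms(1,3) AE_splitting_law[OF assms(2)]])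
  have wY: "AE \<omega> in M. weights (\<lambda>v. Y v \<omega>)"
    by (rule AE_iid_weights[OF assms(1,5) AE_dirichlet2])
  have mean_distr: "(\<integral>\<^sup>+\<omega>. ennreal (X \<omega> $ i) \<partial>M) = (\<integral>\<^sup>+x. ennreal (x $ i) \<partial>distr M borel X)"
    if "X \<in> borel_measurable M" for X :: "'w \<Rightarrow> real ^ 3" and i
    by (rule nn_integral_distr[OF that, symmetric]) simp
  have meanP: "(\<integral>\<^sup>+\<omega>. ennreal (P u \<omega> $ i) \<partial>M) = ennreal (1 / 3)" for u i
    unfolding mean_distr[OF mP] P(2) by (rule splitting_law_mean[OF assms(2)])
  have "prob_space (dirichlet2 (1 / 2))"
    using prob_space_distr[OF mY, of "[]"] by (simp add: Y(2))
  then have meanY: "(\<integral>\<^sup>+\<omega>. ennreal (Y u \<omega> $ i) \<partial>M) = ennreal (1 / 3)" for u i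
    unfolding mean_distr[OF mY] Y(2) by (rule dirichlet2_mean)
  have ind: "indep_set (generated_events M Y UNIV) (generated_events M P UNIV)"
  proof -
    let ?E = "\<lambda>k :: 3. if k = 1 then generated_events M P UNIV
       else if k = 2 then generated_events M U {1..} else generated_events M Y UNIV"
    have ev: "?E k \<subseteq> events" for k
      using assms(6) unfolding indep_sets_def by blast
    have "prob (a \<inter> b) = prob a * prob b"
      if "a \<in> generated_events M Y UNIV" "b \<in> generated_events M P UNIV" for a b
    proof -
      \<comment> \<open>Only the keys 1 and 3, those of the triangle weights and the interval
        weights, are selected.\<close>
      have "prob (\<Inter>j\<in>{1, 3}. if j = (1 :: 3) then b else a) = (\<Prod>j\<in>{1, 3}. prob (if j = (1 :: 3) then b else a))"
        by (rule indep_setsD[OF assms(6)]) (use that in auto)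
      then show ?thesis by (simp add: Int_commute mult.commute)
    qed
    then show ?thesis
      using ev[of 1] ev[of 3] unfolding indep_sets2_eq by simp
  qed
  have small: "AE \<omega> in M. \<forall>d>0. \<exists>k. (\<Sum>u | length u = k. frag_length (\<lambda>v. Y v \<omega>) u * spread (\<lambda>v. P v \<omega>) u) < d"
    by (rule AE_weighted_spread_small[OF assms(1) P(1) wP meanP Y(1) wY meanY ind])
  define good where "good \<omega> \<longleftrightarrow> weights (\<lambda>v. P v \<omega>) \<and> weights (\<lambda>v. Y v \<omega>) \<and> (\<forall>i\<ge>1. U i \<omega> \<in> {0..<1})" for \<omega>
  note cdf = AE_empirical_cdf[OF assms(1,4)]
  have "AE \<omega> in M. good \<omega>"
    using wP wY cdf by eventually_elim (simp add: good_def)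
  then obtain N where N: "{\<omega> \<in> space M. \<not> good \<omega>} \<subseteq> N" "emeasure M N = 0" "N \<in> sets M"
    by (rule AE_E)
  \<comment> \<open>A complement of a measurable null set, so that \<open>G\<close> is an event even
    though measurability of \<open>good\<close> is not established.\<close>
  define G where "G = space M - N"
  have G: "G \<in> sets M" "\<And>\<omega>. \<omega> \<in> G \<Longrightarrow> good \<omega>" using N by (auto simp: G_def)
  have AE_G: "AE \<omega> in M. \<omega> \<in> G"
    using N by (intro AE_I[of _ _ N]) (auto simp: G_def)
  define Z where "Z n \<omega> = (if \<omega> \<in> G then occupation_measure (Suc n) (?V (Suc n) \<omega>)
    else return (restrict_space borel ?S) 0)" for n \<omega>
  have mZ: "Z n \<in> M \<rightarrow>\<^sub>M prob_algebra (restrict_space borel ?S)" for n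
    unfolding Z_def by (rule occupation_measure_measurable[OF mP mY mU G(1)]) (use G(2) in \<open>auto simp: good_def\<close>)
  have ZX: "AE \<omega> in M. Z n \<omega> = occupation_measure (Suc n) (?V (Suc n) \<omega>)" for n
    using AE_G by eventually_elim (simp add: Z_def)
  have lim: "AE \<omega> in M. \<forall>f. continuous_on ?S f \<longrightarrow> (\<lambda>n. \<integral>x. f x \<partial>(Z n \<omega>)) \<longlonglongrightarrow> (\<integral>x. f x \<partial>(\<mu> \<omega>) :: real)"
    using AE_G AE_space cdf small assms(8)
  proof eventually_elim
    case (elim \<omega>)
    let ?p = "\<lambda>v. P v \<omega>" and ?y = "\<lambda>v. Y v \<omega>" and ?x = "\<lambda>i. U i \<omega>"
    have w: "weights ?p" "weights ?y" "\<forall>i\<ge>1. ?x i \<in> {0..<1}"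
      using G(2)[OF elim(1)] by (auto simp: good_def)
    have \<mu>: "\<mu> \<omega> \<in> prob_measures_on ?S"
      using measurable_space[OF assms(7) elim(2)] by (simp add: prob_measures_on_def)
    have meas: "measure (\<mu> \<omega>) (filled_triangle ?p u) = frag_length ?y u" for u
      using elim(5) measure_frag_interval[OF w(2)] by simp
    have cdf': "(\<lambda>n. real (card {k. k < n \<and> U (Suc k) \<omega> < a}) / real n) \<longlonglongrightarrow> a" if "0 \<le> a" "a \<le> 1" for a
      using elim(3) that by blast
    note freq = frag_interval_frequency[OF w(2), of ?x, OF cdf']
    show ?case
    proof (intro allI impI)
      fix f :: "complex \<Rightarrow> real" assume f: "continuous_on ?S f"
      have "(\<lambda>n. (\<Sum>j<n. f (inner_vertex ?p (split_leaf ?x ?y j))) / real n) \<longlonglongrightarrow> (\<integral>x. f x \<partial>(\<mu> \<omega>))"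
        using elim(4) by (intro occupation_integral_limit[OF w \<mu> meas freq _ f]) auto
      \<comment> \<open>The shift matches the indexing from n = 1, where the occupation measure is a
        probability measure.\<close>
      then have "(\<lambda>n. (\<Sum>j<Suc n. f (inner_vertex ?p (split_leaf ?x ?y j))) / real (Suc n)) \<longlonglongrightarrow> (\<integral>x. f x \<partial>(\<mu> \<omega>))"
        by (rule LIMSEQ_Suc)
      moreover have "(\<integral>x. f x \<partial>(Z n \<omega>)) = (\<Sum>j<Suc n. f (inner_vertex ?p (split_leaf ?x ?y j))) / real (Suc n)" for n
      proof -
        have "finite (?V (Suc n) \<omega>)" unfolding internal_vertices_frag_tree[OF w] by simp
        then show ?thesis
          using integral_occupation[OF _ internal_vertices_subset[OF w] f, of "Suc n" "Suc n"] elim(1)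
          by (simp only: Z_def if_True sum_internal_vertices[OF w])
      qed
      ultimately show "(\<lambda>n. \<integral>x. f x \<partial>(Z n \<omega>)) \<longlonglongrightarrow> (\<integral>x. f x \<partial>(\<mu> \<omega>))" by (simp only:)
    qed
  qed
  show ?thesis
    by (rule converges_in_distribution_weakI[OF assms(1) compact_root_triangle mZ assms(7) ZX lim])
qed

end
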